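(* Let $R$ be a Noetherian local ring of prime characteristic $p$ and let $M$ be a finitely generated $R$-module. If $M$ has FFRT, then $M$ has FFRT by an FFRT system.
   Context: All rings are commutative with unit. For a ring $R$ of prime characteristic $p$, an $R$-module $M$ and a positive integer $e$, $F_*^e(M)$ denotes the $R$-module which equals $M$ as an abelian group (the element corresponding to $m\in M$ is written $F_*^e(m)$) with scalar multiplication $rF_*^e(m)=F_*^e(r^{p^e}m)$ for $r\in R$, $m\in M$. Let $R$ be a Noetherian ring of prime characteristic $p$. A finitely generated $R$-module $M$ has finite F-representation type (FFRT) by a finite set $\{M_1,\dots,M_s\}$ of finitely generated $R$-modules if for every positive integer $e$ there are nonnegative integers $t_{(e,1)},\dots,t_{(e,s)}$ with $F_*^e(M)\cong\bigoplus_{j=1}^s M_j^{\oplus t_{(e,j)}}$ as $R$-modules. $M$ has FFRT if it has FFRT by some such finite set. A finite set $\Gamma$ of finitely generated $R$-modules is an FFRT system if for every $N\in\Gamma$, $F_*^1(N)$ is isomorphic to a finite direct sum whose direct summands are all taken from $\Gamma$. $M$ has FFRT by an FFRT system if there exists an FFRT system $\Gamma$ such that $M$ has FFRT by $\Gamma$. *)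

theory Defs
  imports "HOL-Algebra.Module" "HOL-Algebra.Ring_Divisibility" "HOL-Computational_Algebra.Primes"
begin

text \<open>A ring \<open>R\<close> has characteristic \<open>p\<close> iff \<open>p\<close> generates the kernel of \<open>\<int> \<rightarrow> R\<close>.\<close>
definition has_prime_char :: "('a, 'r) ring_scheme \<Rightarrow> nat \<Rightarrow> bool" where
  "has_prime_char R p \<longleftrightarrow> Factorial_Ring.prime p \<and> (\<forall>n::nat. add_pow R n \<one>\<^bsub>R\<^esub> = \<zero>\<^bsub>R\<^esub> \<longleftrightarrow> p dvd n)"

definition local_ring :: "('a, 'r) ring_scheme \<Rightarrow> bool" where
  "local_ring R \<longleftrightarrow> cring R \<and> (\<exists>!\<mm>. maximalideal \<mm> R)"

definition fg_module :: "('a, 'r) ring_scheme \<Rightarrow> ('a, 'b, 'm) module_scheme \<Rightarrow> bool" where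
  "fg_module R M \<longleftrightarrow> module R M \<and>
     (\<exists>A. finite A \<and> A \<subseteq> carrier M \<and>
        (\<forall>x\<in>carrier M. \<exists>c\<in>A \<rightarrow> carrier R. x = (\<Oplus>\<^bsub>M\<^esub>a\<in>A. c a \<odot>\<^bsub>M\<^esub> a)))"

definition module_iso ::
  "('a, 'r) ring_scheme \<Rightarrow> ('a, 'b, 'm) module_scheme \<Rightarrow> ('a, 'c, 'n) module_scheme \<Rightarrow> ('b \<Rightarrow> 'c) set" where
  "module_iso R M N = {f. bij_betw f (carrier M) (carrier N) \<and>
     (\<forall>x\<in>carrier M. \<forall>y\<in>carrier M. f (x \<oplus>\<^bsub>M\<^esub> y) = f x \<oplus>\<^bsub>N\<^esub> f y) \<and>
     (\<forall>r\<in>carrier R. \<forall>x\<in>carrier M. f (r \<odot>\<^bsub>M\<^esub> x) = r \<odot>\<^bsub>N\<^esub> f x)}"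

definition module_isomorphic ::
  "('a, 'r) ring_scheme \<Rightarrow> ('a, 'b, 'm) module_scheme \<Rightarrow> ('a, 'c, 'n) module_scheme \<Rightarrow> bool" where
  "module_isomorphic R M N \<longleftrightarrow> module_iso R M N \<noteq> {}"

text \<open>
  The direct product of a family of modules; it is used for finite \<open>I\<close> only, where it is the direct
  sum. The \<open>mult\<close> and \<open>one\<close> fields, which the module record inherits from the ring record, play no
  role for modules.
\<close>
definition direct_sum_module ::
  "'i set \<Rightarrow> ('i \<Rightarrow> ('a, 'b, 'm) module_scheme) \<Rightarrow> ('a, 'i \<Rightarrow> 'b) module" where
  "direct_sum_module I N =
     \<lparr>carrier = (\<Pi>\<^sub>E i\<in>I. carrier (N i)), monoid.mult = undefined, one = undefined,
      zero = (\<lambda>i\<in>I. \<zero>\<^bsub>N i\<^esub>), add = (\<lambda>x y. \<lambda>i\<in>I. x i \<oplus>\<^bsub>N i\<^esub> y i),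
      smult = (\<lambda>r x. \<lambda>i\<in>I. r \<odot>\<^bsub>N i\<^esub> x i)\<rparr>"

definition frobenius_pushforward ::
  "('a, 'r) ring_scheme \<Rightarrow> nat \<Rightarrow> nat \<Rightarrow> ('a, 'b, 'm) module_scheme \<Rightarrow> ('a, 'b, 'm) module_scheme" where
  "frobenius_pushforward R p e M = M\<lparr>smult := \<lambda>r m. (r [^]\<^bsub>R\<^esub> (p ^ e)) \<odot>\<^bsub>M\<^esub> m\<rparr>"

text \<open>The summand \<open>N\<close> occurs \<open>t N\<close> times, indexed by the pairs \<open>(N, k)\<close> with \<open>k < t N\<close>.\<close>
definition FFRT_by ::
  "('a, 'r) ring_scheme \<Rightarrow> nat \<Rightarrow> ('a, 'b, 'm) module_scheme \<Rightarrow> ('a, 'c) module set \<Rightarrow> bool" where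
  "FFRT_by R p M \<Gamma> \<longleftrightarrow> finite \<Gamma> \<and> (\<forall>N\<in>\<Gamma>. fg_module R N) \<and>
     (\<forall>e>0. \<exists>t :: ('a, 'c) module \<Rightarrow> nat.
        module_isomorphic R (frobenius_pushforward R p e M)
          (direct_sum_module (SIGMA N:\<Gamma>. {..<t N}) fst))"

definition FFRT_system :: "('a, 'r) ring_scheme \<Rightarrow> nat \<Rightarrow> ('a, 'c) module set \<Rightarrow> bool" where
  "FFRT_system R p \<Gamma> \<longleftrightarrow> finite \<Gamma> \<and> (\<forall>N\<in>\<Gamma>. fg_module R N) \<and>
     (\<forall>N\<in>\<Gamma>. \<exists>(n::nat) L. L \<in> {..<n} \<rightarrow> \<Gamma> \<and>
        module_isomorphic R (frobenius_pushforward R p 1 N) (direct_sum_module {..<n} L))"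

text \<open>
  Quantifying over all finitely generated \<open>R\<close>-modules requires a carrier type large enough for all
  of them. A quotient of \<open>R\<^sup>n\<close> consists of sets of tuples, so sets of functions \<open>nat \<Rightarrow> 'a\<close> suffice
  for every finitely generated module over a ring with elements in \<open>'a\<close>. The lemmas
  \<open>fg_module_representative\<close>, \<open>has_FFRT_I\<close> and \<open>has_FFRT_by_system_I\<close> below show that this choice
  loses no generality.
\<close>
type_synonym 'a fg_mod = "('a, (nat \<Rightarrow> 'a) set) module"

definition has_FFRT ::
  "('a, 'r) ring_scheme \<Rightarrow> nat \<Rightarrow> ('a, 'b, 'm) module_scheme \<Rightarrow> bool" where
  "has_FFRT R p M \<longleftrightarrow> (\<exists>\<Gamma> :: 'a fg_mod set. FFRT_by R p M \<Gamma>)"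

definition has_FFRT_by_system ::
  "('a, 'r) ring_scheme \<Rightarrow> nat \<Rightarrow> ('a, 'b, 'm) module_scheme \<Rightarrow> bool" where
  "has_FFRT_by_system R p M \<longleftrightarrow> (\<exists>\<Gamma> :: 'a fg_mod set. FFRT_system R p \<Gamma> \<and> FFRT_by R p M \<Gamma>)"


subsection \<open>Independence of the carrier type\<close>

lemma module_isomorphic_trans:
  assumes "module_isomorphic R M N" "module_isomorphic R N P"
  shows "module_isomorphic R M P"
proof -
  obtain f g where fg: "f \<in> module_iso R M N" "g \<in> module_iso R N P"
    using assms by (auto simp: module_isomorphic_def)
  have "f x \<in> carrier N" if "x \<in> carrier M" for x
    using fg(1) that by (auto simp: module_iso_def dest: bij_betwE)
  then have "g \<circ> f \<in> module_iso R M P"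
    using fg by (auto simp: module_iso_def intro: bij_betw_trans)
  then show ?thesis by (auto simp: module_isomorphic_def)
qed

lemma module_isomorphic_sym:
  assumes "module R M" "module_isomorphic R M N"
  shows "module_isomorphic R N M"
proof -
  interpret module R M by fact
  obtain f where f: "f \<in> module_iso R M N"
    using assms by (auto simp: module_isomorphic_def)
  define g where "g = inv_into (carrier M) f"
  have bij: "bij_betw f (carrier M) (carrier N)"
    using f by (simp add: module_iso_def)
  have g: "g y \<in> carrier M" "f (g y) = y" if "y \<in> carrier N" for y
    using bij that unfolding g_def
    by (metis bij_betw_def inv_into_into, metis bij_betw_inv_into_right)
  have gf: "g (f x) = x" if "x \<in> carrier M" for x
    using bij that unfolding g_def by (metis bij_betw_inv_into_left)
  have "g (x \<oplus>\<^bsub>N\<^esub> y) = g x \<oplus>\<^bsub>M\<^esub> g y" if "x \<in> carrier N" "y \<in> carrier N" for x y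
  proof -
    have "x \<oplus>\<^bsub>N\<^esub> y = f (g x \<oplus>\<^bsub>M\<^esub> g y)" using f g that by (simp add: module_iso_def)
    then show ?thesis using g that by (simp add: gf)
  qed
  moreover have "g (r \<odot>\<^bsub>N\<^esub> y) = r \<odot>\<^bsub>M\<^esub> g y" if "r \<in> carrier R" "y \<in> carrier N" for r y
  proof -
    have "r \<odot>\<^bsub>N\<^esub> y = f (r \<odot>\<^bsub>M\<^esub> g y)" using f g that by (simp add: module_iso_def)
    then show ?thesis using g that by (simp add: gf)
  qed
  ultimately have "g \<in> module_iso R N M"
    using bij_betw_inv_into[OF bij] by (simp add: module_iso_def g_def)
  then show ?thesis by (auto simp: module_isomorphic_def)
qed

lemma direct_sum_module_reindex:
  assumes b: "bij_betw b J I"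
    and iso: "\<And>j. j \<in> J \<Longrightarrow> module_isomorphic R (N (b j)) (N' j)"
  shows "module_isomorphic R (direct_sum_module I N) (direct_sum_module J N')"
proof -
  have "\<forall>j\<in>J. \<exists>f. f \<in> module_iso R (N (b j)) (N' j)"
    using iso by (auto simp: module_isomorphic_def)
  then obtain f where f: "\<And>j. j \<in> J \<Longrightarrow> f j \<in> module_iso R (N (b j)) (N' j)"
    by metis
  have bij: "bij_betw (f j) (carrier (N (b j))) (carrier (N' j))" if "j \<in> J" for j
    using f[OF that] by (simp add: module_iso_def)
  have bI: "b j \<in> I" if "j \<in> J" for j using b that by (auto dest: bij_betwE)
  define a where "a = inv_into J b"
  have a: "a i \<in> J" "b (a i) = i" if "i \<in> I" for i
    using b that unfolding a_def
    by (metis bij_betw_def inv_into_into, metis bij_betw_inv_into_right)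
  have ab: "a (b j) = j" if "j \<in> J" for j
    using b that unfolding a_def by (metis bij_betw_inv_into_left)
  define F where "F x = (\<lambda>j\<in>J. f j (x (b j)))" for x
  define G where "G y = (\<lambda>i\<in>I. inv_into (carrier (N i)) (f (a i)) (y (a i)))" for y
  have "bij_betw F (\<Pi>\<^sub>E i\<in>I. carrier (N i)) (\<Pi>\<^sub>E j\<in>J. carrier (N' j))"
  proof (rule bij_betw_byWitness[where f' = G])
    show "\<forall>x\<in>\<Pi>\<^sub>E i\<in>I. carrier (N i). G (F x) = x"
    proof
      fix x assume x: "x \<in> (\<Pi>\<^sub>E i\<in>I. carrier (N i))"
      show "G (F x) = x"
      proof
        fix i show "G (F x) i = x i"
        proof (cases "i \<in> I")
          case True
          then have "x i \<in> carrier (N i)" using x by auto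
          then show ?thesis using True a[OF True] bij[OF a(1)[OF True]]
            by (simp add: F_def G_def bij_betw_inv_into_left)
        qed (use x in \<open>auto simp: G_def PiE_def extensional_def\<close>)
      qed
    qed
    show "\<forall>y\<in>\<Pi>\<^sub>E j\<in>J. carrier (N' j). F (G y) = y"
    proof
      fix y assume y: "y \<in> (\<Pi>\<^sub>E j\<in>J. carrier (N' j))"
      show "F (G y) = y"
      proof
        fix j show "F (G y) j = y j"
        proof (cases "j \<in> J")
          case True
          then have "y j \<in> carrier (N' j)" using y by auto
          then show ?thesis using True bI[OF True] ab[OF True] bij[OF True]
            by (simp add: F_def G_def bij_betw_inv_into_right)
        qed (use y in \<open>auto simp: F_def PiE_def extensional_def\<close>)
      qed
    qed
    show "F ` (\<Pi>\<^sub>E i\<in>I. carrier (N i)) \<subseteq> (\<Pi>\<^sub>E j\<in>J. carrier (N' j))"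
    proof (rule image_subsetI)
      fix x assume x: "x \<in> (\<Pi>\<^sub>E i\<in>I. carrier (N i))"
      have "f j (x (b j)) \<in> carrier (N' j)" if "j \<in> J" for j
        using bij[OF that] bI[OF that] x by (meson PiE_mem bij_betwE)
      then show "F x \<in> (\<Pi>\<^sub>E j\<in>J. carrier (N' j))" by (simp add: F_def)
    qed
    show "G ` (\<Pi>\<^sub>E j\<in>J. carrier (N' j)) \<subseteq> (\<Pi>\<^sub>E i\<in>I. carrier (N i))"
    proof (rule image_subsetI)
      fix y assume y: "y \<in> (\<Pi>\<^sub>E j\<in>J. carrier (N' j))"
      have "inv_into (carrier (N i)) (f (a i)) (y (a i)) \<in> carrier (N i)" if "i \<in> I" for i
      proof -
        have "y (a i) \<in> carrier (N' (a i))" using y a[OF that] by auto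
        moreover have "bij_betw (f (a i)) (carrier (N i)) (carrier (N' (a i)))"
          using bij[OF a(1)[OF that]] a(2)[OF that] by simp
        ultimately show ?thesis by (metis bij_betw_def inv_into_into)
      qed
      then show "G y \<in> (\<Pi>\<^sub>E i\<in>I. carrier (N i))" by (simp add: G_def)
    qed
  qed
  moreover have "f j (x (b j) \<oplus>\<^bsub>N (b j)\<^esub> y (b j)) = f j (x (b j)) \<oplus>\<^bsub>N' j\<^esub> f j (y (b j))"
    if "x \<in> (\<Pi>\<^sub>E i\<in>I. carrier (N i))" "y \<in> (\<Pi>\<^sub>E i\<in>I. carrier (N i))" "j \<in> J" for x y j
    using f[OF that(3)] PiE_mem[OF that(1) bI[OF that(3)]] PiE_mem[OF that(2) bI[OF that(3)]]
    by (simp add: module_iso_def)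
  moreover have "f j (r \<odot>\<^bsub>N (b j)\<^esub> x (b j)) = r \<odot>\<^bsub>N' j\<^esub> f j (x (b j))"
    if "r \<in> carrier R" "x \<in> (\<Pi>\<^sub>E i\<in>I. carrier (N i))" "j \<in> J" for r x j
    using f[OF that(3)] PiE_mem[OF that(2) bI[OF that(3)]] that(1)
    by (simp add: module_iso_def)
  ultimately have "F \<in> module_iso R (direct_sum_module I N) (direct_sum_module J N')"
    by (auto simp: module_iso_def direct_sum_module_def F_def bI intro!: restrict_ext)
  then show ?thesis by (auto simp: module_isomorphic_def)
qed

lemma frobenius_pushforward_cong:
  assumes "cring R" "module_isomorphic R M N"
  shows "module_isomorphic R (frobenius_pushforward R p e M) (frobenius_pushforward R p e N)"
proof -
  interpret cring R by fact
  obtain f where "f \<in> module_iso R M N"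
    using assms(2) by (auto simp: module_isomorphic_def)
  then have "f \<in> module_iso R (frobenius_pushforward R p e M) (frobenius_pushforward R p e N)"
    by (simp add: module_iso_def frobenius_pushforward_def)
  then show ?thesis unfolding module_isomorphic_def by blast
qed

lemma fg_module_transport:
  fixes M :: "('a, 'b, 'm) module_scheme"
  assumes fg: "fg_module R M" and inj: "inj_on (\<phi> :: 'b \<Rightarrow> 'c) (carrier M)"
  shows "\<exists>N :: ('a, 'c) module. fg_module R N \<and> module_isomorphic R M N"
proof -
  interpret module R M using fg by (simp add: fg_module_def)
  define \<psi> where "\<psi> = inv_into (carrier M) \<phi>"
  have psi [simp]: "\<psi> (\<phi> x) = x" if "x \<in> carrier M" for x
    using inj that by (simp add: \<psi>_def)
  define N :: "('a, 'c) module" where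
    "N = \<lparr>carrier = \<phi> ` carrier M, monoid.mult = undefined, one = undefined,
      zero = \<phi> \<zero>\<^bsub>M\<^esub>, add = (\<lambda>x y. \<phi> (\<psi> x \<oplus>\<^bsub>M\<^esub> \<psi> y)), smult = (\<lambda>r x. \<phi> (r \<odot>\<^bsub>M\<^esub> \<psi> x))\<rparr>"
  have N [simp]: "carrier N = \<phi> ` carrier M" "\<zero>\<^bsub>N\<^esub> = \<phi> \<zero>\<^bsub>M\<^esub>"
    "\<And>x y. x \<oplus>\<^bsub>N\<^esub> y = \<phi> (\<psi> x \<oplus>\<^bsub>M\<^esub> \<psi> y)" "\<And>r x. r \<odot>\<^bsub>N\<^esub> x = \<phi> (r \<odot>\<^bsub>M\<^esub> \<psi> x)"
    by (simp_all add: N_def)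
  have "abelian_group N"
  proof (rule abelian_groupI)
    fix x assume "x \<in> carrier N"
    then show "\<exists>y\<in>carrier N. y \<oplus>\<^bsub>N\<^esub> x = \<zero>\<^bsub>N\<^esub>"
      by (auto intro!: bexI[of _ "\<ominus>\<^bsub>M\<^esub> \<psi> x"] simp: M.l_neg)
  qed (auto simp: M.a_ac)
  then have modN: "module R N"
    by (intro moduleI) (auto simp: smult_l_distr smult_r_distr smult_assoc1 R.is_cring)
  then interpret N: module R N .
  obtain A where A: "finite A" "A \<subseteq> carrier M"
    "\<And>x. x \<in> carrier M \<Longrightarrow> \<exists>c\<in>A \<rightarrow> carrier R. x = (\<Oplus>\<^bsub>M\<^esub>a\<in>A. c a \<odot>\<^bsub>M\<^esub> a)"
    using fg unfolding fg_module_def by blast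
  have sum: "\<phi> (\<Oplus>\<^bsub>M\<^esub>b\<in>B. h b) = (\<Oplus>\<^bsub>N\<^esub>b\<in>B. \<phi> (h b))"
    if "finite B" "h \<in> B \<rightarrow> carrier M" for B :: "'c set" and h
    using that
  proof (induction rule: finite_induct)
    case (insert b B)
    have hb: "h b \<in> carrier M" "h \<in> B \<rightarrow> carrier M" using insert.prems by auto
    have "\<phi> (\<Oplus>\<^bsub>M\<^esub>c\<in>insert b B. h c) = \<phi> (h b \<oplus>\<^bsub>M\<^esub> (\<Oplus>\<^bsub>M\<^esub>c\<in>B. h c))"
      using insert.hyps hb by (simp add: M.finsum_insert)
    also have "\<dots> = \<phi> (h b) \<oplus>\<^bsub>N\<^esub> \<phi> (\<Oplus>\<^bsub>M\<^esub>c\<in>B. h c)"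
      using hb by simp
    also have "\<dots> = \<phi> (h b) \<oplus>\<^bsub>N\<^esub> (\<Oplus>\<^bsub>N\<^esub>c\<in>B. \<phi> (h c))"
      using insert.IH[OF hb(2)] by (simp only:)
    also have "\<dots> = (\<Oplus>\<^bsub>N\<^esub>c\<in>insert b B. \<phi> (h c))"
      using insert.hyps hb by (intro N.M.finsum_insert[symmetric]) auto
    finally show ?case .
  next
    case empty
    have "\<phi> (\<Oplus>\<^bsub>M\<^esub>b\<in>{}. h b) = \<zero>\<^bsub>N\<^esub>" by simp
    then show ?case by (simp only: N.M.finsum_empty)
  qed
  have "\<exists>c\<in>\<phi> ` A \<rightarrow> carrier R. y = (\<Oplus>\<^bsub>N\<^esub>b\<in>\<phi> ` A. c b \<odot>\<^bsub>N\<^esub> b)" if y: "y \<in> carrier N" for y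
  proof -
    obtain x where x: "x \<in> carrier M" "y = \<phi> x" using y by auto
    obtain c where c: "c \<in> A \<rightarrow> carrier R" "x = (\<Oplus>\<^bsub>M\<^esub>a\<in>A. c a \<odot>\<^bsub>M\<^esub> a)" using A(3) x by blast
    have psiA: "\<psi> b \<in> A" "b = \<phi> (\<psi> b)" if "b \<in> \<phi> ` A" for b
      using that A(2) by auto
    have cA: "c a \<odot>\<^bsub>M\<^esub> a \<in> carrier M" "\<psi> (\<phi> a) = a" if "a \<in> A" for a
      using that c(1) A(2) by auto
    have "inj_on \<phi> A" using inj A(2) by (rule inj_on_subset)
    then have "x = (\<Oplus>\<^bsub>M\<^esub>b\<in>\<phi> ` A. c (\<psi> b) \<odot>\<^bsub>M\<^esub> \<psi> b)"
      unfolding c(2)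
      by (subst M.add.finprod_reindex) (auto intro!: M.add.finprod_cong' simp: cA)
    then have "y = \<phi> (\<Oplus>\<^bsub>M\<^esub>b\<in>\<phi> ` A. c (\<psi> b) \<odot>\<^bsub>M\<^esub> \<psi> b)" using x(2) by simp
    also have "\<dots> = (\<Oplus>\<^bsub>N\<^esub>b\<in>\<phi> ` A. \<phi> (c (\<psi> b) \<odot>\<^bsub>M\<^esub> \<psi> b))"
      using A(1) by (intro sum) (auto simp: cA)
    finally have "y = (\<Oplus>\<^bsub>N\<^esub>b\<in>\<phi> ` A. (c \<circ> \<psi>) b \<odot>\<^bsub>N\<^esub> b)" by simp
    moreover have "c \<circ> \<psi> \<in> \<phi> ` A \<rightarrow> carrier R" using c(1) psiA by auto
    ultimately show ?thesis by blast
  qed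
  moreover have "finite (\<phi> ` A)" "\<phi> ` A \<subseteq> carrier N" using A by auto
  ultimately have "fg_module R N" using modN unfolding fg_module_def by blast
  moreover have "\<phi> \<in> module_iso R M N"
    using inj by (auto simp: module_iso_def bij_betw_def)
  ultimately show ?thesis by (auto simp: module_isomorphic_def)
qed

lemma fg_module_representative:
  fixes R :: "('a, 'r) ring_scheme" and M :: "('a, 'b, 'm) module_scheme"
  assumes "fg_module R M"
  shows "\<exists>N :: 'a fg_mod. fg_module R N \<and> module_isomorphic R M N"
proof -
  obtain A where A: "finite A" "A \<subseteq> carrier M"
    "\<And>x. x \<in> carrier M \<Longrightarrow> \<exists>c\<in>A \<rightarrow> carrier R. x = (\<Oplus>\<^bsub>M\<^esub>a\<in>A. c a \<odot>\<^bsub>M\<^esub> a)"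
    using assms unfolding fg_module_def by blast
  interpret module R M using assms by (simp add: fg_module_def)
  obtain k :: "'b \<Rightarrow> nat" where k: "inj_on k A" using A(1) finite_imp_inj_to_nat_seg by metis
  define \<phi> where "\<phi> x = {c. (\<forall>i. c i \<in> carrier R) \<and> x = (\<Oplus>\<^bsub>M\<^esub>a\<in>A. c (k a) \<odot>\<^bsub>M\<^esub> a)}" for x
  have "\<phi> x \<noteq> {}" if x: "x \<in> carrier M" for x
  proof -
    obtain c where c: "c \<in> A \<rightarrow> carrier R" "x = (\<Oplus>\<^bsub>M\<^esub>a\<in>A. c a \<odot>\<^bsub>M\<^esub> a)" using A(3) x by blast
    define d where "d i = (if i \<in> k ` A then c (inv_into A k i) else \<zero>\<^bsub>R\<^esub>)" for i
    have d: "d (k a) = c a" if "a \<in> A" for a using k that by (simp add: d_def)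
    have "x = (\<Oplus>\<^bsub>M\<^esub>a\<in>A. d (k a) \<odot>\<^bsub>M\<^esub> a)"
      unfolding c(2) using c(1) A(2) by (intro M.add.finprod_cong') (auto simp: d Pi_iff)
    moreover have "\<forall>i. d i \<in> carrier R" using c(1) k by (auto simp: d_def)
    ultimately show ?thesis by (auto simp: \<phi>_def)
  qed
  then have "inj_on \<phi> (carrier M)"
    by (intro inj_onI) (fastforce simp: \<phi>_def set_eq_iff)
  with assms show ?thesis by (rule fg_module_transport)
qed

lemma fg_module_representatives:
  fixes R :: "('a, 'r) ring_scheme" and \<Gamma> :: "('a, 'c) module set"
  assumes "\<forall>N\<in>\<Gamma>. fg_module R N"
  obtains h :: "('a, 'c) module \<Rightarrow> 'a fg_mod"
  where "\<And>N. N \<in> \<Gamma> \<Longrightarrow> fg_module R (h N)" "\<And>N. N \<in> \<Gamma> \<Longrightarrow> module_isomorphic R N (h N)"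
proof -
  have "\<forall>N\<in>\<Gamma>. \<exists>N' :: 'a fg_mod. fg_module R N' \<and> module_isomorphic R N N'"
    using assms fg_module_representative by blast
  from bchoice[OF this] show ?thesis using that by blast
qed

lemma FFRT_by_image:
  fixes R :: "('a, 'r) ring_scheme" and \<Gamma> :: "('a, 'c) module set"
    and h :: "('a, 'c) module \<Rightarrow> ('a, 'd) module"
  assumes FFRT: "FFRT_by R p M \<Gamma>"
    and h: "\<And>N. N \<in> \<Gamma> \<Longrightarrow> fg_module R (h N)" "\<And>N. N \<in> \<Gamma> \<Longrightarrow> module_isomorphic R N (h N)"
  shows "FFRT_by R p M (h ` \<Gamma>)"
proof -
  have fin: "finite \<Gamma>" using FFRT by (simp add: FFRT_by_def)
  have "\<exists>t :: ('a, 'd) module \<Rightarrow> nat. module_isomorphic R (frobenius_pushforward R p e M)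
          (direct_sum_module (SIGMA N:h ` \<Gamma>. {..<t N}) fst)" if e: "e > 0" for e :: nat
  proof -
    obtain t :: "('a, 'c) module \<Rightarrow> nat" where t: "module_isomorphic R (frobenius_pushforward R p e M)
        (direct_sum_module (SIGMA N:\<Gamma>. {..<t N}) fst)"
      using FFRT e unfolding FFRT_by_def by blast
    define I where "I = (SIGMA N:\<Gamma>. {..<t N})"
    define B where "B P = {i \<in> I. h (fst i) = P}" for P
    have "finite I" using fin by (simp add: I_def)
    then have "finite (B P)" for P unfolding B_def by (rule rev_finite_subset) blast
    then have "\<exists>g. bij_betw g {..<card (B P)} (B P)" for P
      using ex_bij_betw_nat_finite[of "B P"] by (auto simp: atLeast0LessThan)
    then obtain g where g: "\<And>P. bij_betw (g P) {..<card (B P)} (B P)" by metis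
    define J where "J = (SIGMA P:h ` \<Gamma>. {..<card (B P)})"
    have gB: "g P k \<in> B P" if "k < card (B P)" for P k
      using g[of P] that by (auto dest: bij_betwE)
    have bij: "bij_betw (\<lambda>(P, k). g P k) J I"
    proof (rule bij_betw_imageI)
      show "inj_on (\<lambda>(P, k). g P k) J"
      proof (rule inj_onI, clarify)
        fix P k Q l assume *: "(P, k) \<in> J" "(Q, l) \<in> J" "g P k = g Q l"
        then have kl: "k < card (B P)" "l < card (B Q)" by (auto simp: J_def)
        then have "P = Q" using gB[of k P] gB[of l Q] * by (auto simp: B_def)
        with * kl g[of P] show "P = Q \<and> k = l" by (auto simp: bij_betw_def inj_on_def)
      qed
      show "(\<lambda>(P, k). g P k) ` J = I"
      proof
        show "(\<lambda>(P, k). g P k) ` J \<subseteq> I" using gB by (auto simp: J_def B_def)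
        show "I \<subseteq> (\<lambda>(P, k). g P k) ` J"
        proof
          fix i assume i: "i \<in> I"
          then have "i \<in> B (h (fst i))" by (simp add: B_def)
          then obtain k where "k < card (B (h (fst i)))" "i = g (h (fst i)) k"
            using g[of "h (fst i)"] by (auto simp: bij_betw_def)
          moreover have "h (fst i) \<in> h ` \<Gamma>" using i by (auto simp: I_def)
          ultimately show "i \<in> (\<lambda>(P, k). g P k) ` J"
            by (auto simp: J_def intro!: image_eqI[of _ _ "(h (fst i), k)"])
        qed
      qed
    qed
    have "module_isomorphic R (direct_sum_module I fst) (direct_sum_module J fst)"
    proof (rule direct_sum_module_reindex[OF bij])
      fix j assume "j \<in> J"
      then have "(case j of (P, k) \<Rightarrow> g P k) \<in> B (fst j)" using gB by (auto simp: J_def)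
      then show "module_isomorphic R (fst (case j of (P, k) \<Rightarrow> g P k)) (fst j)"
        using h(2)[of "fst (case j of (P, k) \<Rightarrow> g P k)"] by (auto simp: B_def I_def)
    qed
    with t have "module_isomorphic R (frobenius_pushforward R p e M) (direct_sum_module J fst)"
      unfolding I_def by (rule module_isomorphic_trans)
    then show ?thesis unfolding J_def by (intro exI[of _ "\<lambda>P. card (B P)"])
  qed
  with fin h(1) show ?thesis by (simp add: FFRT_by_def)
qed

lemma has_FFRT_I:
  fixes R :: "('a, 'r) ring_scheme" and \<Gamma> :: "('a, 'c) module set"
  assumes "FFRT_by R p M \<Gamma>"
  shows "has_FFRT R p M"
proof -
  have "\<forall>N\<in>\<Gamma>. fg_module R N" using assms by (simp add: FFRT_by_def)
  then obtain h :: "_ \<Rightarrow> 'a fg_mod" where "\<And>N. N \<in> \<Gamma> \<Longrightarrow> fg_module R (h N)"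
    "\<And>N. N \<in> \<Gamma> \<Longrightarrow> module_isomorphic R N (h N)"
    by (rule fg_module_representatives) blast
  then have "FFRT_by R p M (h ` \<Gamma>)" by (rule FFRT_by_image[OF assms])
  then show ?thesis unfolding has_FFRT_def by blast
qed

lemma has_FFRT_by_system_I:
  fixes R :: "('a, 'r) ring_scheme" and \<Gamma> :: "('a, 'c) module set"
  assumes sys: "FFRT_system R p \<Gamma>" and FFRT: "FFRT_by R p M \<Gamma>"
  shows "has_FFRT_by_system R p M"
proof -
  have fg: "\<forall>N\<in>\<Gamma>. fg_module R N" using sys by (simp add: FFRT_system_def)
  obtain h :: "_ \<Rightarrow> 'a fg_mod" where h: "\<And>N. N \<in> \<Gamma> \<Longrightarrow> fg_module R (h N)"
    "\<And>N. N \<in> \<Gamma> \<Longrightarrow> module_isomorphic R N (h N)"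
    using fg_module_representatives[OF fg] by blast
  have "\<exists>(n::nat) L. L \<in> {..<n} \<rightarrow> h ` \<Gamma> \<and>
      module_isomorphic R (frobenius_pushforward R p 1 (h N)) (direct_sum_module {..<n} L)"
    if N: "N \<in> \<Gamma>" for N
  proof -
    obtain n :: nat and L where L: "L \<in> {..<n} \<rightarrow> \<Gamma>"
      "module_isomorphic R (frobenius_pushforward R p 1 N) (direct_sum_module {..<n} L)"
      using sys N unfolding FFRT_system_def by blast
    have modN: "module R N" using fg N by (simp add: fg_module_def)
    then have "cring R" by (simp add: module_def)
    then have "module_isomorphic R (frobenius_pushforward R p 1 (h N)) (frobenius_pushforward R p 1 N)"
      using module_isomorphic_sym[OF modN h(2)[OF N]] by (rule frobenius_pushforward_cong)
    moreover have "module_isomorphic R (direct_sum_module {..<n} L)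
        (direct_sum_module {..<n} (h \<circ> L))"
      using L(1) h(2) by (intro direct_sum_module_reindex[where b = id]) auto
    ultimately have "module_isomorphic R (frobenius_pushforward R p 1 (h N))
        (direct_sum_module {..<n} (h \<circ> L))"
      using L(2) by (blast intro: module_isomorphic_trans)
    moreover have "h \<circ> L \<in> {..<n} \<rightarrow> h ` \<Gamma>" using L(1) by auto
    ultimately show ?thesis by blast
  qed
  moreover have "finite \<Gamma>" using sys by (simp add: FFRT_system_def)
  ultimately have "FFRT_system R p (h ` \<Gamma>)" using h(1) by (simp add: FFRT_system_def)
  moreover have "FFRT_by R p M (h ` \<Gamma>)" using FFRT h by (rule FFRT_by_image)
  ultimately show ?thesis unfolding has_FFRT_by_system_def by blast
qed

end

theory Submission
  imports Defs "HOL-Algebra.QuotRing"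
begin

text \<open>A direct summand of a module is the image of an idempotent endomorphism, so all direct summands
of all pushforwards \<open>F\<^sub>*\<^sup>e(M)\<close>, \<open>e > 0\<close>, can be studied as idempotents of one ring \<open>S\<close>, the
endomorphism ring of the product \<open>Z\<close> of these pushforwards. Two idempotents have isomorphic images
iff they are equivalent in the sense of Murray and von Neumann, and indecomposable summands
correspond to primitive idempotents. Let \<open>\<Gamma>\<close> consist of one representative for every isomorphism
class of indecomposable direct summands of the modules \<open>F\<^sub>*\<^sup>e(M)\<close>, \<open>e > 0\<close>. Every such summand \<open>N\<close>
of \<open>F\<^sub>*\<^sup>e(M)\<close> has a pushforward \<open>F\<^sub>*\<^sup>1(N)\<close> which is a direct summand of \<open>F\<^sub>*\<^sup>e\<^sup>+\<^sup>1(M)\<close>, hence again a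
direct sum of members of \<open>\<Gamma>\<close>. So \<open>\<Gamma>\<close> is an FFRT system as soon as it is finite.

Finiteness of \<open>\<Gamma>\<close> is the point. If \<open>M\<close> has FFRT by \<open>M\<^sub>1, \<dots>, M\<^sub>s\<close>, then all the summands lie in the
additive closure of \<open>M\<^sub>1 \<oplus> \<dots> \<oplus> M\<^sub>s\<close>. Over a local ring that is not henselian the Krull-Schmidt
theorem may fail in this additive closure, but it holds after reduction modulo the maximal ideal
\<open>\<mm>\<close>: let \<open>J\<close> be the ideal of endomorphisms with image in \<open>\<mm>Z\<close>. Idempotents with finitely
generated image decompose in \<open>S/J\<close> into finitely many primitive idempotents, and these are local
because their corner rings are finite-dimensional over the residue field
(\<open>corner_pi_regular_mod_J\<close>, \<open>corner_almost_orthogonal_bound\<close>). Up to equivalence, only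
the finitely many primitive idempotents coming from the \<open>M\<^sub>j\<close> can occur, so every summand \<open>N\<close>
gets a vector of multiplicities (\<open>multiplicity_vector\<close>). If the vector of \<open>N\<close> is bounded by that of \<open>N'\<close>, there
are maps \<open>N \<rightarrow> N' \<rightarrow> N\<close> whose composition is the identity modulo \<open>\<mm>\<close>; by the Nakayama lemma it is
invertible (\<open>left_inverse_mod_J\<close>), so \<open>N\<close> is a direct summand of \<open>N'\<close>, and \<open>N \<cong> N'\<close> if \<open>N'\<close> is
indecomposable. The vectors of pairwise non-isomorphic indecomposable summands therefore form an
antichain, and by Dickson's lemma such an antichain is finite
(\<open>finitely_many_primitive_classes\<close>).\<close>

section \<open>Idempotents in a noncommutative ring\<close>

definition idempotents :: "('a, 'm) ring_scheme \<Rightarrow> 'a set" where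
  "idempotents R = {e \<in> carrier R. e \<otimes>\<^bsub>R\<^esub> e = e}"

definition corner :: "('a, 'm) ring_scheme \<Rightarrow> 'a \<Rightarrow> 'a set" where
  "corner R e = {x \<in> carrier R. e \<otimes>\<^bsub>R\<^esub> x = x \<and> x \<otimes>\<^bsub>R\<^esub> e = x}"

definition orthogonal_idempotents :: "('a, 'm) ring_scheme \<Rightarrow> 'a set \<Rightarrow> bool" where
  "orthogonal_idempotents R A \<longleftrightarrow> finite A \<and> A \<subseteq> idempotents R - {\<zero>\<^bsub>R\<^esub>} \<and>
     (\<forall>a\<in>A. \<forall>b\<in>A. a \<noteq> b \<longrightarrow> a \<otimes>\<^bsub>R\<^esub> b = \<zero>\<^bsub>R\<^esub>)"

definition primitive_idempotent :: "('a, 'm) ring_scheme \<Rightarrow> 'a \<Rightarrow> bool" where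
  "primitive_idempotent R f \<longleftrightarrow> f \<in> idempotents R \<and> f \<noteq> \<zero>\<^bsub>R\<^esub> \<and>
     (\<forall>g \<in> corner R f \<inter> idempotents R. g = \<zero>\<^bsub>R\<^esub> \<or> g = f)"

text \<open>For idempotents of an endomorphism ring this says that the image of \<open>e\<close> is isomorphic to a direct summand of the image of
\<open>f\<close>. The maps \<open>a\<close> and \<open>b\<close> may be taken arbitrary, since \<open>f a e\<close> and \<open>e b f\<close> then factor \<open>e\<close> as well.\<close>
definition factors_through :: "('a, 'm) ring_scheme \<Rightarrow> 'a \<Rightarrow> 'a \<Rightarrow> bool" where
  "factors_through R e f \<longleftrightarrow> (\<exists>a\<in>carrier R. \<exists>b\<in>carrier R. b \<otimes>\<^bsub>R\<^esub> f \<otimes>\<^bsub>R\<^esub> a = e)"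

text \<open>Murray-von Neumann equivalence: \<open>a\<close> and \<open>b\<close> are mutually inverse isomorphisms between the images.\<close>
definition equivalent_idempotents :: "('a, 'm) ring_scheme \<Rightarrow> 'a \<Rightarrow> 'a \<Rightarrow> bool" where
  "equivalent_idempotents R e f \<longleftrightarrow> (\<exists>a\<in>carrier R. \<exists>b\<in>carrier R.
     f \<otimes>\<^bsub>R\<^esub> a = a \<and> a \<otimes>\<^bsub>R\<^esub> e = a \<and> e \<otimes>\<^bsub>R\<^esub> b = b \<and> b \<otimes>\<^bsub>R\<^esub> f = b \<and>
     b \<otimes>\<^bsub>R\<^esub> a = e \<and> a \<otimes>\<^bsub>R\<^esub> b = f)"

text \<open>Fitting's lemma in ring-theoretic form: the equation makes \<open>w\<^sup>n q\<^sup>n\<close> an idempotent on which \<open>w\<close> is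
invertible, while \<open>w\<close> is nilpotent on its complement.\<close>
definition strongly_pi_regular :: "('a, 'm) ring_scheme \<Rightarrow> 'a \<Rightarrow> bool" where
  "strongly_pi_regular R w \<longleftrightarrow> (\<exists>n>0. \<exists>q\<in>carrier R.
     w \<otimes>\<^bsub>R\<^esub> q = q \<otimes>\<^bsub>R\<^esub> w \<and> w [^]\<^bsub>R\<^esub> (n::nat) = w [^]\<^bsub>R\<^esub> Suc n \<otimes>\<^bsub>R\<^esub> q)"

text \<open>The two conditions replace finite dimension of the corner ring over a field. The bound yields
decompositions into primitive idempotents, and strong pi-regularity makes these primitive
idempotents local.\<close>
definition semiperfect_idempotent :: "('a, 'm) ring_scheme \<Rightarrow> 'a \<Rightarrow> bool" where
  "semiperfect_idempotent R e \<longleftrightarrow> e \<in> idempotents R \<and>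
     (\<exists>d. \<forall>A. orthogonal_idempotents R A \<longrightarrow> A \<subseteq> corner R e \<longrightarrow> card A \<le> d) \<and>
     (\<forall>w\<in>corner R e. strongly_pi_regular R w)"

context ring
begin

lemma corner_trans:
  assumes "f \<in> corner R e" "x \<in> corner R f" "e \<in> carrier R"
  shows "x \<in> corner R e"
proof -
  have "e \<otimes> x = x" using assms by (simp add: corner_def) (metis m_assoc)
  moreover have "x \<otimes> e = x" using assms by (simp add: corner_def) (metis m_assoc)
  ultimately show ?thesis using assms by (simp add: corner_def)
qed

text \<open>If \<open>b f a = e\<close> with \<open>a = f a e\<close> and \<open>b = e b f\<close>, then \<open>a b\<close> is a nonzero idempotent below \<open>f\<close>, and
primitivity leaves only \<open>a b = f\<close>.\<close>
lemma equivalent_of_primitive: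
  assumes f: "primitive_idempotent R f" and e: "e \<in> idempotents R" "e \<noteq> \<zero>"
    and le: "factors_through R e f"
  shows "equivalent_idempotents R e f"
proof -
  obtain a' b' where ab': "a' \<in> carrier R" "b' \<in> carrier R" "b' \<otimes> f \<otimes> a' = e"
    using le by (auto simp: factors_through_def)
  have fc: "f \<in> carrier R" "f \<otimes> f = f" "e \<in> carrier R" "e \<otimes> e = e"
    using f e by (auto simp: primitive_idempotent_def idempotents_def)
  define a where "a = f \<otimes> a' \<otimes> e"
  define b where "b = e \<otimes> b' \<otimes> f"
  have cl: "a \<in> carrier R" "b \<in> carrier R" using ab' fc by (auto simp: a_def b_def)
  have fa: "f \<otimes> a = a" using ab' fc by (simp add: a_def m_assoc[symmetric])
  have ae: "a \<otimes> e = a" using ab' fc by (simp add: a_def m_assoc)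
  have eb: "e \<otimes> b = b" using ab' fc by (simp add: b_def m_assoc[symmetric])
  have bf: "b \<otimes> f = b" using ab' fc by (simp add: b_def m_assoc)
  have "b \<otimes> a = e \<otimes> (b' \<otimes> (f \<otimes> f) \<otimes> a') \<otimes> e"
    using ab'(1,2) fc(1,3) by (simp add: a_def b_def m_assoc)
  then have ba: "b \<otimes> a = e" using ab' fc by simp
  have "a \<otimes> b \<otimes> (a \<otimes> b) = a \<otimes> (b \<otimes> a) \<otimes> b" using cl by (simp add: m_assoc)
  also have "\<dots> = a \<otimes> b" using ba ae by simp
  finally have "a \<otimes> b \<in> idempotents R" using cl by (simp add: idempotents_def)
  moreover have "a \<otimes> b \<in> corner R f" using cl fc fa bf
    by (auto simp: corner_def m_assoc[symmetric]) (simp add: m_assoc)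
  ultimately have ab: "a \<otimes> b = \<zero> \<or> a \<otimes> b = f" using f by (auto simp: primitive_idempotent_def)
  have "a \<otimes> b \<noteq> \<zero>"
  proof
    assume "a \<otimes> b = \<zero>"
    then have "b \<otimes> (a \<otimes> b) \<otimes> a = \<zero>" using cl by simp
    moreover have "b \<otimes> (a \<otimes> b) \<otimes> a = (b \<otimes> a) \<otimes> (b \<otimes> a)" using cl by (simp add: m_assoc)
    ultimately show False using ba fc e by simp
  qed
  with ab have "a \<otimes> b = f" by simp
  with cl fa ae eb bf ba show ?thesis unfolding equivalent_idempotents_def by blast
qed

lemma factors_through_trans:
  assumes "factors_through R e f" "factors_through R f g" "g \<in> carrier R"
  shows "factors_through R e g"
proof -
  obtain a b c d where c: "a \<in> carrier R" "b \<in> carrier R" "c \<in> carrier R" "d \<in> carrier R"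
    and eq: "b \<otimes> f \<otimes> a = e" "d \<otimes> g \<otimes> c = f"
    using assms unfolding factors_through_def by metis
  have "(b \<otimes> d) \<otimes> g \<otimes> (c \<otimes> a) = b \<otimes> (d \<otimes> g \<otimes> c) \<otimes> a"
    using c assms(3) by (simp add: m_assoc)
  also have "\<dots> = e" using eq by simp
  finally show ?thesis using c unfolding factors_through_def by blast
qed

lemma equivalent_imp_factors_through:
  assumes "equivalent_idempotents R e f"
  shows "factors_through R e f" "factors_through R f e"
  using assms unfolding equivalent_idempotents_def factors_through_def by metis+

lemma equivalent_idempotents_sym:
  "equivalent_idempotents R e f \<Longrightarrow> equivalent_idempotents R f e"
  unfolding equivalent_idempotents_def by blast

lemma orthogonal_sum_absorbs:
  assumes A: "orthogonal_idempotents R A" and a: "a \<in> A"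
  shows "a \<otimes> (\<Oplus>b\<in>A. b) = a" "(\<Oplus>b\<in>A. b) \<otimes> a = a"
proof -
  have fin: "finite A" and Ac: "A \<subseteq> carrier R"
    using A by (auto simp: orthogonal_idempotents_def idempotents_def)
  then have ac: "a \<in> carrier R" using a by auto
  have "a \<otimes> (\<Oplus>b\<in>A. b) = (\<Oplus>b\<in>A. a \<otimes> b)"
    using fin Ac ac by (intro finsum_rdistr) auto
  also have "\<dots> = (\<Oplus>b\<in>A. if a = b then b else \<zero>)"
    using A a Ac by (intro finsum_cong') (auto simp: orthogonal_idempotents_def idempotents_def)
  also have "\<dots> = a" using add.finprod_singleton[OF a fin, of "\<lambda>b. b"] Ac by auto
  finally show "a \<otimes> (\<Oplus>b\<in>A. b) = a" .
  have "(\<Oplus>b\<in>A. b) \<otimes> a = (\<Oplus>b\<in>A. b \<otimes> a)"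
    using fin Ac ac by (intro finsum_ldistr) auto
  also have "\<dots> = (\<Oplus>b\<in>A. if a = b then b else \<zero>)"
    using A a Ac by (intro finsum_cong') (auto simp: orthogonal_idempotents_def idempotents_def)
  also have "\<dots> = a" using add.finprod_singleton[OF a fin, of "\<lambda>b. b"] Ac by auto
  finally show "(\<Oplus>b\<in>A. b) \<otimes> a = a" .
qed

lemma orthogonal_sum_in_corner:
  assumes "orthogonal_idempotents R A"
  shows "A \<subseteq> corner R (\<Oplus>b\<in>A. b)"
  using orthogonal_sum_absorbs[OF assms] assms
  by (auto simp: corner_def orthogonal_idempotents_def idempotents_def)

text \<open>The refinement step for orthogonal families. It increases the cardinality, because a nonzero
idempotent orthogonal to every member of a family cannot belong to it.\<close>
lemma orthogonal_split:
  assumes A: "orthogonal_idempotents R A" and a: "a \<in> A"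
    and g: "g \<in> corner R a \<inter> idempotents R" "g \<noteq> \<zero>" "g \<noteq> a"
  shows "orthogonal_idempotents R (insert g (insert (a \<ominus> g) (A - {a})))"
    and "(\<Oplus>b\<in>insert g (insert (a \<ominus> g) (A - {a})). b) = (\<Oplus>b\<in>A. b)"
    and "card (insert g (insert (a \<ominus> g) (A - {a}))) = Suc (card A)"
proof -
  have fin: "finite A" and Ac: "\<And>b. b \<in> A \<Longrightarrow> b \<in> carrier R \<and> b \<otimes> b = b \<and> b \<noteq> \<zero>"
    and orth: "\<And>b c. b \<in> A \<Longrightarrow> c \<in> A \<Longrightarrow> b \<noteq> c \<Longrightarrow> b \<otimes> c = \<zero>"
    using A by (auto simp: orthogonal_idempotents_def idempotents_def)
  have gc: "g \<in> carrier R" "g \<otimes> g = g" "a \<otimes> g = g" "g \<otimes> a = g"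
    using g by (auto simp: corner_def idempotents_def)
  have ac: "a \<in> carrier R" "a \<otimes> a = a" using Ac a by auto
  let ?h = "a \<ominus> g"
  have hc: "?h \<in> carrier R" using gc ac by simp
  have hh: "?h \<otimes> ?h = ?h" "g \<otimes> ?h = \<zero>" "?h \<otimes> g = \<zero>"
    using gc ac by (simp_all add: minus_eq l_distr r_distr l_minus r_minus r_neg l_neg)
  have h0: "?h \<noteq> \<zero>" using g gc ac by (metis r_right_minus_eq)
  have gb: "g \<otimes> b = \<zero>" "b \<otimes> g = \<zero>" "?h \<otimes> b = \<zero>" "b \<otimes> ?h = \<zero>" if b: "b \<in> A - {a}" for b
  proof -
    have bc: "b \<in> carrier R" and ab: "a \<otimes> b = \<zero>" "b \<otimes> a = \<zero>" using b Ac orth a by auto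
    have "g \<otimes> b = g \<otimes> (a \<otimes> b)" using gc ac bc by (metis m_assoc)
    then show 1: "g \<otimes> b = \<zero>" using ab gc by simp
    have "b \<otimes> g = (b \<otimes> a) \<otimes> g" using gc ac bc by (metis m_assoc)
    then show 2: "b \<otimes> g = \<zero>" using ab gc by simp
    show "?h \<otimes> b = \<zero>" "b \<otimes> ?h = \<zero>" using 1 2 gc ac bc ab
      by (simp_all add: minus_eq l_distr r_distr l_minus r_minus)
  qed
  have gA: "g \<notin> A - {a}" using gb(1)[of g] gc g(2) by auto
  have hA: "?h \<notin> A - {a}" using gb(3)[of ?h] hh h0 by auto
  have gh: "g \<noteq> ?h" using hh gc g(2) by auto
  show "orthogonal_idempotents R (insert g (insert ?h (A - {a})))"
    unfolding orthogonal_idempotents_def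
  proof (intro conjI ballI impI)
    fix b c assume "b \<in> insert g (insert ?h (A - {a}))" "c \<in> insert g (insert ?h (A - {a}))" "b \<noteq> c"
    then show "b \<otimes> c = \<zero>" using gb hh orth by auto
  qed (use fin Ac gc hc hh h0 g in \<open>auto simp: idempotents_def\<close>)
  have AcC: "(\<lambda>b. b) \<in> A - {a} \<rightarrow> carrier R" using Ac by auto
  have "(\<Oplus>b\<in>insert g (insert ?h (A - {a})). b) = g \<oplus> (?h \<oplus> (\<Oplus>b\<in>A - {a}. b))"
    using fin gA hA gh gc hc AcC by (simp add: finsum_insert)
  also have "\<dots> = a \<oplus> (\<Oplus>b\<in>A - {a}. b)"
    using gc ac hc finsum_closed[OF AcC]
    by (simp add: a_assoc[symmetric]) (simp add: minus_eq a_lcomm r_neg)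
  also have "\<dots> = (\<Oplus>b\<in>insert a (A - {a}). b)"
    using fin ac AcC by (subst finsum_insert) auto
  also have "insert a (A - {a}) = A" using a by auto
  finally show "(\<Oplus>b\<in>insert g (insert ?h (A - {a})). b) = (\<Oplus>b\<in>A. b)" .
  show "card (insert g (insert ?h (A - {a}))) = Suc (card A)"
    using fin gA hA gh card_Suc_Diff1[OF fin a] by simp
qed

text \<open>A family of maximal cardinality with sum \<open>e\<close> cannot be refined, so its members are primitive.\<close>
lemma primitive_decomposition:
  assumes e: "e \<in> idempotents R"
    and bound: "\<And>A. orthogonal_idempotents R A \<Longrightarrow> A \<subseteq> corner R e \<Longrightarrow> card A \<le> d"
  shows "\<exists>A. orthogonal_idempotents R A \<and> (\<Oplus>a\<in>A. a) = e \<and> (\<forall>a\<in>A. primitive_idempotent R a)"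
proof -
  let ?P = "\<lambda>A. orthogonal_idempotents R A \<and> (\<Oplus>a\<in>A. a) = e"
  have bd: "card A \<le> d" if "?P A" for A
    using bound[of A] orthogonal_sum_in_corner[of A] that by auto
  have "\<exists>A. ?P A"
  proof (cases "e = \<zero>")
    case True
    then have "?P {}" by (simp add: orthogonal_idempotents_def)
    then show ?thesis by blast
  next
    case False
    then have "?P {e}" using e
      by (auto simp: orthogonal_idempotents_def idempotents_def)
    then show ?thesis by blast
  qed
  then obtain A where A: "?P A" and max: "\<And>B. ?P B \<Longrightarrow> card B \<le> card A"
    using ex_has_greatest_nat[of ?P _ card "Suc d"] bd by (metis (no_types, lifting) le_imp_less_Suc)
  have "primitive_idempotent R a" if a: "a \<in> A" for a
  proof (rule ccontr)
    assume "\<not> primitive_idempotent R a"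
    then obtain g where g: "g \<in> corner R a \<inter> idempotents R" "g \<noteq> \<zero>" "g \<noteq> a"
      using A a by (auto simp: primitive_idempotent_def orthogonal_idempotents_def)
    from orthogonal_split[OF _ a g] A max[of "insert g (insert (a \<ominus> g) (A - {a}))"]
    show False by auto
  qed
  with A show ?thesis by blast
qed

lemma pow_closed_corner:
  assumes "w \<in> corner R f" "n > 0" "f \<in> carrier R"
  shows "w [^] (n::nat) \<in> corner R f"
  using assms(2)
proof (induction n rule: nat_induct_non_zero)
  case 1
  then show ?case using assms by (simp add: corner_def)
next
  case (Suc n)
  then have "f \<otimes> (w [^] n \<otimes> w) = w [^] n \<otimes> w" "w [^] n \<otimes> w \<otimes> f = w [^] n \<otimes> w"
    using assms by (simp_all add: corner_def m_assoc[symmetric]) (simp_all add: m_assoc)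
  then show ?case using assms by (simp add: corner_def)
qed

text \<open>Instead of summing a geometric series, use \<open>(f + w)(f - w) = f - w\<^sup>2\<close> and square repeatedly.\<close>
lemma nilpotent_complement_left_invertible:
  assumes f: "f \<in> idempotents R" and w: "w \<in> corner R f" and "w [^] (2 ^ k :: nat) = \<zero>"
  shows "\<exists>y\<in>carrier R. y \<otimes> (f \<ominus> w) = f"
  using w assms(3)
proof (induction k arbitrary: w)
  case 0
  then have "f \<otimes> (f \<ominus> w) = f" using f by (auto simp: corner_def idempotents_def minus_eq)
  then show ?case using f by (auto simp: idempotents_def)
next
  case (Suc k)
  have wc: "w \<in> carrier R" "f \<otimes> w = w" "w \<otimes> f = w" and fc: "f \<in> carrier R" "f \<otimes> f = f"
    using Suc.prems f by (auto simp: corner_def idempotents_def)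
  have "w \<otimes> w \<in> corner R f" using wc fc
    by (auto simp: corner_def m_assoc[symmetric]) (simp add: m_assoc)
  moreover have "(w \<otimes> w) [^] (2 ^ k :: nat) = \<zero>"
  proof -
    have "w \<otimes> w = w [^] (2::nat)" using wc by (simp add: numeral_2_eq_2)
    then show ?thesis using Suc.prems(2) wc by (simp add: nat_pow_pow)
  qed
  ultimately obtain y where y: "y \<in> carrier R" "y \<otimes> (f \<ominus> w \<otimes> w) = f" using Suc.IH by blast
  have "(f \<oplus> w) \<otimes> (f \<ominus> w) = f \<ominus> w \<otimes> w"
  proof -
    have "(f \<oplus> w) \<otimes> (f \<ominus> w) = f \<oplus> (\<ominus> w \<oplus> w) \<ominus> w \<otimes> w"
      using wc fc by (simp add: minus_eq l_distr r_distr l_minus r_minus minus_add a_ac)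
    then show ?thesis using wc fc by (simp add: l_neg)
  qed
  then have "(y \<otimes> (f \<oplus> w)) \<otimes> (f \<ominus> w) = f" using y wc fc by (simp add: m_assoc)
  then show ?case using y wc fc by blast
qed

text \<open>The idempotent \<open>w\<^sup>n q\<^sup>n\<close> of Fitting's lemma lies below the primitive idempotent \<open>f\<close>, so it is \<open>f\<close>,
and \<open>w\<close> is invertible, or it is \<open>0\<close>, and \<open>w\<close> is nilpotent. Hence the corner ring of \<open>f\<close> is local.\<close>
lemma primitive_left_invertible_or_complement:
  assumes f: "primitive_idempotent R f" and w: "w \<in> corner R f" and reg: "strongly_pi_regular R w"
  shows "(\<exists>y\<in>carrier R. y \<otimes> w = f) \<or> (\<exists>y\<in>carrier R. y \<otimes> (f \<ominus> w) = f)"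
proof -
  have fi: "f \<in> idempotents R" and fc: "f \<in> carrier R" "f \<otimes> f = f"
    using f by (auto simp: primitive_idempotent_def idempotents_def)
  have wc: "w \<in> carrier R" using w by (simp add: corner_def)
  obtain n q where n: "n > 0" and q: "q \<in> carrier R" "w \<otimes> q = q \<otimes> w"
    and wn: "w [^] (n::nat) = w [^] Suc n \<otimes> q"
    using reg by (auto simp: strongly_pi_regular_def)
  have comm: "w [^] i \<otimes> q [^] j = q [^] j \<otimes> w [^] i" for i j :: nat
  proof -
    have "q [^] j \<otimes> w = w \<otimes> q [^] j"
      using q wc by (intro group_commutes_pow) auto
    then show ?thesis using q wc by (intro group_commutes_pow) auto
  qed
  have pow: "w [^] n = w [^] k \<otimes> w [^] n \<otimes> q [^] k" for k :: nat
  proof (induction k)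
    case 0
    then show ?case using wc by simp
  next
    case (Suc k)
    have "w [^] k \<otimes> w [^] n \<otimes> q [^] k = w [^] k \<otimes> (w [^] Suc n \<otimes> q) \<otimes> q [^] k" using wn by simp
    also have "\<dots> = w [^] k \<otimes> (w \<otimes> w [^] n) \<otimes> (q \<otimes> q [^] k)"
      using wc q(1) by (simp only: m_assoc nat_pow_closed m_closed nat_pow_Suc2)
    also have "\<dots> = w [^] Suc k \<otimes> w [^] n \<otimes> q [^] Suc k"
      using wc q(1) by (simp add: m_assoc nat_pow_comm[of q k 1, simplified] del: nat_pow_Suc)
    finally show ?case using Suc by simp
  qed
  define \<epsilon> where "\<epsilon> = w [^] n \<otimes> q [^] n"
  have ec: "\<epsilon> \<in> carrier R" using wc q by (simp add: \<epsilon>_def)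
  have wnc: "w [^] n \<in> corner R f" using w n fc(1) by (rule pow_closed_corner)
  have we: "w [^] n \<otimes> \<epsilon> = w [^] n" using pow[of n] wc q by (simp add: \<epsilon>_def m_assoc)
  have eqn: "\<epsilon> = q [^] n \<otimes> w [^] n" by (simp add: \<epsilon>_def comm)
  have "\<epsilon> \<otimes> \<epsilon> = q [^] n \<otimes> (w [^] n \<otimes> \<epsilon>)" using ec wc q by (subst (1) eqn) (simp add: m_assoc)
  then have "\<epsilon> \<in> idempotents R" using we eqn ec by (simp add: idempotents_def)
  moreover have "\<epsilon> \<in> corner R f"
  proof -
    have "f \<otimes> \<epsilon> = \<epsilon>" using wnc q fc by (simp add: \<epsilon>_def corner_def m_assoc[symmetric])
    moreover have "\<epsilon> \<otimes> f = \<epsilon>" using wnc q fc by (simp add: eqn corner_def m_assoc)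
    ultimately show ?thesis using ec by (simp add: corner_def)
  qed
  ultimately consider "\<epsilon> = \<zero>" | "\<epsilon> = f" using f by (auto simp: primitive_idempotent_def)
  then show ?thesis
  proof cases
    case 1
    then have w0: "w [^] n = \<zero>" using we wc by simp
    have "w [^] (2 ^ n :: nat) = w [^] n \<otimes> w [^] (2 ^ n - n :: nat)"
      using wc less_exp[of n] by (simp add: nat_pow_mult)
    then have "w [^] (2 ^ n :: nat) = \<zero>" using w0 wc by simp
    then show ?thesis using nilpotent_complement_left_invertible[OF fi w] by blast
  next
    case 2
    obtain m where m: "n = Suc m" using n by (cases n) auto
    have "(q [^] n \<otimes> w [^] m) \<otimes> w = f" using 2 eqn m wc q by (simp add: m_assoc)
    then show ?thesis using wc q by (metis m_closed nat_pow_closed)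
  qed
qed

text \<open>In a local ring, a sum can be invertible only if one of its summands is.\<close>
lemma primitive_left_invertible_summand:
  assumes f: "primitive_idempotent R f" and reg: "\<And>w. w \<in> corner R f \<Longrightarrow> strongly_pi_regular R w"
    and "finite I" and "x \<in> I \<rightarrow> corner R f"
    and "y \<in> carrier R" "y \<otimes> (\<Oplus>i\<in>I. x i) = f"
  shows "\<exists>i\<in>I. \<exists>y\<in>carrier R. y \<otimes> x i = f"
  using assms(3-)
proof (induction I arbitrary: y rule: finite_induct)
  case empty
  then have "f = \<zero>" by simp
  then show ?case using f by (simp add: primitive_idempotent_def)
next
  case (insert j I)
  have fc: "f \<in> carrier R" "f \<otimes> f = f"
    using f by (auto simp: primitive_idempotent_def idempotents_def)
  have xj: "x j \<in> carrier R" "x j \<otimes> f = x j" and xI: "x \<in> I \<rightarrow> carrier R" "x \<in> I \<rightarrow> corner R f"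
    using insert.prems by (auto simp: corner_def)
  let ?s = "\<Oplus>i\<in>I. x i"
  have sc: "?s \<in> carrier R" using xI by simp
  have yc: "y \<in> carrier R" by fact
  let ?w = "f \<otimes> y \<otimes> x j"
  have w: "?w \<in> corner R f"
  proof -
    have "f \<otimes> ?w = ?w" "?w \<otimes> f = ?w"
      using fc xj yc by (simp_all add: m_assoc) (simp add: m_assoc[symmetric])
    then show ?thesis using fc xj yc by (simp add: corner_def)
  qed
  have "y \<otimes> x j \<oplus> y \<otimes> ?s = f"
    using insert xj xI yc sc by (simp add: finsum_insert r_distr)
  then have "f \<otimes> (y \<otimes> x j) \<oplus> f \<otimes> (y \<otimes> ?s) = f" using fc xj yc sc by (metis m_closed r_distr)
  then have "f \<ominus> ?w = f \<otimes> y \<otimes> ?s"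
    using fc xj yc sc
    by (simp add: m_assoc minus_eq) (metis a_comm add.inv_solve_right m_closed)
  with primitive_left_invertible_or_complement[OF f w reg[OF w]]
  consider v where "v \<in> carrier R" "v \<otimes> ?w = f" | v where "v \<in> carrier R" "v \<otimes> (f \<otimes> y \<otimes> ?s) = f"
    by auto
  then show ?case
  proof cases
    case 1
    then have "(v \<otimes> (f \<otimes> y)) \<otimes> x j = f" using fc yc xj by (simp add: m_assoc)
    then show ?thesis using 1 fc yc by blast
  next
    case 2
    then have "(v \<otimes> (f \<otimes> y)) \<otimes> ?s = f" using fc yc sc by (simp add: m_assoc)
    then show ?thesis using insert.IH[OF xI(2), of "v \<otimes> (f \<otimes> y)"] 2 fc yc by auto
  qed
qed

end

section \<open>Krull-Schmidt multiplicities as a complete invariant\<close>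

text \<open>Comparing multiplicities label by label is what makes it possible to embed one decomposition into
another.\<close>
lemma label_preserving_injection:
  assumes "finite A" "finite B"
    and "\<And>v. v \<in> V \<Longrightarrow> card {a\<in>A. l a = v} \<le> card {b\<in>B. k b = v}" and "l ` A \<subseteq> V"
  shows "\<exists>j. inj_on j A \<and> j ` A \<subseteq> B \<and> (\<forall>a\<in>A. k (j a) = l a)"
proof -
  have "\<exists>h. h ` {a\<in>A. l a = v} \<subseteq> {b\<in>B. k b = v} \<and> inj_on h {a\<in>A. l a = v}" if "v \<in> V" for v
    using assms(1,2) assms(3)[OF that] by (intro card_le_inj) auto
  then have "\<forall>v\<in>V. \<exists>h. h ` {a\<in>A. l a = v} \<subseteq> {b\<in>B. k b = v} \<and> inj_on h {a\<in>A. l a = v}"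
    by blast
  from bchoice[OF this] obtain h where h: "\<And>v. v \<in> V \<Longrightarrow> h v ` {a\<in>A. l a = v} \<subseteq> {b\<in>B. k b = v}"
    "\<And>v. v \<in> V \<Longrightarrow> inj_on (h v) {a\<in>A. l a = v}" by blast
  define j where "j a = h (l a) a" for a
  have j: "j a \<in> B" "k (j a) = l a" if "a \<in> A" for a
    using h(1)[of "l a"] that assms(4) by (auto simp: j_def image_subset_iff)
  have "inj_on j A"
  proof (rule inj_onI)
    fix a a' assume *: "a \<in> A" "a' \<in> A" "j a = j a'"
    then have "l a = l a'" using j by metis
    then show "a = a'" using * h(2)[of "l a"] assms(4) by (auto simp: j_def inj_on_def)
  qed
  with j show ?thesis by auto
qed

context ring
begin

text \<open>Adding up the factorizations of the single summands works because the mixed terms contain products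
of distinct orthogonal idempotents and vanish.\<close>
lemma factors_through_orthogonal_sums:
  assumes A: "orthogonal_idempotents R A" and B: "orthogonal_idempotents R B"
    and j: "inj_on j A" "j ` A \<subseteq> B" and le: "\<And>a. a \<in> A \<Longrightarrow> factors_through R a (j a)"
  shows "factors_through R (\<Oplus>a\<in>A. a) (\<Oplus>b\<in>B. b)"
proof -
  obtain p q where pq: "\<And>a. a \<in> A \<Longrightarrow> p a \<in> carrier R" "\<And>a. a \<in> A \<Longrightarrow> q a \<in> carrier R"
    "\<And>a. a \<in> A \<Longrightarrow> q a \<otimes> j a \<otimes> p a = a"
    using le unfolding factors_through_def by metis
  have fin: "finite A" and jc: "\<And>a. a \<in> A \<Longrightarrow> j a \<in> carrier R \<and> j a \<otimes> j a = j a"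
    and orth: "\<And>a a'. a \<in> A \<Longrightarrow> a' \<in> A \<Longrightarrow> a \<noteq> a' \<Longrightarrow> j a \<otimes> j a' = \<zero>"
    and Ac: "\<And>a. a \<in> A \<Longrightarrow> a \<in> carrier R"
  proof -
    show "finite A" using A by (simp add: orthogonal_idempotents_def)
    show "a \<in> carrier R" if "a \<in> A" for a
      using A that by (auto simp: orthogonal_idempotents_def idempotents_def)
    show "j a \<in> carrier R \<and> j a \<otimes> j a = j a" if "a \<in> A" for a
      using B j that by (auto simp: orthogonal_idempotents_def idempotents_def)
    show "j a \<otimes> j a' = \<zero>" if "a \<in> A" "a' \<in> A" "a \<noteq> a'" for a a'
    proof -
      have "j a \<noteq> j a'" "j a \<in> B" "j a' \<in> B" using j that by (auto dest: inj_onD)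
      then show ?thesis using B by (auto simp: orthogonal_idempotents_def)
    qed
  qed
  let ?e = "\<Oplus>b\<in>B. b"
  have "(\<lambda>b. b) \<in> B \<rightarrow> carrier R" using B by (auto simp: orthogonal_idempotents_def idempotents_def)
  then have ec: "?e \<in> carrier R" by (rule finsum_closed)
  let ?P = "\<Oplus>a\<in>A. j a \<otimes> p a" and ?Q = "\<Oplus>a\<in>A. q a \<otimes> j a"
  have Pc: "?P \<in> carrier R" and Qc: "?Q \<in> carrier R" using pq jc by auto
  have "?e \<otimes> ?P = (\<Oplus>a\<in>A. ?e \<otimes> (j a \<otimes> p a))"
    using fin ec jc pq by (intro finsum_rdistr) auto
  also have "\<dots> = ?P"
  proof (intro finsum_cong')
    fix a assume a: "a \<in> A"
    then have "?e \<otimes> j a = j a" using orthogonal_sum_absorbs(2)[OF B] j by auto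
    then show "?e \<otimes> (j a \<otimes> p a) = j a \<otimes> p a" using a ec jc pq by (simp add: m_assoc[symmetric])
  qed (use jc pq in auto)
  finally have eP: "?e \<otimes> ?P = ?P" .
  have "?Q \<otimes> ?P = (\<Oplus>a\<in>A. (q a \<otimes> j a) \<otimes> ?P)"
    using fin jc pq Pc by (intro finsum_ldistr) auto
  also have "\<dots> = (\<Oplus>a\<in>A. a)"
  proof (intro finsum_cong')
    fix a assume a: "a \<in> A"
    have "(q a \<otimes> j a) \<otimes> ?P = (\<Oplus>a'\<in>A. (q a \<otimes> j a) \<otimes> (j a' \<otimes> p a'))"
      using fin jc pq a by (intro finsum_rdistr) auto
    also have "\<dots> = (\<Oplus>a'\<in>A. if a = a' then a' else \<zero>)"
    proof (intro finsum_cong')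
      fix a' assume a': "a' \<in> A"
      have "(q a \<otimes> j a) \<otimes> (j a' \<otimes> p a') = q a \<otimes> (j a \<otimes> j a') \<otimes> p a'"
        using a a' pq jc by (simp add: m_assoc)
      then show "(q a \<otimes> j a) \<otimes> (j a' \<otimes> p a') = (if a = a' then a' else \<zero>)"
        using orth[OF a a'] jc[OF a] pq a a' by auto
    qed (use Ac in auto)
    also have "\<dots> = a" using add.finprod_singleton[OF a fin, of "\<lambda>b. b"] Ac by auto
    finally show "(q a \<otimes> j a) \<otimes> ?P = a" .
  qed (use Ac in auto)
  finally have "?Q \<otimes> ?e \<otimes> ?P = (\<Oplus>a\<in>A. a)" using eP Pc Qc ec by (simp add: m_assoc)
  then show ?thesis using Pc Qc unfolding factors_through_def by blast
qed

text \<open>The existence half of the Krull-Schmidt theorem: if the local object \<open>f\<close> is cut out of the direct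
sum of the \<open>u i\<close>, its identity is a sum of maps through the primitive summands of the \<open>u i\<close>, and one
of these maps is invertible.\<close>
lemma primitive_factors_through_summand:
  assumes f: "primitive_idempotent R f" and reg: "\<And>w. w \<in> corner R f \<Longrightarrow> strongly_pi_regular R w"
    and U: "\<And>u. u \<in> U \<Longrightarrow> orthogonal_idempotents R (D u) \<and> (\<Oplus>v\<in>D u. v) = u"
    and I: "finite I" "\<And>i. i \<in> I \<Longrightarrow> a i \<in> carrier R" "\<And>i. i \<in> I \<Longrightarrow> b i \<in> carrier R"
       "\<And>i. i \<in> I \<Longrightarrow> u i \<in> U"
    and sum: "f \<otimes> (\<Oplus>i\<in>I. a i \<otimes> u i \<otimes> b i) \<otimes> f = f"
  shows "\<exists>v\<in>(\<Union>u\<in>U. D u). factors_through R f v"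
proof -
  have fc: "f \<in> carrier R" "f \<otimes> f = f"
    using f by (auto simp: primitive_idempotent_def idempotents_def)
  have Uc: "u \<in> carrier R" "\<And>v. v \<in> D u \<Longrightarrow> v \<in> carrier R" "finite (D u)" if "u \<in> U" for u
  proof -
    show D: "v \<in> carrier R" if "v \<in> D u" for v
      using U[OF \<open>u \<in> U\<close>] that by (auto simp: orthogonal_idempotents_def idempotents_def)
    show "finite (D u)" using U[OF that] by (auto simp: orthogonal_idempotents_def)
    have "(\<Oplus>v\<in>D u. v) \<in> carrier R" using D by auto
    then show "u \<in> carrier R" using U[OF that] by simp
  qed
  have cor: "f \<otimes> x \<otimes> f \<in> corner R f" if "x \<in> carrier R" for x
    using fc that by (auto simp: corner_def m_assoc) (simp add: m_assoc[symmetric])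
  have "f \<otimes> (\<Oplus>i\<in>I. a i \<otimes> u i \<otimes> b i) \<otimes> f = (\<Oplus>i\<in>I. f \<otimes> (a i \<otimes> u i \<otimes> b i)) \<otimes> f"
    using I fc Uc by (subst finsum_rdistr) auto
  also have "\<dots> = (\<Oplus>i\<in>I. f \<otimes> (a i \<otimes> u i \<otimes> b i) \<otimes> f)"
    using I fc Uc by (subst finsum_ldistr) auto
  finally have "\<one> \<otimes> (\<Oplus>i\<in>I. f \<otimes> (a i \<otimes> u i \<otimes> b i) \<otimes> f) = f"
    using sum fc by simp
  then obtain i y where i: "i \<in> I" and y: "y \<in> carrier R" "y \<otimes> (f \<otimes> (a i \<otimes> u i \<otimes> b i) \<otimes> f) = f"
    using primitive_left_invertible_summand[OF f reg I(1), of "\<lambda>i. f \<otimes> (a i \<otimes> u i \<otimes> b i) \<otimes> f" \<one>]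
      cor I Uc by auto
  note ic = I(2)[OF i] I(3)[OF i] Uc[OF I(4)[OF i]]
  have "f \<otimes> (a i \<otimes> u i \<otimes> b i) \<otimes> f = (f \<otimes> a i) \<otimes> (\<Oplus>v\<in>D (u i). v) \<otimes> (b i \<otimes> f)"
    using ic fc U[OF I(4)[OF i]] by (simp add: m_assoc)
  also have "\<dots> = (\<Oplus>v\<in>D (u i). (f \<otimes> a i) \<otimes> v) \<otimes> (b i \<otimes> f)"
    using ic fc by (subst finsum_rdistr) auto
  also have "\<dots> = (\<Oplus>v\<in>D (u i). (f \<otimes> a i) \<otimes> v \<otimes> (b i \<otimes> f))"
    using ic fc by (subst finsum_ldistr) auto
  also have "\<dots> = (\<Oplus>v\<in>D (u i). f \<otimes> (a i \<otimes> v \<otimes> b i) \<otimes> f)"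
    using ic fc by (intro finsum_cong') (auto simp: m_assoc)
  finally have y': "y \<otimes> (\<Oplus>v\<in>D (u i). f \<otimes> (a i \<otimes> v \<otimes> b i) \<otimes> f) = f" using y by simp
  obtain v z where v: "v \<in> D (u i)" and z: "z \<in> carrier R" "z \<otimes> (f \<otimes> (a i \<otimes> v \<otimes> b i) \<otimes> f) = f"
    using primitive_left_invertible_summand[OF f reg ic(5) _ y(1) y'] cor ic by auto
  have "(z \<otimes> f \<otimes> a i) \<otimes> v \<otimes> (b i \<otimes> f) = f" using z v ic fc by (simp add: m_assoc)
  then have "factors_through R f v" unfolding factors_through_def using z v ic fc by blast
  then show ?thesis using v i I by blast
qed

lemma semiperfect_decomposition:
  assumes e: "semiperfect_idempotent R e"
  obtains A where "orthogonal_idempotents R A" "(\<Oplus>a\<in>A. a) = e" "\<And>a. a \<in> A \<Longrightarrow> primitive_idempotent R a"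
     "\<And>a w. a \<in> A \<Longrightarrow> w \<in> corner R a \<Longrightarrow> strongly_pi_regular R w"
proof -
  from e obtain A where A: "orthogonal_idempotents R A" "(\<Oplus>a\<in>A. a) = e" "\<forall>a\<in>A. primitive_idempotent R a"
    using primitive_decomposition unfolding semiperfect_idempotent_def by metis
  have "strongly_pi_regular R w" if "a \<in> A" "w \<in> corner R a" for a w
  proof -
    have "a \<in> corner R e" using orthogonal_sum_in_corner A that by auto
    then have "w \<in> corner R e" using corner_trans that e
      by (auto simp: semiperfect_idempotent_def idempotents_def)
    then show ?thesis using e by (auto simp: semiperfect_idempotent_def)
  qed
  then show ?thesis using that A by blast
qed

text \<open>The finite set \<open>\<Lambda>\<close> collects the primitive constituents of the members of \<open>U\<close>. Each \<open>q\<close> has a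
decomposition whose members are equivalent to elements of \<open>\<Lambda>\<close>, and \<open>\<tau> q\<close> counts how often each of
them is used. The count refers to one decomposition chosen for
\<open>q\<close>.\<close>
theorem multiplicity_vector:
  assumes U: "finite U" "\<And>u. u \<in> U \<Longrightarrow> semiperfect_idempotent R u"
    and Q: "\<And>q. q \<in> Q \<Longrightarrow> semiperfect_idempotent R q"
    and sum: "\<And>q. q \<in> Q \<Longrightarrow> \<exists>(I :: 'i set) a u b. finite I \<and> a \<in> I \<rightarrow> carrier R \<and> b \<in> I \<rightarrow> carrier R \<and>
        u \<in> I \<rightarrow> U \<and> (\<Oplus>i\<in>I. a i \<otimes> u i \<otimes> b i) = q"
  obtains \<Lambda> :: "'a set" and \<tau> :: "'a \<Rightarrow> 'a \<Rightarrow> nat"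
  where "finite \<Lambda>"
    "\<And>q q'. q \<in> Q \<Longrightarrow> q' \<in> Q \<Longrightarrow> (\<And>v. v \<in> \<Lambda> \<Longrightarrow> \<tau> q v \<le> \<tau> q' v) \<Longrightarrow> factors_through R q q'"
proof -
  have "\<forall>e\<in>U \<union> Q. \<exists>A. orthogonal_idempotents R A \<and> (\<Oplus>a\<in>A. a) = e \<and> (\<forall>a\<in>A. primitive_idempotent R a) \<and>
     (\<forall>a\<in>A. \<forall>w\<in>corner R a. strongly_pi_regular R w)"
  proof
    fix e assume "e \<in> U \<union> Q"
    then have "semiperfect_idempotent R e" using U Q by auto
    from semiperfect_decomposition[OF this]
    show "\<exists>A. orthogonal_idempotents R A \<and> (\<Oplus>a\<in>A. a) = e \<and> (\<forall>a\<in>A. primitive_idempotent R a) \<and>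
      (\<forall>a\<in>A. \<forall>w\<in>corner R a. strongly_pi_regular R w)" by metis
  qed
  from bchoice[OF this] obtain D where D: "\<And>e. e \<in> U \<union> Q \<Longrightarrow> orthogonal_idempotents R (D e)"
    "\<And>e. e \<in> U \<union> Q \<Longrightarrow> (\<Oplus>a\<in>D e. a) = e"
    "\<And>e a. e \<in> U \<union> Q \<Longrightarrow> a \<in> D e \<Longrightarrow> primitive_idempotent R a"
    "\<And>e a w. e \<in> U \<union> Q \<Longrightarrow> a \<in> D e \<Longrightarrow> w \<in> corner R a \<Longrightarrow> strongly_pi_regular R w"
    by blast
  define \<Lambda> where "\<Lambda> = (\<Union>u\<in>U. D u)"
  have "\<exists>v\<in>\<Lambda>. factors_through R a v" if q: "q \<in> Q" and a: "a \<in> D q" for q a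
  proof -
    obtain I :: "'i set" and x u b where I: "finite I" "x \<in> I \<rightarrow> carrier R" "b \<in> I \<rightarrow> carrier R"
      "u \<in> I \<rightarrow> U" "(\<Oplus>i\<in>I. x i \<otimes> u i \<otimes> b i) = q" using sum[OF q] by blast
    have aq: "a \<otimes> q \<otimes> a = a"
      using orthogonal_sum_absorbs[OF D(1) a] D(2)[of q] D(1)[of q] q a
      by (auto simp: orthogonal_idempotents_def idempotents_def)
    have "\<exists>v\<in>(\<Union>u\<in>U. D u). factors_through R a v"
    proof (rule primitive_factors_through_summand[where I = I and a = x and b = b and u = u])
      show "a \<otimes> (\<Oplus>i\<in>I. x i \<otimes> u i \<otimes> b i) \<otimes> a = a" using I(5) aq by simp
      show "primitive_idempotent R a" using D(3) q a by blast
      show "strongly_pi_regular R w" if "w \<in> corner R a" for w using D(4) q a that by blast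
      show "orthogonal_idempotents R (D u) \<and> (\<Oplus>v\<in>D u. v) = u" if "u \<in> U" for u
        using D(1,2) that by blast
    qed (use I in auto)
    then show ?thesis by (simp add: \<Lambda>_def)
  qed
  then have "\<forall>a\<in>(\<Union>q\<in>Q. D q). \<exists>v. v \<in> \<Lambda> \<and> factors_through R a v" by blast
  from bchoice[OF this]
  obtain l where l: "\<And>q a. q \<in> Q \<Longrightarrow> a \<in> D q \<Longrightarrow> l a \<in> \<Lambda> \<and> factors_through R a (l a)"
    by blast
  have Lprim: "primitive_idempotent R v" if "v \<in> \<Lambda>" for v using that D(3) by (auto simp: \<Lambda>_def)
  have leq: "equivalent_idempotents R a (l a)" if "q \<in> Q" "a \<in> D q" for q a
  proof -
    have "primitive_idempotent R a" using D(3) that by blast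
    then show ?thesis using equivalent_of_primitive[of "l a" a] l[OF that] Lprim
      by (auto simp: primitive_idempotent_def)
  qed
  define \<tau> where "\<tau> q v = card {a \<in> D q. l a = v}" for q v
  have "factors_through R q q'" if q: "q \<in> Q" "q' \<in> Q" and le: "\<And>v. v \<in> \<Lambda> \<Longrightarrow> \<tau> q v \<le> \<tau> q' v" for q q'
  proof -
    have "finite (D q)" "finite (D q')" using D(1) q by (auto simp: orthogonal_idempotents_def)
    moreover have "l ` D q \<subseteq> \<Lambda>" using l q by auto
    ultimately obtain j where j: "inj_on j (D q)" "j ` D q \<subseteq> D q'" "\<forall>a\<in>D q. l (j a) = l a"
      using label_preserving_injection[of "D q" "D q'" \<Lambda> l l] le unfolding \<tau>_def by blast
    have "factors_through R (\<Oplus>a\<in>D q. a) (\<Oplus>a\<in>D q'. a)"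
    proof (rule factors_through_orthogonal_sums[OF _ _ j(1,2)])
      fix a assume a: "a \<in> D q"
      then have ja: "j a \<in> D q'" using j by auto
      have "factors_through R (l a) (j a)"
        using equivalent_imp_factors_through(2)[OF leq[OF q(2) ja]] j a by simp
      moreover have "j a \<in> carrier R" using D(1)[of q'] q ja
        by (auto simp: orthogonal_idempotents_def idempotents_def)
      ultimately show "factors_through R a (j a)"
        using factors_through_trans l[OF q(1) a] by blast
    qed (use D q in auto)
    then show ?thesis using D(2) q by simp
  qed
  moreover have "finite \<Lambda>" using U D(1) by (auto simp: \<Lambda>_def orthogonal_idempotents_def)
  ultimately show ?thesis using that by blast
qed

end

section \<open>Dickson's lemma\<close>

text \<open>Among the monotone subsequences, a decreasing one is eventually constant.\<close>
lemma nat_sequence_incseq_subseq: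
  fixes s :: "nat \<Rightarrow> nat"
  shows "\<exists>r. strict_mono r \<and> incseq (s \<circ> r)"
proof -
  obtain r where r: "strict_mono r" "monoseq (\<lambda>n. s (r n))" using seq_monosub by blast
  show ?thesis
  proof (cases "incseq (\<lambda>n. s (r n))")
    case True
    then show ?thesis using r by (auto simp: o_def)
  next
    case False
    then have dec: "decseq (\<lambda>n. s (r n))" using r by (auto simp: monoseq_iff)
    define k where "k = (LEAST v. v \<in> range (\<lambda>n. s (r n)))"
    have "k \<in> range (\<lambda>n. s (r n))" unfolding k_def by (rule LeastI_ex) blast
    then obtain N where N: "k = s (r N)" by blast
    have "s (r (N + n)) = k" for n
    proof (rule antisym)
      show "s (r (N + n)) \<le> k" using dec N by (simp add: decseq_def)
      show "k \<le> s (r (N + n))" unfolding k_def by (rule Least_le) blast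
    qed
    then have "incseq (s \<circ> (\<lambda>n. r (N + n)))" by (simp add: incseq_def)
    moreover have "strict_mono (\<lambda>n. r (N + n))" using r by (auto simp: strict_mono_def)
    ultimately show ?thesis by blast
  qed
qed

lemma dickson_sequence:
  fixes t :: "nat \<Rightarrow> 'b \<Rightarrow> nat"
  assumes "finite V"
  shows "\<exists>r. strict_mono r \<and> (\<forall>v\<in>V. incseq (\<lambda>n. t (r n) v))"
  using assms
proof (induction V rule: finite_induct)
  case empty
  show ?case by (intro exI[of _ id]) (auto simp: strict_mono_def)
next
  case (insert v V)
  then obtain r where r: "strict_mono r" "\<forall>v\<in>V. incseq (\<lambda>n. t (r n) v)" by blast
  obtain r' where r': "strict_mono r'" "incseq ((\<lambda>n. t (r n) v) \<circ> r')"
    using nat_sequence_incseq_subseq by blast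
  have "strict_mono (r \<circ> r')" using r r' by (simp add: strict_mono_o)
  moreover have "incseq (\<lambda>n. t ((r \<circ> r') n) w)" if "w \<in> insert v V" for w
    using that r r' by (auto simp: incseq_def strict_mono_less_eq o_def)
  ultimately show ?case by blast
qed

text \<open>Without finitely many representatives one could choose an infinite sequence in which no term is
\<open>P\<close>-related to an earlier one; Dickson's lemma produces two terms with comparable vectors.\<close>
lemma dickson_finite_representatives:
  fixes \<tau> :: "'b \<Rightarrow> 'c \<Rightarrow> nat"
  assumes "finite V" and le: "\<And>q q'. q \<in> Q \<Longrightarrow> q' \<in> Q \<Longrightarrow> (\<And>v. v \<in> V \<Longrightarrow> \<tau> q v \<le> \<tau> q' v) \<Longrightarrow> P q' q"
  shows "\<exists>F. finite F \<and> F \<subseteq> Q \<and> (\<forall>q\<in>Q. \<exists>f\<in>F. P q f)"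
proof (rule ccontr)
  assume no: "\<not> ?thesis"
  have ex: "\<exists>q. q \<in> Q \<and> (\<forall>f\<in>F. \<not> P q f)" if F: "finite F" "F \<subseteq> Q" for F
  proof (rule ccontr)
    assume "\<not> ?thesis"
    then have "\<forall>q\<in>Q. \<exists>f\<in>F. P q f" by blast
    with no F show False by blast
  qed
  define nxt where "nxt F = (SOME q. q \<in> Q \<and> (\<forall>f\<in>F. \<not> P q f))" for F
  have nxt: "nxt F \<in> Q \<and> (\<forall>f\<in>F. \<not> P (nxt F) f)" if "finite F" "F \<subseteq> Q" for F
    unfolding nxt_def by (rule someI_ex) (rule ex[OF that])
  define G where "G = rec_nat {} (\<lambda>_ F. insert (nxt F) F)"
  have G: "finite (G n) \<and> G n \<subseteq> Q" for n by (induction n) (auto simp: G_def nxt)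
  define s where "s n = nxt (G n)" for n
  have GS: "G (Suc n) = insert (s n) (G n)" for n by (simp add: G_def s_def)
  have sG: "s m \<in> G n" if "m < n" for m n
    using that by (induction n) (auto simp: GS less_Suc_eq)
  have sQ: "s n \<in> Q" "\<And>m. m < n \<Longrightarrow> \<not> P (s n) (s m)" for n
    using nxt[of "G n"] G sG by (auto simp: s_def)
  obtain r where r: "strict_mono r" "\<forall>v\<in>V. incseq (\<lambda>n. \<tau> (s (r n)) v)"
    using dickson_sequence[OF assms(1), of "\<lambda>n. \<tau> (s n)"] by blast
  have "P (s (r 1)) (s (r 0))"
    using r by (intro le sQ) (auto simp: incseq_def)
  moreover have "r 0 < r 1" using r by (simp add: strict_mono_def)
  ultimately show False using sQ by blast
qed

section \<open>Linear dependence and the Nakayama lemma\<close>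

text \<open>Every nonunit lies in a maximal ideal by Zorn's lemma, and there is only one.\<close>
lemma local_ring_nonunits_ideal:
  fixes R (structure)
  assumes "local_ring R"
  obtains \<mm> where "ideal \<mm> R" "\<one>\<^bsub>R\<^esub> \<notin> \<mm>" "carrier R - \<mm> \<subseteq> Units R"
proof -
  interpret cring R using assms by (simp add: local_ring_def)
  obtain \<mm> where m: "maximalideal \<mm> R" and uniq: "\<And>J. maximalideal J R \<Longrightarrow> J = \<mm>"
    using assms unfolding local_ring_def by blast
  interpret m: maximalideal \<mm> R by (rule m)
  have "a \<in> Units R" if a: "a \<in> carrier R" "a \<notin> \<mm>" for a
  proof (rule ccontr)
    assume nu: "a \<notin> Units R"
    define \<A> where "\<A> = {J. ideal J R \<and> a \<in> J \<and> \<one> \<notin> J}"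
    have "\<one> \<notin> PIdl a"
    proof
      assume "\<one> \<in> PIdl a"
      then obtain x where "x \<in> carrier R" "\<one> = x \<otimes> a" by (auto simp: cgenideal_def)
      then show False using nu a by (auto simp: Units_def m_comm)
    qed
    then have ne: "\<A> \<noteq> {}"
      using cgenideal_ideal[OF a(1)] cgenideal_self[OF a(1)] by (auto simp: \<A>_def)
    have "\<exists>J\<in>\<A>. \<forall>X\<in>\<A>. J \<subseteq> X \<longrightarrow> X = J"
    proof (rule subset_Zorn_nonempty[OF ne])
      fix C assume C: "C \<noteq> {}" "subset.chain \<A> C"
      then have sub: "C \<subseteq> \<A>" by (simp add: pred_on.chain_def)
      have "subset.chain {I. ideal I R} C" using C by (auto simp: pred_on.chain_def \<A>_def)
      from chain_Union_is_ideal[OF this] have "ideal (\<Union>C) R" using C by simp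
      then show "\<Union>C \<in> \<A>" using sub C(1) by (auto simp: \<A>_def)
    qed
    then obtain J where J: "J \<in> \<A>" "\<And>X. X \<in> \<A> \<Longrightarrow> J \<subseteq> X \<Longrightarrow> X = J" by blast
    have "maximalideal J R"
    proof (rule maximalidealI)
      show "ideal J R" "carrier R \<noteq> J" using J(1) by (auto simp: \<A>_def)
      fix X assume X: "ideal X R" "J \<subseteq> X" "X \<subseteq> carrier R"
      then show "X = J \<or> X = carrier R"
        using J ideal.one_imp_carrier[OF X(1)] by (auto simp: \<A>_def)
    qed
    then show False using uniq J(1) a by (auto simp: \<A>_def)
  qed
  moreover have "\<one> \<notin> \<mm>" using m.one_imp_carrier m.I_notcarr by auto
  ultimately show ?thesis using that m.is_ideal by blast
qed

text \<open>More vectors than coordinates over the residue field are linearly dependent. Gaussian elimination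
is carried out on representatives in \<open>R\<close>, which avoids passing to the residue field.\<close>
lemma (in cring) linear_dependence_mod_ideal:
  assumes m: "ideal \<mm> R" "\<one> \<notin> \<mm>" "carrier R - \<mm> \<subseteq> Units R"
    and "finite J" "finite A" "card J < card A"
    and "\<And>a j. a \<in> A \<Longrightarrow> j \<in> J \<Longrightarrow> V a j \<in> carrier R"
  shows "\<exists>c\<in>A \<rightarrow> carrier R. (\<exists>a\<in>A. c a \<notin> \<mm>) \<and> (\<forall>j\<in>J. (\<Oplus>a\<in>A. c a \<otimes> V a j) \<in> \<mm>)"
  using assms(4-)
proof (induction J arbitrary: A V rule: finite_induct)
  case empty
  then have "A \<noteq> {}" by auto
  then show ?case using m by (intro bexI[of _ "\<lambda>_. \<one>"]) auto
next
  case (insert j J)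
  interpret m: ideal \<mm> R by (rule m)
  have Vc: "V a j' \<in> carrier R" if "a \<in> A" "j' \<in> insert j J" for a j' using insert.prems that by auto
  have "A \<noteq> {}" using insert.prems by auto
  then obtain a0 u where a0: "a0 \<in> A" and u: "u \<in> carrier R"
    and cases: "(u = \<zero> \<and> (\<forall>a\<in>A. V a j \<in> \<mm>)) \<or> u \<otimes> V a0 j = \<one>"
    \<comment> \<open>The pivot. A column that vanishes modulo \<open>\<mm>\<close> needs no elimination, which \<open>u = \<zero>\<close> encodes.\<close>
  proof (cases "\<forall>a\<in>A. V a j \<in> \<mm>")
    case True
    then show ?thesis using that[of _ \<zero>] \<open>A \<noteq> {}\<close> by auto
  next
    case False
    then obtain a where a: "a \<in> A" "V a j \<notin> \<mm>" by blast
    then have "V a j \<in> Units R" using m(3) Vc by auto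
    then show ?thesis using that[OF a(1), of "inv (V a j)"] by auto
  qed
  define B where "B = A - {a0}"
  have B: "finite B" "a0 \<notin> B" "insert a0 B = A" "B \<subseteq> A" using insert.prems a0 by (auto simp: B_def)
  have cB: "card J < card B"
    using insert.prems insert.hyps a0 by (simp add: B_def)
  define V' where "V' a j' = V a j' \<ominus> V a j \<otimes> u \<otimes> V a0 j'" for a j'
  have V'c: "V' a j' \<in> carrier R" if "a \<in> B" "j' \<in> J" for a j'
    using that Vc u a0 B by (auto simp: V'_def)
  from insert.IH[OF B(1) cB, of V', OF V'c]
  obtain c where c: "c \<in> B \<rightarrow> carrier R" "\<exists>a\<in>B. c a \<notin> \<mm>" "\<And>j'. j' \<in> J \<Longrightarrow> (\<Oplus>a\<in>B. c a \<otimes> V' a j') \<in> \<mm>"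
    by blast
  have cc: "c a \<in> carrier R" if "a \<in> B" for a using c that by auto
  define s where "s = (\<Oplus>a\<in>B. c a \<otimes> V a j)"
  have sc: "s \<in> carrier R" unfolding s_def using cc Vc B by auto
  define c' where "c' a = (if a = a0 then \<ominus> (s \<otimes> u) else c a)" for a
  have c'c: "c' \<in> A \<rightarrow> carrier R" using cc sc u B by (auto simp: c'_def)
  have sum: "(\<Oplus>a\<in>A. c' a \<otimes> V a j') = \<ominus> (s \<otimes> u) \<otimes> V a0 j' \<oplus> (\<Oplus>a\<in>B. c a \<otimes> V a j')"
    if j': "j' \<in> insert j J" for j'
  proof -
    have VB: "V a j' \<in> carrier R" if "a \<in> B" for a using that Vc[OF _ j'] B by auto
    have "(\<Oplus>a\<in>A. c' a \<otimes> V a j') = (\<Oplus>a\<in>insert a0 B. c' a \<otimes> V a j')" using B by simp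
    also have "\<dots> = c' a0 \<otimes> V a0 j' \<oplus> (\<Oplus>a\<in>B. c' a \<otimes> V a j')"
      using B c'c VB Vc[OF a0 j'] by (intro finsum_insert) auto
    also have "(\<Oplus>a\<in>B. c' a \<otimes> V a j') = (\<Oplus>a\<in>B. c a \<otimes> V a j')"
      using B cc VB by (intro finsum_cong') (auto simp: c'_def)
    finally show ?thesis by (simp add: c'_def)
  qed
  have "(\<Oplus>a\<in>A. c' a \<otimes> V a j') \<in> \<mm>" if j': "j' \<in> insert j J" for j'
  proof (cases "j' = j")
    case True
    have e: "(\<Oplus>a\<in>A. c' a \<otimes> V a j') = \<ominus> (s \<otimes> u) \<otimes> V a0 j \<oplus> s"
      using sum[OF j'] True by (simp add: s_def)
    from cases show ?thesis
    proof
      assume *: "u = \<zero> \<and> (\<forall>a\<in>A. V a j \<in> \<mm>)"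
      have "s \<in> \<mm>" unfolding s_def
        using B(1) * cc B(4)
      proof (induction B rule: finite_induct)
        case (insert b B)
        then have "c b \<otimes> V b j \<in> \<mm>" "c b \<otimes> V b j \<in> carrier R" "(\<lambda>a. c a \<otimes> V a j) \<in> B \<rightarrow> carrier R"
          using Vc by (auto simp: m.I_l_closed)
        then show ?case using insert by (simp add: finsum_insert m.a_closed)
      qed simp
      then show ?thesis using e * sc Vc[OF a0] by simp
    next
      assume *: "u \<otimes> V a0 j = \<one>"
      have "\<ominus> (s \<otimes> u) \<otimes> V a0 j = \<ominus> (s \<otimes> (u \<otimes> V a0 j))"
        using sc u Vc[OF a0] by (simp add: l_minus m_assoc)
      then show ?thesis using e * sc by (simp add: l_neg)
    qed
  next
    case False
    then have jJ: "j' \<in> J" using j' by auto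
    have VB: "V a j' \<in> carrier R" "V a j \<in> carrier R" if "a \<in> B" for a
      using that Vc j' B by auto
    have V0: "V a0 j' \<in> carrier R" using Vc[OF a0 j'] .
    have "(\<Oplus>a\<in>B. c a \<otimes> V' a j') = (\<Oplus>a\<in>B. c a \<otimes> V a j' \<oplus> (c a \<otimes> V a j) \<otimes> (\<ominus> (u \<otimes> V a0 j')))"
      using cc VB V0 u
      by (intro finsum_cong') (auto simp: V'_def minus_eq r_distr m_assoc r_minus)
    also have "\<dots> = (\<Oplus>a\<in>B. c a \<otimes> V a j') \<oplus> (\<Oplus>a\<in>B. (c a \<otimes> V a j) \<otimes> (\<ominus> (u \<otimes> V a0 j')))"
      using cc VB V0 u by (intro finsum_addf) auto
    also have "(\<Oplus>a\<in>B. (c a \<otimes> V a j) \<otimes> (\<ominus> (u \<otimes> V a0 j'))) = s \<otimes> (\<ominus> (u \<otimes> V a0 j'))"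
      unfolding s_def using B cc VB V0 u by (intro finsum_ldistr[symmetric]) auto
    also have "s \<otimes> (\<ominus> (u \<otimes> V a0 j')) = \<ominus> (s \<otimes> u) \<otimes> V a0 j'"
      using sc u V0 by (simp add: l_minus r_minus m_assoc)
    also have "(\<Oplus>a\<in>B. c a \<otimes> V a j') \<oplus> \<dots> = (\<Oplus>a\<in>A. c' a \<otimes> V a j')"
      unfolding sum[OF j'] using sc u V0 cc VB by (intro a_comm) auto
    finally show ?thesis using c(3)[OF jJ] by simp
  qed
  moreover have "\<exists>a\<in>A. c' a \<notin> \<mm>" using c(2) B by (auto simp: c'_def)
  ultimately show ?case using c'c by blast
qed

context module
begin

lemma submodule_zero: "submodule W R M \<Longrightarrow> \<zero>\<^bsub>M\<^esub> \<in> W"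
  using subgroup.one_closed[of W "add_monoid M"] by (simp add: submodule_def)

lemma submodule_minus: "submodule W R M \<Longrightarrow> x \<in> W \<Longrightarrow> y \<in> W \<Longrightarrow> x \<ominus>\<^bsub>M\<^esub> y \<in> W"
  by (simp add: M.minus_eq submoduleE)

lemma submodule_finsum:
  assumes W: "submodule W R M" and "h \<in> A \<rightarrow> W"
  shows "(\<Oplus>\<^bsub>M\<^esub>a\<in>A. h a) \<in> W"
  using assms(2)
proof (induction A rule: infinite_finite_induct)
  case (insert a A)
  moreover have "h \<in> A \<rightarrow> carrier M" "h a \<in> carrier M"
    using insert.prems submoduleE(1)[OF W] by auto
  ultimately show ?case using submoduleE(5)[OF W] by (simp add: M.finsum_insert)
qed (use submodule_zero[OF W] in auto)

text \<open>The submodule \<open>W + I x\<^sub>1 + \<dots> + I x\<^sub>n\<close>.\<close>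
primrec ideal_combinations :: "'c set \<Rightarrow> 'a set \<Rightarrow> 'c list \<Rightarrow> 'c set" where
  "ideal_combinations W I [] = W"
| "ideal_combinations W I (x # xs) = {n \<oplus>\<^bsub>M\<^esub> i \<odot>\<^bsub>M\<^esub> x |n i. n \<in> ideal_combinations W I xs \<and> i \<in> I}"

lemma submodule_ideal_combinations:
  assumes I: "ideal I R" and W: "submodule W R M" and "set xs \<subseteq> carrier M"
  shows "submodule (ideal_combinations W I xs) R M"
  using assms(3)
proof (induction xs)
  case (Cons x xs)
  interpret I: ideal I R by (rule I)
  have N: "submodule (ideal_combinations W I xs) R M" and x: "x \<in> carrier M" using Cons by auto
  note NE = submoduleE[OF N] submodule_zero[OF N]
  have Nc: "n \<in> carrier M" if "n \<in> ideal_combinations W I xs" for n using NE(1) that by blast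
  have Ic: "i \<in> carrier R" if "i \<in> I" for i using that by (rule I.a_Hcarr)
  show ?case
  proof (rule submoduleI)
    show "ideal_combinations W I (x # xs) \<subseteq> carrier M" using Nc Ic x by auto
    have "\<zero>\<^bsub>M\<^esub> = \<zero>\<^bsub>M\<^esub> \<oplus>\<^bsub>M\<^esub> \<zero> \<odot>\<^bsub>M\<^esub> x" using x by simp
    then show "\<zero>\<^bsub>M\<^esub> \<in> ideal_combinations W I (x # xs)"
      using NE(7) I.zero_closed unfolding ideal_combinations.simps by blast
  next
    fix a assume "a \<in> ideal_combinations W I (x # xs)"
    then obtain n i where a: "a = n \<oplus>\<^bsub>M\<^esub> i \<odot>\<^bsub>M\<^esub> x" "n \<in> ideal_combinations W I xs" "i \<in> I" by auto
    then have "\<ominus>\<^bsub>M\<^esub> a = \<ominus>\<^bsub>M\<^esub> n \<oplus>\<^bsub>M\<^esub> (\<ominus> i) \<odot>\<^bsub>M\<^esub> x"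
      using Nc Ic x by (simp add: M.minus_add smult_l_minus)
    then show "\<ominus>\<^bsub>M\<^esub> a \<in> ideal_combinations W I (x # xs)"
      using NE(3)[OF a(2)] I.a_inv_closed[OF a(3)] by auto
  next
    fix a b assume "a \<in> ideal_combinations W I (x # xs)" "b \<in> ideal_combinations W I (x # xs)"
    then obtain n i n' i' where a: "a = n \<oplus>\<^bsub>M\<^esub> i \<odot>\<^bsub>M\<^esub> x" "n \<in> ideal_combinations W I xs" "i \<in> I"
      and b: "b = n' \<oplus>\<^bsub>M\<^esub> i' \<odot>\<^bsub>M\<^esub> x" "n' \<in> ideal_combinations W I xs" "i' \<in> I" by auto
    have "a \<oplus>\<^bsub>M\<^esub> b = (n \<oplus>\<^bsub>M\<^esub> n') \<oplus>\<^bsub>M\<^esub> (i \<oplus> i') \<odot>\<^bsub>M\<^esub> x"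
      using a b Nc Ic x by (simp add: smult_l_distr M.a_ac)
    then show "a \<oplus>\<^bsub>M\<^esub> b \<in> ideal_combinations W I (x # xs)"
      using NE(5)[OF a(2) b(2)] I.a_closed[OF a(3) b(3)] by auto
  next
    fix r a assume r: "r \<in> carrier R" and "a \<in> ideal_combinations W I (x # xs)"
    then obtain n i where a: "a = n \<oplus>\<^bsub>M\<^esub> i \<odot>\<^bsub>M\<^esub> x" "n \<in> ideal_combinations W I xs" "i \<in> I" by auto
    have "r \<odot>\<^bsub>M\<^esub> a = r \<odot>\<^bsub>M\<^esub> n \<oplus>\<^bsub>M\<^esub> (r \<otimes> i) \<odot>\<^bsub>M\<^esub> x"
      using a r Nc Ic x by (simp add: smult_r_distr smult_assoc1)
    then show "r \<odot>\<^bsub>M\<^esub> a \<in> ideal_combinations W I (x # xs)"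
      using NE(4)[OF r a(2)] I.I_l_closed[OF a(3) r] by auto
  qed
qed (use W in auto)

lemma ideal_combinations_mem:
  assumes I: "ideal I R" and W: "submodule W R M" and "set xs \<subseteq> carrier M"
    and "i \<in> I" "x \<in> set xs"
  shows "i \<odot>\<^bsub>M\<^esub> x \<in> ideal_combinations W I xs"
  using assms(3,5)
proof (induction xs)
  case (Cons y xs)
  interpret I: ideal I R by (rule I)
  note N = submodule_ideal_combinations[OF I W, of xs]
  show ?case
  proof (cases "x = y")
    case True
    then have "i \<odot>\<^bsub>M\<^esub> x = \<zero>\<^bsub>M\<^esub> \<oplus>\<^bsub>M\<^esub> i \<odot>\<^bsub>M\<^esub> y"
      using Cons.prems I.a_Hcarr[OF \<open>i \<in> I\<close>] by auto
    moreover have "\<zero>\<^bsub>M\<^esub> \<in> ideal_combinations W I xs" using submodule_zero[OF N] Cons.prems by auto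
    ultimately show ?thesis using \<open>i \<in> I\<close> unfolding ideal_combinations.simps by blast
  next
    case False
    then have "i \<odot>\<^bsub>M\<^esub> x \<in> ideal_combinations W I xs" using Cons by auto
    moreover have "i \<odot>\<^bsub>M\<^esub> x = i \<odot>\<^bsub>M\<^esub> x \<oplus>\<^bsub>M\<^esub> \<zero> \<odot>\<^bsub>M\<^esub> y"
      using Cons.prems I.a_Hcarr[OF \<open>i \<in> I\<close>] False by auto
    ultimately show ?thesis using I.zero_closed unfolding ideal_combinations.simps by blast
  qed
qed auto

lemma ideal_combinations_absorb:
  assumes I: "ideal I R" and W: "submodule W R M" and xs: "set xs \<subseteq> carrier M" and a: "a \<in> carrier R"
    and W': "\<And>z. z \<in> set xs \<Longrightarrow> a \<odot>\<^bsub>M\<^esub> z \<in> W" and z: "z \<in> ideal_combinations W I xs"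
  shows "a \<odot>\<^bsub>M\<^esub> z \<in> W"
  using xs W' z
proof (induction xs arbitrary: z)
  case Nil
  then show ?case using submoduleE(4)[OF W a] by auto
next
  case (Cons x xs)
  interpret I: ideal I R by (rule I)
  obtain n i where z: "z = n \<oplus>\<^bsub>M\<^esub> i \<odot>\<^bsub>M\<^esub> x" "n \<in> ideal_combinations W I xs" "i \<in> I"
    using Cons.prems by auto
  have n: "n \<in> carrier M" using submoduleE(1)[OF submodule_ideal_combinations[OF I W]] z Cons.prems by auto
  have ic: "i \<in> carrier R" using z(3) by (rule I.a_Hcarr)
  have x: "x \<in> carrier M" using Cons.prems by auto
  have "a \<odot>\<^bsub>M\<^esub> z = a \<odot>\<^bsub>M\<^esub> n \<oplus>\<^bsub>M\<^esub> (a \<otimes> i) \<odot>\<^bsub>M\<^esub> x"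
    using z n ic a x by (simp add: smult_r_distr smult_assoc1)
  also have "a \<otimes> i = i \<otimes> a" using a ic by (rule R.m_comm)
  also have "(i \<otimes> a) \<odot>\<^bsub>M\<^esub> x = i \<odot>\<^bsub>M\<^esub> (a \<odot>\<^bsub>M\<^esub> x)" using a ic x by (simp add: smult_assoc1)
  finally have e: "a \<odot>\<^bsub>M\<^esub> z = a \<odot>\<^bsub>M\<^esub> n \<oplus>\<^bsub>M\<^esub> i \<odot>\<^bsub>M\<^esub> (a \<odot>\<^bsub>M\<^esub> x)" .
  have "a \<odot>\<^bsub>M\<^esub> n \<in> W" using Cons.IH[OF _ _ z(2)] Cons.prems by auto
  moreover have "i \<odot>\<^bsub>M\<^esub> (a \<odot>\<^bsub>M\<^esub> x) \<in> W" using submoduleE(4)[OF W ic] Cons.prems by auto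
  ultimately show ?case unfolding e by (rule submoduleE(5)[OF W])
qed

text \<open>The determinant trick without determinants: if \<open>x\<^sub>1, \<dots>, x\<^sub>n\<close> are combinations of themselves with
coefficients in \<open>I\<close>, modulo \<open>W\<close>, then a single element of \<open>1 + I\<close> carries all of them into \<open>W\<close>.
The first generator is eliminated after multiplying all relations by the factor \<open>1 - i\<close> that comes
from its own relation. It is applied below both to the local ring \<open>R\<close> and to a commutative ring of
endomorphisms.\<close>
theorem nakayama_mod_submodule:
  assumes I: "ideal I R" and W: "submodule W R M" and "set xs \<subseteq> carrier M"
    and "\<And>x. x \<in> set xs \<Longrightarrow> x \<in> ideal_combinations W I xs"
  shows "\<exists>i\<in>I. \<forall>x\<in>set xs. (\<one> \<ominus> i) \<odot>\<^bsub>M\<^esub> x \<in> W"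
  using assms(3,4)
proof (induction xs)
  case Nil
  then show ?case using additive_subgroup.zero_closed[OF ideal.axioms(1)[OF I]] by auto
next
  case (Cons x xs)
  interpret I: ideal I R by (rule I)
  let ?N = "ideal_combinations W I xs"
  have x: "x \<in> carrier M" and xs: "set xs \<subseteq> carrier M" using Cons.prems by auto
  have N: "submodule ?N R M" using I W xs by (rule submodule_ideal_combinations)
  note NE = submoduleE[OF N]
  have Nc: "n \<in> carrier M" if "n \<in> ?N" for n using NE(1) that by blast
  obtain n i where ni: "x = n \<oplus>\<^bsub>M\<^esub> i \<odot>\<^bsub>M\<^esub> x" "n \<in> ?N" "i \<in> I"
    using Cons.prems(2)[of x] by auto
  have i: "i \<in> carrier R" using ni(3) by (rule I.a_Hcarr)
  let ?j = "\<one> \<ominus> i"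
  have j: "?j \<in> carrier R" using i by simp
  have "?j \<odot>\<^bsub>M\<^esub> x = x \<ominus>\<^bsub>M\<^esub> i \<odot>\<^bsub>M\<^esub> x"
    using i x by (simp add: R.minus_eq smult_l_distr smult_l_minus M.minus_eq)
  also have "\<dots> = n"
    using ni(1) Nc[OF ni(2)] i x by (metis M.add.inv_solve_right M.minus_eq smult_closed)
  finally have jx: "?j \<odot>\<^bsub>M\<^esub> x \<in> ?N" using ni(2) by simp
  have "y \<in> ?N" if y: "y \<in> set xs" for y
  proof -
    have yc: "y \<in> carrier M" using y xs by auto
    obtain n' d where d: "y = n' \<oplus>\<^bsub>M\<^esub> d \<odot>\<^bsub>M\<^esub> x" "n' \<in> ?N" "d \<in> I"
      using Cons.prems(2)[of y] y by auto
    have dc: "d \<in> carrier R" using d(3) by (rule I.a_Hcarr)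
    have "?j \<odot>\<^bsub>M\<^esub> y = ?j \<odot>\<^bsub>M\<^esub> n' \<oplus>\<^bsub>M\<^esub> d \<odot>\<^bsub>M\<^esub> (?j \<odot>\<^bsub>M\<^esub> x)"
    proof -
      have "?j \<odot>\<^bsub>M\<^esub> (d \<odot>\<^bsub>M\<^esub> x) = (?j \<otimes> d) \<odot>\<^bsub>M\<^esub> x" using j dc x by (simp add: smult_assoc1)
      also have "\<dots> = d \<odot>\<^bsub>M\<^esub> (?j \<odot>\<^bsub>M\<^esub> x)"
        using j dc x by (metis R.m_comm smult_assoc1)
      finally show ?thesis using d Nc[OF d(2)] j dc x by (simp add: smult_r_distr)
    qed
    then have "?j \<odot>\<^bsub>M\<^esub> y \<in> ?N" using NE(4)[OF j d(2)] NE(4)[OF dc jx] NE(5) by auto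
    moreover have "i \<odot>\<^bsub>M\<^esub> y \<in> ?N" by (rule ideal_combinations_mem[OF I W xs ni(3) y])
    moreover have "y = ?j \<odot>\<^bsub>M\<^esub> y \<oplus>\<^bsub>M\<^esub> i \<odot>\<^bsub>M\<^esub> y"
    proof -
      have "?j \<oplus> i = \<one>" using i by (simp add: R.minus_eq R.a_assoc R.l_neg)
      then show ?thesis using i j yc by (metis smult_l_distr smult_one)
    qed
    ultimately show ?thesis using NE(5) by metis
  qed
  with Cons.IH xs obtain a where a: "a \<in> I" "\<And>z. z \<in> set xs \<Longrightarrow> (\<one> \<ominus> a) \<odot>\<^bsub>M\<^esub> z \<in> W" by blast
  have ac: "a \<in> carrier R" using a(1) by (rule I.a_Hcarr)
  let ?b = "\<one> \<ominus> a"
  have b: "?b \<in> carrier R" using ac by simp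
  let ?k = "a \<oplus> i \<ominus> a \<otimes> i"
  have k: "\<one> \<ominus> ?k = ?b \<otimes> ?j"
    using ac i by (simp add: R.minus_eq R.l_distr R.r_distr R.l_minus R.r_minus R.minus_add R.a_ac)
  have "?k \<in> I" using a(1) ni(3) i ac by (simp add: R.minus_eq I.I_r_closed)
  moreover have "(\<one> \<ominus> ?k) \<odot>\<^bsub>M\<^esub> z \<in> W" if z: "z \<in> set (x # xs)" for z
  proof (cases "z = x")
    case True
    have "(\<one> \<ominus> ?k) \<odot>\<^bsub>M\<^esub> x = ?b \<odot>\<^bsub>M\<^esub> (?j \<odot>\<^bsub>M\<^esub> x)" unfolding k using b j x by (simp add: smult_assoc1)
    then show ?thesis using ideal_combinations_absorb[OF I W xs b a(2) jx] True by simp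
  next
    case False
    then have z: "z \<in> set xs" "z \<in> carrier M" using that xs by auto
    have "(\<one> \<ominus> ?k) \<odot>\<^bsub>M\<^esub> z = ?j \<odot>\<^bsub>M\<^esub> (?b \<odot>\<^bsub>M\<^esub> z)"
      unfolding k using b j z by (metis R.m_comm smult_assoc1)
    then show ?thesis using submoduleE(4)[OF W j a(2)[OF z(1)]] by simp
  qed
  ultimately show ?case by blast
qed

text \<open>The submodule \<open>I M\<close>.\<close>
definition ideal_multiples :: "'a set \<Rightarrow> 'c set" where
  "ideal_multiples I = \<Inter>{W. submodule W R M \<and> (\<forall>i\<in>I. \<forall>x\<in>carrier M. i \<odot>\<^bsub>M\<^esub> x \<in> W)}"

lemma ideal_multiples_mem:
  "i \<in> I \<Longrightarrow> x \<in> carrier M \<Longrightarrow> i \<odot>\<^bsub>M\<^esub> x \<in> ideal_multiples I"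
  by (auto simp: ideal_multiples_def)

lemma ideal_multiples_least:
  "submodule W R M \<Longrightarrow> (\<And>i x. i \<in> I \<Longrightarrow> x \<in> carrier M \<Longrightarrow> i \<odot>\<^bsub>M\<^esub> x \<in> W) \<Longrightarrow> ideal_multiples I \<subseteq> W"
  by (auto simp: ideal_multiples_def)

lemma submodule_ideal_multiples:
  assumes "I \<subseteq> carrier R"
  shows "submodule (ideal_multiples I) R M"
proof (rule submoduleI)
  have "carrier M \<in> {W. submodule W R M \<and> (\<forall>i\<in>I. \<forall>x\<in>carrier M. i \<odot>\<^bsub>M\<^esub> x \<in> W)}"
    using carrier_is_submodule assms by auto
  then show "ideal_multiples I \<subseteq> carrier M" unfolding ideal_multiples_def by blast
qed (auto simp: ideal_multiples_def submodule_zero submoduleE)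

end

section \<open>The endomorphism ring of a module\<close>

definition endo_ring :: "('a, 'r) ring_scheme \<Rightarrow> ('a, 'b, 'm) module_scheme \<Rightarrow> ('b \<Rightarrow> 'b) ring" where
  "endo_ring R M =
     \<lparr>carrier = {f \<in> carrier M \<rightarrow>\<^sub>E carrier M.
        (\<forall>x\<in>carrier M. \<forall>y\<in>carrier M. f (x \<oplus>\<^bsub>M\<^esub> y) = f x \<oplus>\<^bsub>M\<^esub> f y) \<and>
        (\<forall>r\<in>carrier R. \<forall>x\<in>carrier M. f (r \<odot>\<^bsub>M\<^esub> x) = r \<odot>\<^bsub>M\<^esub> f x)},
      monoid.mult = (\<lambda>f g. \<lambda>x\<in>carrier M. f (g x)), one = (\<lambda>x\<in>carrier M. x),
      zero = (\<lambda>x\<in>carrier M. \<zero>\<^bsub>M\<^esub>), add = (\<lambda>f g. \<lambda>x\<in>carrier M. f x \<oplus>\<^bsub>M\<^esub> g x)\<rparr>"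

context abelian_monoid
begin

lemma finsum_swap:
  assumes "finite A" "finite B" "\<And>a b. a \<in> A \<Longrightarrow> b \<in> B \<Longrightarrow> f a b \<in> carrier G"
  shows "(\<Oplus>a\<in>A. \<Oplus>b\<in>B. f a b) = (\<Oplus>b\<in>B. \<Oplus>a\<in>A. f a b)"
  using assms(1,3)
proof (induction A rule: finite_induct)
  case (insert a A)
  have "(\<Oplus>a\<in>insert a A. \<Oplus>b\<in>B. f a b) = (\<Oplus>b\<in>B. f a b) \<oplus> (\<Oplus>b\<in>B. \<Oplus>a\<in>A. f a b)"
    using insert by (subst finsum_insert) (auto intro!: finsum_closed)
  also have "\<dots> = (\<Oplus>b\<in>B. f a b \<oplus> (\<Oplus>a\<in>A. f a b))"
    using insert by (intro finsum_addf[symmetric]) (auto intro!: finsum_closed)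
  also have "\<dots> = (\<Oplus>b\<in>B. \<Oplus>a\<in>insert a A. f a b)"
    using insert by (intro finsum_cong') (auto intro!: finsum_closed finsum_insert[symmetric])
  finally show ?case .
qed simp

end

context module
begin

abbreviation "S \<equiv> endo_ring R M"

lemma finsum_smult_rdistr:
  assumes "finite A" "c \<in> A \<rightarrow> carrier R" "x \<in> carrier M"
  shows "(\<Oplus>a\<in>A. c a) \<odot>\<^bsub>M\<^esub> x = (\<Oplus>\<^bsub>M\<^esub>a\<in>A. c a \<odot>\<^bsub>M\<^esub> x)"
  using assms
proof (induction A rule: finite_induct)
  case (insert a A)
  then have "(\<Oplus>a\<in>insert a A. c a) \<odot>\<^bsub>M\<^esub> x = (c a \<oplus> (\<Oplus>a\<in>A. c a)) \<odot>\<^bsub>M\<^esub> x"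
    by (subst R.finsum_insert) auto
  also have "\<dots> = c a \<odot>\<^bsub>M\<^esub> x \<oplus>\<^bsub>M\<^esub> (\<Oplus>\<^bsub>M\<^esub>a\<in>A. c a \<odot>\<^bsub>M\<^esub> x)"
    using insert by (subst smult_l_distr) auto
  also have "\<dots> = (\<Oplus>\<^bsub>M\<^esub>a\<in>insert a A. c a \<odot>\<^bsub>M\<^esub> x)"
    using insert by (intro M.finsum_insert[symmetric]) auto
  finally show ?case .
qed simp

lemma endoI:
  assumes "f \<in> carrier M \<rightarrow>\<^sub>E carrier M"
    "\<And>x y. x \<in> carrier M \<Longrightarrow> y \<in> carrier M \<Longrightarrow> f (x \<oplus>\<^bsub>M\<^esub> y) = f x \<oplus>\<^bsub>M\<^esub> f y"
    "\<And>r x. r \<in> carrier R \<Longrightarrow> x \<in> carrier M \<Longrightarrow> f (r \<odot>\<^bsub>M\<^esub> x) = r \<odot>\<^bsub>M\<^esub> f x"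
  shows "f \<in> carrier S"
  using assms by (auto simp: endo_ring_def)

lemma endo_closed: "f \<in> carrier S \<Longrightarrow> x \<in> carrier M \<Longrightarrow> f x \<in> carrier M"
  by (auto simp: endo_ring_def)

lemma endo_add:
  "f \<in> carrier S \<Longrightarrow> x \<in> carrier M \<Longrightarrow> y \<in> carrier M \<Longrightarrow> f (x \<oplus>\<^bsub>M\<^esub> y) = f x \<oplus>\<^bsub>M\<^esub> f y"
  by (auto simp: endo_ring_def)

lemma endo_smult:
  "f \<in> carrier S \<Longrightarrow> r \<in> carrier R \<Longrightarrow> x \<in> carrier M \<Longrightarrow> f (r \<odot>\<^bsub>M\<^esub> x) = r \<odot>\<^bsub>M\<^esub> f x"
  by (auto simp: endo_ring_def)

lemma endo_ext:
  assumes "f \<in> carrier S" "g \<in> carrier S" "\<And>x. x \<in> carrier M \<Longrightarrow> f x = g x"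
  shows "f = g"
  using assms by (auto simp: endo_ring_def intro: PiE_ext)

lemma endo_mult [simp]: "x \<in> carrier M \<Longrightarrow> (f \<otimes>\<^bsub>S\<^esub> g) x = f (g x)"
  by (simp add: endo_ring_def)

lemma endo_plus [simp]: "x \<in> carrier M \<Longrightarrow> (f \<oplus>\<^bsub>S\<^esub> g) x = f x \<oplus>\<^bsub>M\<^esub> g x"
  by (simp add: endo_ring_def)

lemma endo_one [simp]: "x \<in> carrier M \<Longrightarrow> \<one>\<^bsub>S\<^esub> x = x"
  by (simp add: endo_ring_def)

lemma endo_zero [simp]: "x \<in> carrier M \<Longrightarrow> \<zero>\<^bsub>S\<^esub> x = \<zero>\<^bsub>M\<^esub>"
  by (simp add: endo_ring_def)

lemma endo_app_zero: "f \<in> carrier S \<Longrightarrow> f \<zero>\<^bsub>M\<^esub> = \<zero>\<^bsub>M\<^esub>"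
  using endo_smult[of f \<zero> "\<zero>\<^bsub>M\<^esub>"] endo_closed[of f "\<zero>\<^bsub>M\<^esub>"] by simp

lemma endo_app_uminus: "f \<in> carrier S \<Longrightarrow> x \<in> carrier M \<Longrightarrow> f (\<ominus>\<^bsub>M\<^esub> x) = \<ominus>\<^bsub>M\<^esub> f x"
  using endo_smult[of f "\<ominus> \<one>" x] endo_closed[of f x] by (simp add: smult_l_minus)

lemma endo_app_minus:
  "f \<in> carrier S \<Longrightarrow> x \<in> carrier M \<Longrightarrow> y \<in> carrier M \<Longrightarrow> f (x \<ominus>\<^bsub>M\<^esub> y) = f x \<ominus>\<^bsub>M\<^esub> f y"
  by (simp add: M.minus_eq endo_add endo_app_uminus)

lemma endo_app_finsum:
  assumes "f \<in> carrier S" "h \<in> A \<rightarrow> carrier M"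
  shows "f (\<Oplus>\<^bsub>M\<^esub>a\<in>A. h a) = (\<Oplus>\<^bsub>M\<^esub>a\<in>A. f (h a))"
  using assms(2)
proof (induction A rule: infinite_finite_induct)
  case (insert a A)
  then have "f (\<Oplus>\<^bsub>M\<^esub>a\<in>insert a A. h a) = f (h a \<oplus>\<^bsub>M\<^esub> (\<Oplus>\<^bsub>M\<^esub>a\<in>A. h a))"
    by (subst M.finsum_insert) auto
  also have "\<dots> = f (h a) \<oplus>\<^bsub>M\<^esub> (\<Oplus>\<^bsub>M\<^esub>a\<in>A. f (h a))"
    using insert assms(1) by (subst endo_add) auto
  also have "\<dots> = (\<Oplus>\<^bsub>M\<^esub>a\<in>insert a A. f (h a))"
    using insert assms(1) by (intro M.finsum_insert[symmetric]) (auto simp: endo_closed Pi_iff)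
  finally show ?case .
qed (use assms(1) endo_app_zero in auto)

lemma ring_endo: "ring S"
proof (rule ringI)
  show "abelian_group S"
  proof (rule abelian_groupI)
    fix f g assume fg: "f \<in> carrier S" "g \<in> carrier S"
    show "f \<oplus>\<^bsub>S\<^esub> g \<in> carrier S"
      by (rule endoI) (use fg in \<open>auto simp: endo_closed endo_add endo_smult smult_r_distr M.a_ac, auto simp: endo_ring_def\<close>)
    then show "f \<oplus>\<^bsub>S\<^esub> g = g \<oplus>\<^bsub>S\<^esub> f"
      using fg by (auto simp: endo_ring_def M.a_comm endo_closed intro!: restrict_ext M.a_comm)
  next
    show z: "\<zero>\<^bsub>S\<^esub> \<in> carrier S" by (rule endoI) (auto, auto simp: endo_ring_def)
    fix f assume f: "f \<in> carrier S"
    have "\<zero>\<^bsub>S\<^esub> \<oplus>\<^bsub>S\<^esub> f \<in> carrier S"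
      by (rule endoI) (use f in \<open>auto simp: endo_closed endo_add endo_smult, auto simp: endo_ring_def\<close>)
    then show "\<zero>\<^bsub>S\<^esub> \<oplus>\<^bsub>S\<^esub> f = f" using f by (intro endo_ext) (auto simp: endo_closed)
    let ?g = "\<lambda>x\<in>carrier M. \<ominus>\<^bsub>M\<^esub> f x"
    have g: "?g \<in> carrier S"
      by (rule endoI) (use f in \<open>auto simp: endo_closed endo_add endo_smult M.minus_add M.a_comm smult_r_minus\<close>)
    have "?g \<oplus>\<^bsub>S\<^esub> f \<in> carrier S"
      by (rule endoI) (use f in \<open>auto simp: endo_closed M.l_neg, auto simp: endo_ring_def M.l_neg\<close>)
    then have "?g \<oplus>\<^bsub>S\<^esub> f = \<zero>\<^bsub>S\<^esub>" using z f by (intro endo_ext) (auto simp: endo_closed M.l_neg)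
    with g show "\<exists>g\<in>carrier S. g \<oplus>\<^bsub>S\<^esub> f = \<zero>\<^bsub>S\<^esub>" by blast
  next
    fix f g h assume "f \<in> carrier S" "g \<in> carrier S" "h \<in> carrier S"
    then show "f \<oplus>\<^bsub>S\<^esub> g \<oplus>\<^bsub>S\<^esub> h = f \<oplus>\<^bsub>S\<^esub> (g \<oplus>\<^bsub>S\<^esub> h)"
      by (auto simp: endo_ring_def M.a_assoc intro!: restrict_ext M.a_assoc)
  qed
  show "Group.monoid S"
  proof (rule monoidI)
    show "\<one>\<^bsub>S\<^esub> \<in> carrier S" by (rule endoI) (auto, auto simp: endo_ring_def)
    fix f g assume "f \<in> carrier S" "g \<in> carrier S"
    then show "f \<otimes>\<^bsub>S\<^esub> g \<in> carrier S"
      by (intro endoI) (auto simp: endo_closed endo_add endo_smult, auto simp: endo_ring_def)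
  next
    fix f assume "f \<in> carrier S"
    then show "\<one>\<^bsub>S\<^esub> \<otimes>\<^bsub>S\<^esub> f = f" "f \<otimes>\<^bsub>S\<^esub> \<one>\<^bsub>S\<^esub> = f"
      by (auto simp: endo_ring_def fun_eq_iff PiE_def extensional_def)
  next
    fix f g h assume "f \<in> carrier S" "g \<in> carrier S" "h \<in> carrier S"
    then show "f \<otimes>\<^bsub>S\<^esub> g \<otimes>\<^bsub>S\<^esub> h = f \<otimes>\<^bsub>S\<^esub> (g \<otimes>\<^bsub>S\<^esub> h)"
      by (auto simp: endo_ring_def intro!: restrict_ext)
  qed
  fix f g h assume "f \<in> carrier S" "g \<in> carrier S" "h \<in> carrier S"
  then show "(f \<oplus>\<^bsub>S\<^esub> g) \<otimes>\<^bsub>S\<^esub> h = f \<otimes>\<^bsub>S\<^esub> h \<oplus>\<^bsub>S\<^esub> g \<otimes>\<^bsub>S\<^esub> h"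
    "h \<otimes>\<^bsub>S\<^esub> (f \<oplus>\<^bsub>S\<^esub> g) = h \<otimes>\<^bsub>S\<^esub> f \<oplus>\<^bsub>S\<^esub> h \<otimes>\<^bsub>S\<^esub> g"
    by (auto simp: endo_ring_def PiE_iff intro!: restrict_ext)
qed

sublocale S: ring S by (rule ring_endo)

lemma endo_uminus: "f \<in> carrier S \<Longrightarrow> x \<in> carrier M \<Longrightarrow> (\<ominus>\<^bsub>S\<^esub> f) x = \<ominus>\<^bsub>M\<^esub> f x"
proof -
  assume f: "f \<in> carrier S" and x: "x \<in> carrier M"
  have "(\<ominus>\<^bsub>S\<^esub> f \<oplus>\<^bsub>S\<^esub> f) x = \<zero>\<^bsub>S\<^esub> x" using f by (simp add: S.l_neg)
  then have "(\<ominus>\<^bsub>S\<^esub> f) x \<oplus>\<^bsub>M\<^esub> f x = \<zero>\<^bsub>M\<^esub>" using x by simp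
  then show ?thesis using f x by (metis M.minus_equality S.a_inv_closed endo_closed)
qed

lemma endo_minus: "f \<in> carrier S \<Longrightarrow> g \<in> carrier S \<Longrightarrow> x \<in> carrier M \<Longrightarrow> (f \<ominus>\<^bsub>S\<^esub> g) x = f x \<ominus>\<^bsub>M\<^esub> g x"
  by (simp add: S.minus_eq M.minus_eq endo_uminus)

lemma endo_finsum:
  assumes "h \<in> A \<rightarrow> carrier S" "x \<in> carrier M"
  shows "(\<Oplus>\<^bsub>S\<^esub>a\<in>A. h a) x = (\<Oplus>\<^bsub>M\<^esub>a\<in>A. h a x)"
  using assms(1)
proof (induction A rule: infinite_finite_induct)
  case (insert a A)
  then have "(\<Oplus>\<^bsub>S\<^esub>a\<in>insert a A. h a) = h a \<oplus>\<^bsub>S\<^esub> (\<Oplus>\<^bsub>S\<^esub>a\<in>A. h a)" by (subst S.finsum_insert) auto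
  then have "(\<Oplus>\<^bsub>S\<^esub>a\<in>insert a A. h a) x = h a x \<oplus>\<^bsub>M\<^esub> (\<Oplus>\<^bsub>M\<^esub>a\<in>A. h a x)"
    using insert assms(2) by simp
  also have "\<dots> = (\<Oplus>\<^bsub>M\<^esub>a\<in>insert a A. h a x)"
    using insert assms(2) by (intro M.finsum_insert[symmetric]) (auto simp: endo_closed Pi_iff)
  finally show ?case .
qed (use assms(2) in auto)

text \<open>Scalars enter the endomorphism ring as central elements, so that polynomials in an endomorphism
with coefficients in \<open>R\<close> can be written inside this ring.\<close>
definition scalar_endo :: "'a \<Rightarrow> 'c \<Rightarrow> 'c" where
  "scalar_endo r = (\<lambda>x\<in>carrier M. r \<odot>\<^bsub>M\<^esub> x)"

lemma scalar_endo_apply [simp]: "x \<in> carrier M \<Longrightarrow> scalar_endo r x = r \<odot>\<^bsub>M\<^esub> x"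
  by (simp add: scalar_endo_def)

lemma scalar_endo_closed: "r \<in> carrier R \<Longrightarrow> scalar_endo r \<in> carrier S"
  by (rule endoI) (auto simp: smult_r_distr, auto simp: scalar_endo_def, metis R.m_comm smult_assoc1)

lemma scalar_endo_central:
  "r \<in> carrier R \<Longrightarrow> f \<in> carrier S \<Longrightarrow> f \<otimes>\<^bsub>S\<^esub> scalar_endo r = scalar_endo r \<otimes>\<^bsub>S\<^esub> f"
  by (rule endo_ext) (auto simp: scalar_endo_closed endo_smult endo_closed)

definition endos_into :: "'c set \<Rightarrow> ('c \<Rightarrow> 'c) set" where
  "endos_into W = {f \<in> carrier S. \<forall>x\<in>carrier M. f x \<in> W}"

lemma endo_ideal_multiples:
  assumes f: "f \<in> carrier S" and I: "I \<subseteq> carrier R" and x: "x \<in> ideal_multiples I"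
  shows "f x \<in> ideal_multiples I"
proof -
  note sub = submodule_ideal_multiples[OF I]
  note subE = submoduleE[OF sub]
  have "submodule {x \<in> carrier M. f x \<in> ideal_multiples I} R M"
    using f by (intro submoduleI)
      (auto simp: endo_add endo_app_uminus endo_smult endo_app_zero submodule_zero[OF sub] subE)
  moreover have "i \<odot>\<^bsub>M\<^esub> x \<in> {x \<in> carrier M. f x \<in> ideal_multiples I}"
    if "i \<in> I" "x \<in> carrier M" for i x
  proof -
    have "i \<in> carrier R" using I that by auto
    then show ?thesis using f that by (simp add: endo_smult ideal_multiples_mem endo_closed)
  qed
  ultimately have "ideal_multiples I \<subseteq> {x \<in> carrier M. f x \<in> ideal_multiples I}"
    by (rule ideal_multiples_least)
  then show ?thesis using x by auto
qed

lemma ideal_endos_into: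
  assumes I: "I \<subseteq> carrier R"
  shows "ideal (endos_into (ideal_multiples I)) S"
proof (rule idealI)
  note sub = submodule_ideal_multiples[OF I]
  note subE = submoduleE[OF sub]
  show "subgroup (endos_into (ideal_multiples I)) (add_monoid S)"
    by (rule S.add.subgroupI)
      (auto simp: endos_into_def subE endo_uminus a_inv_def[symmetric] submodule_zero[OF sub] intro!: exI[of _ "\<zero>\<^bsub>S\<^esub>"])
  fix f g assume "f \<in> endos_into (ideal_multiples I)" "g \<in> carrier S"
  then show "g \<otimes>\<^bsub>S\<^esub> f \<in> endos_into (ideal_multiples I)" "f \<otimes>\<^bsub>S\<^esub> g \<in> endos_into (ideal_multiples I)"
    by (auto simp: endos_into_def endo_closed simp: endo_ideal_multiples[OF _ I])
qed (rule ring_endo)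

end

section \<open>Strong pi-regularity modulo the maximal ideal\<close>

context module
begin

text \<open>The generators are required to lie in the image itself, so that for an idempotent \<open>f\<close> they are
fixed by \<open>f\<close> and generate the corresponding direct summand.\<close>
definition fg_image :: "('c \<Rightarrow> 'c) \<Rightarrow> bool" where
  "fg_image f \<longleftrightarrow> (\<exists>X. finite X \<and> X \<subseteq> f ` carrier M \<and>
     (\<forall>z\<in>carrier M. \<exists>c\<in>X \<rightarrow> carrier R. f z = (\<Oplus>\<^bsub>M\<^esub>x\<in>X. c x \<odot>\<^bsub>M\<^esub> x)))"

text \<open>Coordinates with respect to a finite generating set are not unique; for membership in \<open>I M\<close> it is
enough that some choice of coordinates of the combination lies in \<open>I\<close>.\<close>
lemma dependent_combination_in_ideal_multiples:
  assumes I: "ideal I R" and fin: "finite A" "finite X" and X: "X \<subseteq> carrier M"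
    and c: "c \<in> A \<rightarrow> carrier R" and V: "\<And>a x. a \<in> A \<Longrightarrow> x \<in> X \<Longrightarrow> V a x \<in> carrier R"
    and v: "\<And>a. a \<in> A \<Longrightarrow> v a = (\<Oplus>\<^bsub>M\<^esub>x\<in>X. V a x \<odot>\<^bsub>M\<^esub> x)"
    and dep: "\<And>x. x \<in> X \<Longrightarrow> (\<Oplus>a\<in>A. c a \<otimes> V a x) \<in> I"
  shows "(\<Oplus>\<^bsub>M\<^esub>a\<in>A. c a \<odot>\<^bsub>M\<^esub> v a) \<in> ideal_multiples I"
proof -
  have cc: "c a \<in> carrier R" if "a \<in> A" for a using c that by auto
  have Xc: "x \<in> carrier M" if "x \<in> X" for x using X that by auto
  have "(\<Oplus>\<^bsub>M\<^esub>a\<in>A. c a \<odot>\<^bsub>M\<^esub> v a) = (\<Oplus>\<^bsub>M\<^esub>a\<in>A. \<Oplus>\<^bsub>M\<^esub>x\<in>X. (c a \<otimes> V a x) \<odot>\<^bsub>M\<^esub> x)"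
  proof (intro M.finsum_cong')
    fix a assume a: "a \<in> A"
    have "c a \<odot>\<^bsub>M\<^esub> v a = (\<Oplus>\<^bsub>M\<^esub>x\<in>X. c a \<odot>\<^bsub>M\<^esub> (V a x \<odot>\<^bsub>M\<^esub> x))"
      unfolding v[OF a] using fin cc[OF a] V[OF a] Xc by (intro finsum_smult_ldistr) auto
    also have "\<dots> = (\<Oplus>\<^bsub>M\<^esub>x\<in>X. (c a \<otimes> V a x) \<odot>\<^bsub>M\<^esub> x)"
      using cc[OF a] V[OF a] Xc by (intro M.finsum_cong') (auto simp: smult_assoc1)
    finally show "c a \<odot>\<^bsub>M\<^esub> v a = (\<Oplus>\<^bsub>M\<^esub>x\<in>X. (c a \<otimes> V a x) \<odot>\<^bsub>M\<^esub> x)" .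
  qed (use cc V Xc in \<open>auto intro!: M.finsum_closed\<close>)
  also have "\<dots> = (\<Oplus>\<^bsub>M\<^esub>x\<in>X. \<Oplus>\<^bsub>M\<^esub>a\<in>A. (c a \<otimes> V a x) \<odot>\<^bsub>M\<^esub> x)"
    using fin cc V Xc by (intro M.finsum_swap) auto
  also have "\<dots> = (\<Oplus>\<^bsub>M\<^esub>x\<in>X. (\<Oplus>a\<in>A. c a \<otimes> V a x) \<odot>\<^bsub>M\<^esub> x)"
  proof (intro M.finsum_cong')
    fix x assume x: "x \<in> X"
    show "(\<Oplus>\<^bsub>M\<^esub>a\<in>A. (c a \<otimes> V a x) \<odot>\<^bsub>M\<^esub> x) = (\<Oplus>a\<in>A. c a \<otimes> V a x) \<odot>\<^bsub>M\<^esub> x"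
      using fin cc V[OF _ x] Xc[OF x] by (intro finsum_smult_rdistr[symmetric]) auto
  next
    show "(\<lambda>x. (\<Oplus>a\<in>A. c a \<otimes> V a x) \<odot>\<^bsub>M\<^esub> x) \<in> X \<rightarrow> carrier M"
      using cc V Xc by (auto intro!: smult_closed R.finsum_closed)
  qed auto
  also have "\<dots> \<in> ideal_multiples I"
  proof (rule submodule_finsum[OF submodule_ideal_multiples])
    show "I \<subseteq> carrier R" using ideal.Icarr[OF I] by blast
    show "(\<lambda>x. (\<Oplus>a\<in>A. c a \<otimes> V a x) \<odot>\<^bsub>M\<^esub> x) \<in> X \<rightarrow> ideal_multiples I"
      using dep Xc by (auto intro!: ideal_multiples_mem)
  qed
  finally show ?thesis .
qed

lemma endos_into_generators:
  assumes X: "X \<subseteq> carrier M" and W: "submodule W R M"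
    and gen: "\<And>z. z \<in> carrier M \<Longrightarrow> \<exists>c\<in>X \<rightarrow> carrier R. e z = (\<Oplus>\<^bsub>M\<^esub>x\<in>X. c x \<odot>\<^bsub>M\<^esub> x)"
    and f: "f \<in> carrier S" "\<And>z. z \<in> carrier M \<Longrightarrow> f (e z) = f z"
    and fX: "\<And>x. x \<in> X \<Longrightarrow> f x \<in> W"
  shows "f \<in> endos_into W"
proof -
  have "f z \<in> W" if z: "z \<in> carrier M" for z
  proof -
    obtain c where c: "c \<in> X \<rightarrow> carrier R" "e z = (\<Oplus>\<^bsub>M\<^esub>x\<in>X. c x \<odot>\<^bsub>M\<^esub> x)" using gen[OF z] by blast
    have "f z = f (\<Oplus>\<^bsub>M\<^esub>x\<in>X. c x \<odot>\<^bsub>M\<^esub> x)" using c(2) f(2)[OF z] by simp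
    also have "\<dots> = (\<Oplus>\<^bsub>M\<^esub>x\<in>X. f (c x \<odot>\<^bsub>M\<^esub> x))"
      using c X by (intro endo_app_finsum[OF f(1)]) auto
    also have "\<dots> \<in> W"
    proof (rule submodule_finsum[OF W], rule Pi_I)
      fix x assume x: "x \<in> X"
      then have "c x \<in> carrier R" "x \<in> carrier M" using c X by auto
      then show "f (c x \<odot>\<^bsub>M\<^esub> x) \<in> W"
        using submoduleE(4)[OF W] fX[OF x] by (simp add: endo_smult[OF f(1)])
    qed
    finally show ?thesis .
  qed
  with f(1) show ?thesis by (simp add: endos_into_def)
qed

end

text \<open>The locality of \<open>R\<close> is used in the form that all elements outside the ideal \<open>\<mm>\<close> are units.\<close>
locale local_module = module R M for R (structure) and M (structure) +
  fixes \<mm>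
  assumes mm_ideal: "ideal \<mm> R" and mm_proper: "\<one> \<notin> \<mm>" and mm_units: "carrier R - \<mm> \<subseteq> Units R"
begin

lemma mm_subset: "\<mm> \<subseteq> carrier R" using ideal.Icarr[OF mm_ideal] by blast

abbreviation "mM \<equiv> ideal_multiples \<mm>"
abbreviation "J \<equiv> endos_into mM"

lemma submodule_mM: "submodule mM R M" by (rule submodule_ideal_multiples[OF mm_subset])

lemma ideal_J: "ideal J S" by (rule ideal_endos_into[OF mm_subset])

lemmas J_l_closed = ideal.I_l_closed[OF ideal_J]
  and J_carrier = ideal.Icarr[OF ideal_J]
  and J_add_closed = additive_subgroup.a_closed[OF ideal.axioms(1)[OF ideal_J]]
  and J_zero_closed = additive_subgroup.zero_closed[OF ideal.axioms(1)[OF ideal_J]]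

lemma J_uminus_closed: "f \<in> J \<Longrightarrow> \<ominus>\<^bsub>S\<^esub> f \<in> J"
  using submoduleE(3)[OF submodule_mM] by (auto simp: endos_into_def endo_uminus)

lemma scalar_mult_finsum_power:
  assumes w: "w \<in> carrier S" and "c \<in> A \<rightarrow> carrier R" and "finite A"
  shows "w \<otimes>\<^bsub>S\<^esub> (\<Oplus>\<^bsub>S\<^esub>i\<in>A. scalar_endo (c i) \<otimes>\<^bsub>S\<^esub> w [^]\<^bsub>S\<^esub> (k i :: nat))
      = (\<Oplus>\<^bsub>S\<^esub>i\<in>A. scalar_endo (c i) \<otimes>\<^bsub>S\<^esub> w [^]\<^bsub>S\<^esub> Suc (k i))" (is "_ \<otimes>\<^bsub>S\<^esub> ?s = ?t")
    and "(\<Oplus>\<^bsub>S\<^esub>i\<in>A. scalar_endo (c i) \<otimes>\<^bsub>S\<^esub> w [^]\<^bsub>S\<^esub> (k i :: nat)) \<otimes>\<^bsub>S\<^esub> w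
      = (\<Oplus>\<^bsub>S\<^esub>i\<in>A. scalar_endo (c i) \<otimes>\<^bsub>S\<^esub> w [^]\<^bsub>S\<^esub> Suc (k i))"
proof -
  have cc: "c i \<in> carrier R" "scalar_endo (c i) \<in> carrier S" if "i \<in> A" for i
    using assms(2) that by (auto simp: scalar_endo_closed Pi_iff)
  have "w \<otimes>\<^bsub>S\<^esub> ?s = (\<Oplus>\<^bsub>S\<^esub>i\<in>A. w \<otimes>\<^bsub>S\<^esub> (scalar_endo (c i) \<otimes>\<^bsub>S\<^esub> w [^]\<^bsub>S\<^esub> k i))"
    using assms cc by (intro S.finsum_rdistr) auto
  also have "\<dots> = ?t"
  proof (intro S.add.finprod_cong')
    fix i assume i: "i \<in> A"
    have "w \<otimes>\<^bsub>S\<^esub> (scalar_endo (c i) \<otimes>\<^bsub>S\<^esub> w [^]\<^bsub>S\<^esub> k i) = (w \<otimes>\<^bsub>S\<^esub> scalar_endo (c i)) \<otimes>\<^bsub>S\<^esub> w [^]\<^bsub>S\<^esub> k i"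
      using w cc[OF i] by (simp add: S.m_assoc)
    also have "\<dots> = scalar_endo (c i) \<otimes>\<^bsub>S\<^esub> (w \<otimes>\<^bsub>S\<^esub> w [^]\<^bsub>S\<^esub> k i)"
      using w cc[OF i] by (simp add: scalar_endo_central S.m_assoc)
    finally show "w \<otimes>\<^bsub>S\<^esub> (scalar_endo (c i) \<otimes>\<^bsub>S\<^esub> w [^]\<^bsub>S\<^esub> k i) = scalar_endo (c i) \<otimes>\<^bsub>S\<^esub> w [^]\<^bsub>S\<^esub> Suc (k i)"
      using w by (simp only: S.nat_pow_Suc2)
  qed (use w cc in auto)
  finally show "w \<otimes>\<^bsub>S\<^esub> ?s = ?t" .
  have "?s \<otimes>\<^bsub>S\<^esub> w = (\<Oplus>\<^bsub>S\<^esub>i\<in>A. (scalar_endo (c i) \<otimes>\<^bsub>S\<^esub> w [^]\<^bsub>S\<^esub> k i) \<otimes>\<^bsub>S\<^esub> w)"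
    using assms cc by (intro S.finsum_ldistr) auto
  also have "\<dots> = ?t"
    using w cc by (intro S.add.finprod_cong') (auto simp: S.m_assoc)
  finally show "?s \<otimes>\<^bsub>S\<^esub> w = ?t" .
qed

text \<open>An endomorphism of a module with \<open>d\<close> generators is described by \<open>d\<^sup>2\<close> coordinates, so its first
\<open>d\<^sup>2 + 1\<close> powers are linearly dependent over the residue field. The powers start at \<open>1\<close> because
the zeroth power is the identity of the whole module, which in general does not belong to the corner of \<open>e\<close>.\<close>
lemma power_relation_mod_J:
  assumes e: "e \<in> idempotents S" and fg: "fg_image e" and w: "w \<in> corner S e"
  obtains D :: nat and c where "c \<in> {1..D} \<rightarrow> carrier R" "\<exists>i\<in>{1..D}. c i \<notin> \<mm>"
    "(\<Oplus>\<^bsub>S\<^esub>i\<in>{1..D}. scalar_endo (c i) \<otimes>\<^bsub>S\<^esub> w [^]\<^bsub>S\<^esub> i) \<in> J"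
proof -
  have ec: "e \<in> carrier S" "e \<otimes>\<^bsub>S\<^esub> e = e" using e by (auto simp: idempotents_def)
  have wc: "w \<in> carrier S" using w by (simp add: corner_def)
  obtain X where X: "finite X" "X \<subseteq> e ` carrier M"
    "\<And>z. z \<in> carrier M \<Longrightarrow> \<exists>c\<in>X \<rightarrow> carrier R. e z = (\<Oplus>\<^bsub>M\<^esub>x\<in>X. c x \<odot>\<^bsub>M\<^esub> x)"
    using fg unfolding fg_image_def by blast
  have Xc: "X \<subseteq> carrier M" using X(2) ec endo_closed by auto
  \<comment> \<open>one more power than there are matrix entries\<close>
  define D where "D = Suc (card (X \<times> X))"
  define A where "A = {1..D}"
  have A: "finite A" "card (X \<times> X) < card A" by (auto simp: A_def D_def)
  have wi: "w [^]\<^bsub>S\<^esub> i \<in> carrier S" "e \<otimes>\<^bsub>S\<^esub> w [^]\<^bsub>S\<^esub> i = w [^]\<^bsub>S\<^esub> i" "w [^]\<^bsub>S\<^esub> i \<otimes>\<^bsub>S\<^esub> e = w [^]\<^bsub>S\<^esub> i" if "i \<in> A" for i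
    using S.pow_closed_corner[OF w _ ec(1), of i] that by (auto simp: A_def corner_def)
  have "\<exists>c\<in>X \<rightarrow> carrier R. (w [^]\<^bsub>S\<^esub> i) x = (\<Oplus>\<^bsub>M\<^esub>y\<in>X. c y \<odot>\<^bsub>M\<^esub> y)" if "i \<in> A" "x \<in> X" for i x
  proof -
    have x: "x \<in> carrier M" using that Xc by auto
    then have "(w [^]\<^bsub>S\<^esub> i) x = e ((w [^]\<^bsub>S\<^esub> i) x)" using wi(2)[OF that(1)] by (metis endo_mult)
    then show ?thesis using X(3)[OF endo_closed[OF wi(1)[OF that(1)] x]] by metis
  qed
  then have "\<forall>ix\<in>A \<times> X. \<exists>c. c \<in> X \<rightarrow> carrier R \<and>
      (w [^]\<^bsub>S\<^esub> fst ix) (snd ix) = (\<Oplus>\<^bsub>M\<^esub>y\<in>X. c y \<odot>\<^bsub>M\<^esub> y)"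
    by (auto simp: Bex_def)
  from bchoice[OF this] obtain C' where C': "\<forall>ix\<in>A \<times> X. C' ix \<in> X \<rightarrow> carrier R \<and>
      (w [^]\<^bsub>S\<^esub> fst ix) (snd ix) = (\<Oplus>\<^bsub>M\<^esub>y\<in>X. C' ix y \<odot>\<^bsub>M\<^esub> y)" by blast
  define C where "C i x = C' (i, x)" for i x
  have C: "\<And>i x. i \<in> A \<Longrightarrow> x \<in> X \<Longrightarrow> C i x \<in> X \<rightarrow> carrier R"
    "\<And>i x. i \<in> A \<Longrightarrow> x \<in> X \<Longrightarrow> (w [^]\<^bsub>S\<^esub> i) x = (\<Oplus>\<^bsub>M\<^esub>y\<in>X. C i x y \<odot>\<^bsub>M\<^esub> y)"
    using C' by (auto simp: C_def)
  have Cc: "C i (fst xy) (snd xy) \<in> carrier R" if "i \<in> A" "xy \<in> X \<times> X" for i xy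
    using C(1)[of i "fst xy"] that by auto
  obtain c where c: "c \<in> A \<rightarrow> carrier R" "\<exists>i\<in>A. c i \<notin> \<mm>"
    "\<And>xy. xy \<in> X \<times> X \<Longrightarrow> (\<Oplus>i\<in>A. c i \<otimes> C i (fst xy) (snd xy)) \<in> \<mm>"
    using R.linear_dependence_mod_ideal[OF mm_ideal mm_proper mm_units finite_cartesian_product[OF X(1) X(1)]
      A, of "\<lambda>i xy. C i (fst xy) (snd xy)", OF Cc] by blast
  have cc: "c i \<in> carrier R" "scalar_endo (c i) \<in> carrier S" if "i \<in> A" for i
    using c(1) that by (auto simp: scalar_endo_closed Pi_iff)
  let ?\<psi> = "\<Oplus>\<^bsub>S\<^esub>i\<in>A. scalar_endo (c i) \<otimes>\<^bsub>S\<^esub> w [^]\<^bsub>S\<^esub> i"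
  have pc: "?\<psi> \<in> carrier S" using cc wi by (auto intro!: S.finsum_closed)
  have papp: "?\<psi> z = (\<Oplus>\<^bsub>M\<^esub>i\<in>A. c i \<odot>\<^bsub>M\<^esub> (w [^]\<^bsub>S\<^esub> i) z)" if z: "z \<in> carrier M" for z
  proof -
    have "?\<psi> z = (\<Oplus>\<^bsub>M\<^esub>i\<in>A. (scalar_endo (c i) \<otimes>\<^bsub>S\<^esub> w [^]\<^bsub>S\<^esub> i) z)"
      using cc wi z by (intro endo_finsum) auto
    also have "\<dots> = (\<Oplus>\<^bsub>M\<^esub>i\<in>A. c i \<odot>\<^bsub>M\<^esub> (w [^]\<^bsub>S\<^esub> i) z)"
      using cc wi z by (intro M.finsum_cong') (auto simp: endo_closed)
    finally show ?thesis .
  qed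
  have "?\<psi> \<in> J"
  proof (rule endos_into_generators[OF Xc submodule_mM X(3) pc])
    fix z assume z: "z \<in> carrier M"
    have "(w [^]\<^bsub>S\<^esub> i) (e z) = (w [^]\<^bsub>S\<^esub> i) z" if "i \<in> A" for i using wi(3)[OF that] z by (metis endo_mult)
    then show "?\<psi> (e z) = ?\<psi> z"
      using papp[OF z] papp[of "e z"] z ec cc wi by (auto simp: endo_closed intro!: M.finsum_cong')
  next
    fix x assume x: "x \<in> X"
    then have xc: "x \<in> carrier M" using Xc by auto
    have "(\<Oplus>\<^bsub>M\<^esub>i\<in>A. c i \<odot>\<^bsub>M\<^esub> (w [^]\<^bsub>S\<^esub> i) x) \<in> mM"
    proof (rule dependent_combination_in_ideal_multiples[OF mm_ideal A(1) X(1) Xc c(1), where V = "\<lambda>i. C i x"])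
      show "C i x y \<in> carrier R" if "i \<in> A" "y \<in> X" for i y using C(1)[OF that(1) x] that by auto
      show "(w [^]\<^bsub>S\<^esub> i) x = (\<Oplus>\<^bsub>M\<^esub>y\<in>X. C i x y \<odot>\<^bsub>M\<^esub> y)" if "i \<in> A" for i using C(2)[OF that x] .
      show "(\<Oplus>i\<in>A. c i \<otimes> C i x y) \<in> \<mm>" if "y \<in> X" for y using c(3)[of "(x, y)"] that x by simp
    qed
    then show "?\<psi> x \<in> mM" using papp[OF xc] by simp
  qed auto
  then show ?thesis using that c(1,2) unfolding A_def by blast
qed

text \<open>Divide a polynomial relation by its lowest coefficient that is nonzero in the residue field; solving
for the lowest power \<open>w\<^sup>n\<close> exhibits it as a multiple of \<open>w\<^sup>n\<^sup>+\<^sup>1\<close>.\<close>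
lemma corner_pi_regular_mod_J:
  assumes e: "e \<in> idempotents S" and fg: "fg_image e" and w: "w \<in> corner S e"
  shows "\<exists>n>0. \<exists>q\<in>carrier S. w \<otimes>\<^bsub>S\<^esub> q = q \<otimes>\<^bsub>S\<^esub> w \<and> w [^]\<^bsub>S\<^esub> (n::nat) \<ominus>\<^bsub>S\<^esub> w [^]\<^bsub>S\<^esub> Suc n \<otimes>\<^bsub>S\<^esub> q \<in> J"
proof -
  have wc: "w \<in> carrier S" using w by (simp add: corner_def)
  obtain D :: nat and c where c: "c \<in> {1..D} \<rightarrow> carrier R" "\<exists>i\<in>{1..D}. c i \<notin> \<mm>"
    and rel: "(\<Oplus>\<^bsub>S\<^esub>i\<in>{1..D}. scalar_endo (c i) \<otimes>\<^bsub>S\<^esub> w [^]\<^bsub>S\<^esub> i) \<in> J"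
    by (rule power_relation_mod_J[OF e fg w])
  define n where "n = (LEAST i. i \<in> {1..D} \<and> c i \<notin> \<mm>)"
  have n: "n \<in> {1..D}" "c n \<notin> \<mm>" using LeastI_ex[of "\<lambda>i. i \<in> {1..D} \<and> c i \<notin> \<mm>"] c(2)
    unfolding n_def by blast+
  have small: "c i \<in> \<mm>" if "i \<in> {1..D}" "i < n" for i
    using not_less_Least[of i "\<lambda>i. i \<in> {1..D} \<and> c i \<notin> \<mm>"] that unfolding n_def by blast
  have "c n \<in> Units R" using n c(1) mm_units by auto
  then obtain u where u: "u \<in> carrier R" "u \<otimes> c n = \<one>" by (meson R.Units_inv_closed R.Units_l_inv)
  define d where "d i = u \<otimes> c i" for i
  have dc: "d i \<in> carrier R" "scalar_endo (d i) \<in> carrier S" if "i \<in> {1..D}" for i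
    using c(1) u that by (auto simp: d_def scalar_endo_closed Pi_iff)
  let ?t = "\<lambda>i. scalar_endo (d i) \<otimes>\<^bsub>S\<^esub> w [^]\<^bsub>S\<^esub> i"
  have tc: "?t i \<in> carrier S" if "i \<in> {1..D}" for i using dc[OF that] wc by simp
  have "scalar_endo u \<otimes>\<^bsub>S\<^esub> (\<Oplus>\<^bsub>S\<^esub>i\<in>{1..D}. scalar_endo (c i) \<otimes>\<^bsub>S\<^esub> w [^]\<^bsub>S\<^esub> i)
      = (\<Oplus>\<^bsub>S\<^esub>i\<in>{1..D}. scalar_endo u \<otimes>\<^bsub>S\<^esub> (scalar_endo (c i) \<otimes>\<^bsub>S\<^esub> w [^]\<^bsub>S\<^esub> i))"
    using c(1) u wc by (intro S.finsum_rdistr) (auto simp: scalar_endo_closed Pi_iff)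
  also have "\<dots> = (\<Oplus>\<^bsub>S\<^esub>i\<in>{1..D}. ?t i)"
  proof (intro S.add.finprod_cong')
    fix i assume i: "i \<in> {1..D}"
    then have ci: "c i \<in> carrier R" using c(1) by auto
    have "scalar_endo u \<otimes>\<^bsub>S\<^esub> scalar_endo (c i) = scalar_endo (d i)"
      using u ci by (intro endo_ext) (auto simp: scalar_endo_closed d_def smult_assoc1)
    then show "scalar_endo u \<otimes>\<^bsub>S\<^esub> (scalar_endo (c i) \<otimes>\<^bsub>S\<^esub> w [^]\<^bsub>S\<^esub> i) = ?t i"
      using u ci wc by (simp add: S.m_assoc[symmetric] scalar_endo_closed)
  qed (use tc in auto)
  finally have tJ: "(\<Oplus>\<^bsub>S\<^esub>i\<in>{1..D}. ?t i) \<in> J"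
    using J_l_closed[OF rel scalar_endo_closed[OF u(1)]] by simp
  define L where "L = {1..<n}"
  define U where "U = {Suc n..D}"
  have D_eq: "{1..D} = insert n (L \<union> U)" using n by (auto simp: L_def U_def)
  have split: "n \<notin> L \<union> U" "L \<inter> U = {}" "finite L" "finite U"
    by (auto simp: L_def U_def)
  have LU: "d i \<in> carrier R" "scalar_endo (d i) \<in> carrier S" "?t i \<in> carrier S" if "i \<in> L \<union> U" for i
    using dc[of i] tc[of i] that n by (auto simp: L_def U_def)
  let ?sL = "\<Oplus>\<^bsub>S\<^esub>i\<in>L. ?t i" and ?sU = "\<Oplus>\<^bsub>S\<^esub>i\<in>U. ?t i"
  have sLc: "?sL \<in> carrier S" and sUc: "?sU \<in> carrier S"
    using LU(3) by (auto intro!: S.finsum_closed simp del: One_nat_def)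
  have tn: "?t n = w [^]\<^bsub>S\<^esub> n"
  proof -
    have "scalar_endo (d n) = \<one>\<^bsub>S\<^esub>" using u by (intro endo_ext) (auto simp: d_def scalar_endo_closed)
    then show ?thesis using wc by simp
  qed
  have "(\<Oplus>\<^bsub>S\<^esub>i\<in>{1..D}. ?t i) = ?t n \<oplus>\<^bsub>S\<^esub> (\<Oplus>\<^bsub>S\<^esub>i\<in>L \<union> U. ?t i)"
    unfolding D_eq using split LU(3) tc[OF n(1)] by (intro S.finsum_insert) auto
  also have "(\<Oplus>\<^bsub>S\<^esub>i\<in>L \<union> U. ?t i) = ?sL \<oplus>\<^bsub>S\<^esub> ?sU"
    using split LU(3) by (intro S.finsum_Un_disjoint) auto
  finally have sum: "(\<Oplus>\<^bsub>S\<^esub>i\<in>{1..D}. ?t i) = w [^]\<^bsub>S\<^esub> n \<oplus>\<^bsub>S\<^esub> (?sL \<oplus>\<^bsub>S\<^esub> ?sU)" using tn by simp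
  have sLJ: "?sL \<in> J"
  proof -
    have tL: "?t i \<in> J" if i: "i \<in> L" for i
    proof -
      have iD: "i \<in> {1..D}" and ci: "c i \<in> \<mm>" using i small n by (auto simp: L_def)
      have "d i \<in> \<mm>" using ideal.I_l_closed[OF mm_ideal ci u(1)] by (simp add: d_def)
      then have "?t i x \<in> mM" if "x \<in> carrier M" for x
        using that wc by (auto intro!: ideal_multiples_mem simp: endo_closed)
      then show ?thesis using tc[OF iD] by (simp add: endos_into_def)
    qed
    show ?thesis using split(3) tL
    proof (induction L rule: finite_induct)
      case (insert i L)
      then have "?t i \<in> carrier S" "?t \<in> L \<rightarrow> carrier S" using J_carrier by blast+
      then have "(\<Oplus>\<^bsub>S\<^esub>i\<in>insert i L. ?t i) = ?t i \<oplus>\<^bsub>S\<^esub> (\<Oplus>\<^bsub>S\<^esub>i\<in>L. ?t i)"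
        using insert.hyps by (intro S.finsum_insert) auto
      then show ?case using insert by (simp add: J_add_closed)
    qed (simp add: J_zero_closed)
  qed
  let ?k = "\<lambda>i. i - Suc n"
  define q where "q = \<ominus>\<^bsub>S\<^esub> (\<Oplus>\<^bsub>S\<^esub>i\<in>U. scalar_endo (d i) \<otimes>\<^bsub>S\<^esub> w [^]\<^bsub>S\<^esub> (?k i))"
  have dU: "d \<in> U \<rightarrow> carrier R" using LU(1) by auto
  have q'c: "(\<Oplus>\<^bsub>S\<^esub>i\<in>U. scalar_endo (d i) \<otimes>\<^bsub>S\<^esub> w [^]\<^bsub>S\<^esub> (?k i + m)) \<in> carrier S" for m
    using LU(2) wc by (auto intro!: S.finsum_closed)
  have qc: "q \<in> carrier S" using q'c[of 0] by (simp add: q_def)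
  have comm: "w \<otimes>\<^bsub>S\<^esub> q = q \<otimes>\<^bsub>S\<^esub> w"
    unfolding q_def using scalar_mult_finsum_power[OF wc dU split(4), of ?k] q'c[of 0] wc
    by (simp add: S.l_minus S.r_minus)
  have pw: "w [^]\<^bsub>S\<^esub> m \<otimes>\<^bsub>S\<^esub> (\<Oplus>\<^bsub>S\<^esub>i\<in>U. scalar_endo (d i) \<otimes>\<^bsub>S\<^esub> w [^]\<^bsub>S\<^esub> (?k i))
     = (\<Oplus>\<^bsub>S\<^esub>i\<in>U. scalar_endo (d i) \<otimes>\<^bsub>S\<^esub> w [^]\<^bsub>S\<^esub> (?k i + m))" for m :: nat
  proof (induction m)
    case 0
    then show ?case using q'c[of 0] by simp
  next
    case (Suc m)
    have "w [^]\<^bsub>S\<^esub> Suc m \<otimes>\<^bsub>S\<^esub> (\<Oplus>\<^bsub>S\<^esub>i\<in>U. scalar_endo (d i) \<otimes>\<^bsub>S\<^esub> w [^]\<^bsub>S\<^esub> (?k i))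
       = w \<otimes>\<^bsub>S\<^esub> (w [^]\<^bsub>S\<^esub> m \<otimes>\<^bsub>S\<^esub> (\<Oplus>\<^bsub>S\<^esub>i\<in>U. scalar_endo (d i) \<otimes>\<^bsub>S\<^esub> w [^]\<^bsub>S\<^esub> (?k i)))"
      using wc q'c[of 0] by (simp only: S.nat_pow_Suc2 S.m_assoc S.nat_pow_closed add_0_right)
    also have "\<dots> = (\<Oplus>\<^bsub>S\<^esub>i\<in>U. scalar_endo (d i) \<otimes>\<^bsub>S\<^esub> w [^]\<^bsub>S\<^esub> (Suc (?k i + m)))"
      unfolding Suc using scalar_mult_finsum_power(1)[OF wc dU split(4), of "\<lambda>i. ?k i + m"] .
    finally show ?case by (simp only: add_Suc_right)
  qed
  have "(\<Oplus>\<^bsub>S\<^esub>i\<in>U. scalar_endo (d i) \<otimes>\<^bsub>S\<^esub> w [^]\<^bsub>S\<^esub> (?k i + Suc n)) = ?sU"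
    using LU(3) by (intro S.add.finprod_cong') (auto simp: U_def)
  then have wq: "w [^]\<^bsub>S\<^esub> Suc n \<otimes>\<^bsub>S\<^esub> q = \<ominus>\<^bsub>S\<^esub> ?sU"
    unfolding q_def using pw[of "Suc n"] wc q'c[of 0] by (simp only: S.r_minus S.nat_pow_closed add_0_right)
  then have "w [^]\<^bsub>S\<^esub> n \<ominus>\<^bsub>S\<^esub> w [^]\<^bsub>S\<^esub> Suc n \<otimes>\<^bsub>S\<^esub> q = (\<Oplus>\<^bsub>S\<^esub>i\<in>{1..D}. ?t i) \<oplus>\<^bsub>S\<^esub> \<ominus>\<^bsub>S\<^esub> ?sL"
  proof -
    have "w [^]\<^bsub>S\<^esub> n \<oplus>\<^bsub>S\<^esub> (?sL \<oplus>\<^bsub>S\<^esub> ?sU) \<oplus>\<^bsub>S\<^esub> \<ominus>\<^bsub>S\<^esub> ?sL = w [^]\<^bsub>S\<^esub> n \<oplus>\<^bsub>S\<^esub> ?sU \<oplus>\<^bsub>S\<^esub> (?sL \<oplus>\<^bsub>S\<^esub> \<ominus>\<^bsub>S\<^esub> ?sL)"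
      using wc sLc sUc by (simp add: S.a_ac)
    then show ?thesis
      unfolding sum wq using wc sLc sUc by (simp add: S.minus_eq S.r_neg)
  qed
  also have "\<dots> \<in> J" using tJ J_uminus_closed[OF sLJ] by (rule J_add_closed)
  finally show ?thesis using n qc comm by (intro exI[of _ n]) auto
qed

end

section \<open>Inverting endomorphisms with finitely generated image\<close>

context module
begin

lemma finsum_in_closed_set:
  assumes "\<zero>\<^bsub>M\<^esub> \<in> N" "N \<subseteq> carrier M" "\<And>a b. a \<in> N \<Longrightarrow> b \<in> N \<Longrightarrow> a \<oplus>\<^bsub>M\<^esub> b \<in> N" and "h \<in> A \<rightarrow> N"
  shows "(\<Oplus>\<^bsub>M\<^esub>a\<in>A. h a) \<in> N"
  using assms(4)
proof (induction A rule: infinite_finite_induct)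
  case (insert a A)
  then have "h \<in> A \<rightarrow> carrier M" "h a \<in> carrier M" "h a \<in> N" "h \<in> A \<rightarrow> N" using assms(2) by auto
  then show ?case using insert assms(3) by (simp add: M.finsum_insert)
qed (use assms(1) in auto)

definition span :: "'c set \<Rightarrow> 'c set" where
  "span X = {\<Oplus>\<^bsub>M\<^esub>x\<in>X. c x \<odot>\<^bsub>M\<^esub> x |c. c \<in> X \<rightarrow> carrier R}"

lemma mem_span_iff: "z \<in> span X \<longleftrightarrow> (\<exists>c\<in>X \<rightarrow> carrier R. z = (\<Oplus>\<^bsub>M\<^esub>x\<in>X. c x \<odot>\<^bsub>M\<^esub> x))"
  by (auto simp: span_def)

lemma submodule_span:
  assumes X: "finite X" "X \<subseteq> carrier M"
  shows "submodule (span X) R M"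
proof (rule submoduleI)
  have Xc: "x \<in> carrier M" if "x \<in> X" for x using X that by auto
  show "span X \<subseteq> carrier M" using X by (auto simp: span_def intro!: M.finsum_closed)
  have z: "\<zero>\<^bsub>M\<^esub> = (\<Oplus>\<^bsub>M\<^esub>x\<in>X. \<zero> \<odot>\<^bsub>M\<^esub> x)"
    using X by (subst M.finsum_cong'[where g = "\<lambda>_. \<zero>\<^bsub>M\<^esub>"]) auto
  show "\<zero>\<^bsub>M\<^esub> \<in> span X" unfolding span_def by (rule CollectI, rule exI[of _ "\<lambda>_. \<zero>"]) (use z in auto)
  have sm: "r \<odot>\<^bsub>M\<^esub> a \<in> span X" if ra: "r \<in> carrier R" "a \<in> span X" for r a
  proof -
    obtain c where c: "c \<in> X \<rightarrow> carrier R" "a = (\<Oplus>\<^bsub>M\<^esub>x\<in>X. c x \<odot>\<^bsub>M\<^esub> x)" using ra by (auto simp: span_def)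
    have "r \<odot>\<^bsub>M\<^esub> a = (\<Oplus>\<^bsub>M\<^esub>x\<in>X. r \<odot>\<^bsub>M\<^esub> (c x \<odot>\<^bsub>M\<^esub> x))"
      unfolding c(2) using X c(1) ra by (intro finsum_smult_ldistr) auto
    also have "\<dots> = (\<Oplus>\<^bsub>M\<^esub>x\<in>X. (r \<otimes> c x) \<odot>\<^bsub>M\<^esub> x)"
      using Xc c(1) ra by (intro M.finsum_cong') (auto simp: smult_assoc1 Pi_iff)
    finally show ?thesis unfolding span_def using c(1) ra
      by (intro CollectI exI[of _ "\<lambda>x. r \<otimes> c x"]) auto
  qed
  then show "r \<odot>\<^bsub>M\<^esub> a \<in> span X" if "r \<in> carrier R" "a \<in> span X" for r a using that .
  show "\<ominus>\<^bsub>M\<^esub> a \<in> span X" if a: "a \<in> span X" for a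
  proof -
    have "a \<in> carrier M" using \<open>span X \<subseteq> carrier M\<close> a by auto
    then have "\<ominus>\<^bsub>M\<^esub> a = (\<ominus> \<one>) \<odot>\<^bsub>M\<^esub> a" by (simp add: smult_l_minus)
    then show ?thesis using sm[of "\<ominus> \<one>" a] a by simp
  qed
  fix a b assume "a \<in> span X" "b \<in> span X"
  then obtain c d where c: "c \<in> X \<rightarrow> carrier R" "a = (\<Oplus>\<^bsub>M\<^esub>x\<in>X. c x \<odot>\<^bsub>M\<^esub> x)"
    and d: "d \<in> X \<rightarrow> carrier R" "b = (\<Oplus>\<^bsub>M\<^esub>x\<in>X. d x \<odot>\<^bsub>M\<^esub> x)" by (auto simp: span_def)
  have "a \<oplus>\<^bsub>M\<^esub> b = (\<Oplus>\<^bsub>M\<^esub>x\<in>X. c x \<odot>\<^bsub>M\<^esub> x \<oplus>\<^bsub>M\<^esub> d x \<odot>\<^bsub>M\<^esub> x)"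
    unfolding c(2) d(2) using Xc c(1) d(1) by (intro M.finsum_addf[symmetric]) auto
  also have "\<dots> = (\<Oplus>\<^bsub>M\<^esub>x\<in>X. (c x \<oplus> d x) \<odot>\<^bsub>M\<^esub> x)"
    using Xc c(1) d(1) by (intro M.finsum_cong') (auto simp: smult_l_distr Pi_iff)
  finally show "a \<oplus>\<^bsub>M\<^esub> b \<in> span X" unfolding span_def using c(1) d(1)
    by (intro CollectI exI[of _ "\<lambda>x. c x \<oplus> d x"]) auto
qed

lemma span_superset:
  assumes X: "finite X" "X \<subseteq> carrier M" and x: "x \<in> X"
  shows "x \<in> span X"
proof -
  have "(\<Oplus>\<^bsub>M\<^esub>y\<in>X. (if x = y then \<one> else \<zero>) \<odot>\<^bsub>M\<^esub> y) = (\<Oplus>\<^bsub>M\<^esub>y\<in>X. if x = y then y else \<zero>\<^bsub>M\<^esub>)"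
    using X by (intro M.finsum_cong') auto
  also have "\<dots> = x" using M.add.finprod_singleton[OF x X(1), of "\<lambda>y. y"] X by auto
  finally show ?thesis unfolding span_def
    by (intro CollectI exI[of _ "\<lambda>y. if x = y then \<one> else \<zero>"]) auto
qed

lemma span_subset:
  assumes W: "submodule W R M" and X: "X \<subseteq> W"
  shows "span X \<subseteq> W"
proof
  fix z assume "z \<in> span X"
  then obtain c where c: "c \<in> X \<rightarrow> carrier R" "z = (\<Oplus>\<^bsub>M\<^esub>x\<in>X. c x \<odot>\<^bsub>M\<^esub> x)" by (auto simp: span_def)
  show "z \<in> W" unfolding c(2)
    using c(1) X by (intro submodule_finsum[OF W]) (auto intro!: submoduleE(4)[OF W])
qed

lemma fg_image_iff_span:
  "fg_image f \<longleftrightarrow> (\<exists>X. finite X \<and> X \<subseteq> f ` carrier M \<and> (\<forall>z\<in>carrier M. f z \<in> span X))"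
  by (simp add: fg_image_def mem_span_iff)

lemma submodule_preimage:
  assumes f: "f \<in> carrier S" and W: "submodule W R M"
  shows "submodule {z \<in> carrier M. f z \<in> W} R M"
  using f submoduleE[OF W] submodule_zero[OF W]
  by (intro submoduleI) (auto simp: endo_add endo_app_uminus endo_smult endo_app_zero)

lemma submodule_image:
  assumes f: "f \<in> carrier S"
  shows "submodule (f ` carrier M) R M"
proof (rule submoduleI)
  show "f ` carrier M \<subseteq> carrier M" using f endo_closed by auto
  show "\<zero>\<^bsub>M\<^esub> \<in> f ` carrier M" using endo_app_zero[OF f] by (metis M.zero_closed image_eqI)
  show "\<ominus>\<^bsub>M\<^esub> a \<in> f ` carrier M" if a: "a \<in> f ` carrier M" for a
  proof -
    obtain a' where "a' \<in> carrier M" "a = f a'" using a by blast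
    then show ?thesis using endo_app_uminus[OF f, of a'] by (intro image_eqI[of _ _ "\<ominus>\<^bsub>M\<^esub> a'"]) auto
  qed
  show "a \<oplus>\<^bsub>M\<^esub> b \<in> f ` carrier M" if ab: "a \<in> f ` carrier M" "b \<in> f ` carrier M" for a b
  proof -
    obtain a' b' where "a' \<in> carrier M" "a = f a'" "b' \<in> carrier M" "b = f b'" using ab by blast
    then show ?thesis using endo_add[OF f, of a' b'] by (intro image_eqI[of _ _ "a' \<oplus>\<^bsub>M\<^esub> b'"]) auto
  qed
  show "r \<odot>\<^bsub>M\<^esub> b \<in> f ` carrier M" if rb: "r \<in> carrier R" "b \<in> f ` carrier M" for r b
  proof -
    obtain b' where "b' \<in> carrier M" "b = f b'" using rb by blast
    then show ?thesis using endo_smult[OF f rb(1), of b'] rb by (intro image_eqI[of _ _ "r \<odot>\<^bsub>M\<^esub> b'"]) auto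
  qed
qed

lemma fg_image_corner:
  assumes e: "fg_image e" "e \<in> carrier S" and f: "f \<in> carrier S" "f \<otimes>\<^bsub>S\<^esub> e = f"
  shows "fg_image f"
proof -
  obtain X where X: "finite X" "X \<subseteq> e ` carrier M" "\<And>z. z \<in> carrier M \<Longrightarrow> e z \<in> span X"
    using e by (auto simp: fg_image_iff_span)
  have Xc: "X \<subseteq> carrier M" using X(2) e endo_closed by auto
  have fX: "f ` X \<subseteq> carrier M" using Xc f endo_closed by auto
  let ?W = "{z \<in> carrier M. f z \<in> span (f ` X)}"
  have "submodule ?W R M" using X f fX by (intro submodule_preimage submodule_span) auto
  moreover have "X \<subseteq> ?W" using Xc X fX by (auto intro!: span_superset)
  ultimately have *: "span X \<subseteq> ?W" by (rule span_subset)
  have "f z \<in> span (f ` X)" if z: "z \<in> carrier M" for z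
  proof -
    have "f z = f (e z)" using f(2) z by (metis endo_mult)
    then show ?thesis using * X(3)[OF z] by auto
  qed
  moreover have "f ` X \<subseteq> f ` carrier M" using Xc by auto
  ultimately show ?thesis using X(1) by (auto simp: fg_image_iff_span)
qed

text \<open>A commutative ring of endomorphisms that contains \<open>x\<close> and all scalars. It replaces the polynomial
ring \<open>R[x]\<close> acting on the module.\<close>
definition bicommutant :: "('c \<Rightarrow> 'c) \<Rightarrow> ('c \<Rightarrow> 'c) set" where
  "bicommutant x = {s \<in> carrier S. \<forall>t\<in>carrier S. t \<otimes>\<^bsub>S\<^esub> x = x \<otimes>\<^bsub>S\<^esub> t \<longrightarrow> t \<otimes>\<^bsub>S\<^esub> s = s \<otimes>\<^bsub>S\<^esub> t}"

definition bicommutant_ring :: "('c \<Rightarrow> 'c) \<Rightarrow> ('c \<Rightarrow> 'c) ring" where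
  "bicommutant_ring x = S\<lparr>carrier := bicommutant x\<rparr>"

lemma bicommutant_self: "x \<in> carrier S \<Longrightarrow> x \<in> bicommutant x"
  by (auto simp: bicommutant_def)

lemma cring_bicommutant:
  assumes x: "x \<in> carrier S"
  shows "cring (bicommutant_ring x)"
proof -
  have comm: "s \<otimes>\<^bsub>S\<^esub> t = t \<otimes>\<^bsub>S\<^esub> s" if "s \<in> bicommutant x" "t \<in> bicommutant x" for s t
  proof -
    have "s \<otimes>\<^bsub>S\<^esub> x = x \<otimes>\<^bsub>S\<^esub> s" using that(1) x by (simp add: bicommutant_def)
    then show ?thesis using that by (simp add: bicommutant_def)
  qed
  have cl: "s \<otimes>\<^bsub>S\<^esub> t \<in> bicommutant x" "s \<oplus>\<^bsub>S\<^esub> t \<in> bicommutant x"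
    if st: "s \<in> bicommutant x" "t \<in> bicommutant x" for s t
  proof -
    have c: "s \<in> carrier S" "t \<in> carrier S" using st by (auto simp: bicommutant_def)
    have "u \<otimes>\<^bsub>S\<^esub> (s \<otimes>\<^bsub>S\<^esub> t) = s \<otimes>\<^bsub>S\<^esub> t \<otimes>\<^bsub>S\<^esub> u \<and> u \<otimes>\<^bsub>S\<^esub> (s \<oplus>\<^bsub>S\<^esub> t) = (s \<oplus>\<^bsub>S\<^esub> t) \<otimes>\<^bsub>S\<^esub> u"
      if u: "u \<in> carrier S" "u \<otimes>\<^bsub>S\<^esub> x = x \<otimes>\<^bsub>S\<^esub> u" for u
    proof -
      have us: "u \<otimes>\<^bsub>S\<^esub> s = s \<otimes>\<^bsub>S\<^esub> u" "u \<otimes>\<^bsub>S\<^esub> t = t \<otimes>\<^bsub>S\<^esub> u" using st u by (auto simp: bicommutant_def)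
      have "u \<otimes>\<^bsub>S\<^esub> (s \<otimes>\<^bsub>S\<^esub> t) = (u \<otimes>\<^bsub>S\<^esub> s) \<otimes>\<^bsub>S\<^esub> t" using u c by (simp add: S.m_assoc)
      also have "\<dots> = s \<otimes>\<^bsub>S\<^esub> (u \<otimes>\<^bsub>S\<^esub> t)" unfolding us(1) using u c by (simp add: S.m_assoc)
      also have "\<dots> = s \<otimes>\<^bsub>S\<^esub> t \<otimes>\<^bsub>S\<^esub> u" unfolding us(2) using u c by (simp add: S.m_assoc)
      finally show ?thesis using u c us by (simp add: S.l_distr S.r_distr)
    qed
    then show "s \<otimes>\<^bsub>S\<^esub> t \<in> bicommutant x" "s \<oplus>\<^bsub>S\<^esub> t \<in> bicommutant x"
      using c by (auto simp: bicommutant_def)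
  qed
  have neg: "\<ominus>\<^bsub>S\<^esub> s \<in> bicommutant x" if "s \<in> bicommutant x" for s
    using that by (auto simp: bicommutant_def S.l_minus S.r_minus)
  have zo: "\<zero>\<^bsub>S\<^esub> \<in> bicommutant x" "\<one>\<^bsub>S\<^esub> \<in> bicommutant x" by (auto simp: bicommutant_def)
  have sub: "s \<in> carrier S" if "s \<in> bicommutant x" for s using that by (simp add: bicommutant_def)
  show ?thesis unfolding bicommutant_ring_def
  proof (rule cringI)
    show "abelian_group (S\<lparr>carrier := bicommutant x\<rparr>)"
    proof (rule abelian_groupI)
      fix s assume "s \<in> carrier (S\<lparr>carrier := bicommutant x\<rparr>)"
      then show "\<exists>t\<in>carrier (S\<lparr>carrier := bicommutant x\<rparr>). t \<oplus>\<^bsub>S\<lparr>carrier := bicommutant x\<rparr>\<^esub> s = \<zero>\<^bsub>S\<lparr>carrier := bicommutant x\<rparr>\<^esub>"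
        using neg sub by (auto intro!: bexI[of _ "\<ominus>\<^bsub>S\<^esub> s"] simp: S.l_neg)
    qed (auto simp: cl zo sub S.a_ac)
    show "comm_monoid (S\<lparr>carrier := bicommutant x\<rparr>)"
    proof (rule comm_monoidI)
      fix s t assume "s \<in> carrier (S\<lparr>carrier := bicommutant x\<rparr>)" "t \<in> carrier (S\<lparr>carrier := bicommutant x\<rparr>)"
      then show "s \<otimes>\<^bsub>S\<lparr>carrier := bicommutant x\<rparr>\<^esub> t = t \<otimes>\<^bsub>S\<lparr>carrier := bicommutant x\<rparr>\<^esub> s"
        using comm by simp
    qed (auto simp: cl zo sub S.m_assoc)
  qed (auto simp: sub S.l_distr)
qed

text \<open>The same abelian group \<open>M\<close>, with endomorphisms as scalars.\<close>
definition bicommutant_module :: "('c \<Rightarrow> 'c) \<Rightarrow> (('c \<Rightarrow> 'c), 'c) module" where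
  "bicommutant_module x = \<lparr>carrier = carrier M, monoid.mult = undefined, one = undefined,
     zero = \<zero>\<^bsub>M\<^esub>, add = add M, smult = (\<lambda>s z. s z)\<rparr>"

lemma module_bicommutant:
  assumes x: "x \<in> carrier S"
  shows "module (bicommutant_ring x) (bicommutant_module x)"
proof (rule moduleI)
  show "cring (bicommutant_ring x)" using x by (rule cring_bicommutant)
  show "abelian_group (bicommutant_module x)"
  proof (rule abelian_groupI)
    fix a assume "a \<in> carrier (bicommutant_module x)"
    then show "\<exists>y\<in>carrier (bicommutant_module x). y \<oplus>\<^bsub>bicommutant_module x\<^esub> a = \<zero>\<^bsub>bicommutant_module x\<^esub>"
      by (auto simp: bicommutant_module_def M.l_neg intro!: bexI[of _ "\<ominus>\<^bsub>M\<^esub> a"])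
  qed (auto simp: bicommutant_module_def M.a_ac)
qed (auto simp: bicommutant_module_def bicommutant_ring_def bicommutant_def endo_closed endo_add)

end

context module
begin

lemma endo_eq_on_span:
  assumes f: "f \<in> carrier S" and g: "g \<in> carrier S" and X: "X \<subseteq> carrier M"
    and eq: "\<And>x. x \<in> X \<Longrightarrow> f x = g x" and z: "z \<in> span X"
  shows "f z = g z"
proof -
  obtain c where c: "c \<in> X \<rightarrow> carrier R" "z = (\<Oplus>\<^bsub>M\<^esub>x\<in>X. c x \<odot>\<^bsub>M\<^esub> x)" using z by (auto simp: span_def)
  have cc: "c x \<in> carrier R" "x \<in> carrier M" if "x \<in> X" for x using c(1) X that by auto
  have "f z = (\<Oplus>\<^bsub>M\<^esub>x\<in>X. f (c x \<odot>\<^bsub>M\<^esub> x))" unfolding c(2) using cc by (intro endo_app_finsum[OF f]) auto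
  also have "\<dots> = (\<Oplus>\<^bsub>M\<^esub>x\<in>X. g (c x \<odot>\<^bsub>M\<^esub> x))"
    using cc eq f g by (intro M.finsum_cong') (auto simp: endo_smult endo_closed)
  also have "\<dots> = g z" unfolding c(2) using cc by (intro endo_app_finsum[OF g, symmetric]) auto
  finally show ?thesis .
qed

text \<open>Vasconcelos' theorem: a surjective endomorphism of a finitely generated module is invertible. Over
the commutative ring \<open>B\<close> of operators that commute with everything commuting with \<open>x\<close>, surjectivity
means that the ideal \<open>B x\<close> times the image of \<open>f\<close> is the whole image, so the Nakayama lemma gives
\<open>s x\<close> in \<open>B x\<close> acting as the identity on it.\<close>
theorem surjective_corner_endo_left_invertible:
  assumes f: "f \<in> idempotents S" and fg: "fg_image f" and x: "x \<in> corner S f"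
    and surj: "f ` carrier M \<subseteq> x ` carrier M"
  shows "\<exists>y\<in>carrier S. y \<otimes>\<^bsub>S\<^esub> x = f"
proof -
  have fc: "f \<in> carrier S" "f \<otimes>\<^bsub>S\<^esub> f = f" using f by (auto simp: idempotents_def)
  have xc: "x \<in> carrier S" "f \<otimes>\<^bsub>S\<^esub> x = x" "x \<otimes>\<^bsub>S\<^esub> f = x" using x by (auto simp: corner_def)
  obtain X where X: "finite X" "X \<subseteq> f ` carrier M" "\<And>z. z \<in> carrier M \<Longrightarrow> f z \<in> span X"
    using fg by (auto simp: fg_image_iff_span)
  have Xc: "X \<subseteq> carrier M" using X(2) fc endo_closed by auto
  obtain xs where xs: "set xs = X" using finite_list X(1) by blast
  interpret B: module "bicommutant_ring x" "bicommutant_module x"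
    by (rule module_bicommutant[OF xc(1)])
  have Bc [simp]: "carrier (bicommutant_ring x) = bicommutant x"
    "carrier (bicommutant_module x) = carrier M" "\<zero>\<^bsub>bicommutant_module x\<^esub> = \<zero>\<^bsub>M\<^esub>"
    "add (bicommutant_module x) = add M" "\<And>s z. s \<odot>\<^bsub>bicommutant_module x\<^esub> z = s z"
    "mult (bicommutant_ring x) = mult S" "add (bicommutant_ring x) = add S"
    "\<one>\<^bsub>bicommutant_ring x\<^esub> = \<one>\<^bsub>S\<^esub>"
    by (simp_all add: bicommutant_module_def bicommutant_ring_def)
  have xB: "x \<in> carrier (bicommutant_ring x)" using bicommutant_self[OF xc(1)] by simp
  define I where "I = cgenideal (bicommutant_ring x) x"
  have I: "ideal I (bicommutant_ring x)" unfolding I_def by (rule B.R.cgenideal_ideal[OF xB])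
  have I_iff: "i \<in> I \<longleftrightarrow> (\<exists>s\<in>bicommutant x. i = s \<otimes>\<^bsub>S\<^esub> x)" for i
    by (auto simp: I_def cgenideal_def)
  have W: "submodule {\<zero>\<^bsub>M\<^esub>} (bicommutant_ring x) (bicommutant_module x)"
  proof (rule B.submoduleI)
    show "\<ominus>\<^bsub>bicommutant_module x\<^esub> a \<in> {\<zero>\<^bsub>M\<^esub>}" if "a \<in> {\<zero>\<^bsub>M\<^esub>}" for a
      using that B.M.minus_equality[of "\<zero>\<^bsub>M\<^esub>" "\<zero>\<^bsub>M\<^esub>"] by simp
  qed (auto simp: endo_app_zero bicommutant_def)
  let ?N = "B.ideal_combinations {\<zero>\<^bsub>M\<^esub>} I xs"
  have xsB: "set xs \<subseteq> carrier (bicommutant_module x)" using Xc xs by simp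
  have N: "submodule ?N (bicommutant_ring x) (bicommutant_module x)"
    by (rule B.submodule_ideal_combinations[OF I W xsB])
  note NE = B.submoduleE[OF N] B.submodule_zero[OF N]
  have "y \<in> ?N" if y: "y \<in> set xs" for y
  proof -
    have "y \<in> x ` carrier M" using y xs X surj by auto
    then obtain z where z: "z \<in> carrier M" "y = x z" by blast
    obtain c where c: "c \<in> X \<rightarrow> carrier R" "f z = (\<Oplus>\<^bsub>M\<^esub>w\<in>X. c w \<odot>\<^bsub>M\<^esub> w)"
      using X(3)[OF z(1)] by (auto simp: span_def)
    have "y = x (f z)" using z xc by (metis endo_mult)
    also have "\<dots> = (\<Oplus>\<^bsub>M\<^esub>w\<in>X. x (c w \<odot>\<^bsub>M\<^esub> w))"
      unfolding c(2) using c(1) Xc by (intro endo_app_finsum[OF xc(1)]) auto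
    also have "\<dots> \<in> ?N"
    proof (rule finsum_in_closed_set)
      show "\<zero>\<^bsub>M\<^esub> \<in> ?N" "?N \<subseteq> carrier M" using NE by auto
      show "a \<oplus>\<^bsub>M\<^esub> b \<in> ?N" if "a \<in> ?N" "b \<in> ?N" for a b using NE(5)[OF that] by simp
      show "(\<lambda>w. x (c w \<odot>\<^bsub>M\<^esub> w)) \<in> X \<rightarrow> ?N"
      proof
        fix w assume w: "w \<in> X"
        then have cw: "c w \<in> carrier R" and wc: "w \<in> carrier M" using c Xc by auto
        have "scalar_endo (c w) \<in> bicommutant x"
          using cw by (auto simp: bicommutant_def scalar_endo_closed scalar_endo_central)
        then have "scalar_endo (c w) \<otimes>\<^bsub>S\<^esub> x \<in> I" by (auto simp: I_iff)
        from B.ideal_combinations_mem[OF I W xsB this, of w] w xs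
        have "(scalar_endo (c w) \<otimes>\<^bsub>S\<^esub> x) w \<in> ?N" by simp
        then show "x (c w \<odot>\<^bsub>M\<^esub> w) \<in> ?N" using cw wc xc(1) by (simp add: endo_smult endo_closed)
      qed
    qed
    finally show ?thesis .
  qed
  then obtain i where i: "i \<in> I" "\<And>y. y \<in> X \<Longrightarrow> (\<one>\<^bsub>bicommutant_ring x\<^esub> \<ominus>\<^bsub>bicommutant_ring x\<^esub> i) y = \<zero>\<^bsub>M\<^esub>"
    using B.nakayama_mod_submodule[OF I W xsB] xs by auto
  obtain s where s: "s \<in> carrier S" "s \<in> bicommutant x" "i = s \<otimes>\<^bsub>S\<^esub> x"
    using i(1) by (auto simp: I_iff bicommutant_def)
  have iB: "i \<in> carrier (bicommutant_ring x)" using ideal.Icarr[OF I i(1)] .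
  let ?k = "\<one>\<^bsub>bicommutant_ring x\<^esub> \<ominus>\<^bsub>bicommutant_ring x\<^esub> i"
  have "?k \<oplus>\<^bsub>bicommutant_ring x\<^esub> i = \<one>\<^bsub>bicommutant_ring x\<^esub>"
    using iB by (simp add: B.R.minus_eq B.R.a_assoc B.R.l_neg del: Bc)
  then have k1: "?k \<oplus>\<^bsub>S\<^esub> i = \<one>\<^bsub>S\<^esub>" by simp
  have iy: "i y = y" if y: "y \<in> X" for y
  proof -
    have yc: "y \<in> carrier M" using y Xc by auto
    have "(?k \<oplus>\<^bsub>S\<^esub> i) y = \<one>\<^bsub>S\<^esub> y" using k1 by (rule arg_cong)
    then have "?k y \<oplus>\<^bsub>M\<^esub> i y = y" using yc by (simp del: Bc)
    moreover have "i \<in> carrier S" using s xc by simp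
    ultimately show ?thesis using i(2)[OF y] yc by (simp add: endo_closed del: Bc)
  qed
  have "s \<otimes>\<^bsub>S\<^esub> x = f"
  proof (rule endo_ext)
    show "s \<otimes>\<^bsub>S\<^esub> x \<in> carrier S" "f \<in> carrier S" using s xc fc by auto
    fix z assume z: "z \<in> carrier M"
    have "(s \<otimes>\<^bsub>S\<^esub> x) z = i (f z)"
      using z s(3) xc(3) fc endo_closed by (metis endo_mult)
    also have "\<dots> = \<one>\<^bsub>S\<^esub> (f z)"
    proof (rule endo_eq_on_span[OF _ _ Xc _ X(3)[OF z]])
      show "i \<in> carrier S" unfolding s(3) using s(1) xc(1) by (rule S.m_closed)
      show "i y = \<one>\<^bsub>S\<^esub> y" if "y \<in> X" for y
        using iy[OF that] endo_one[of y] that Xc by (simp add: subsetD del: Bc)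
    qed (rule S.one_closed)
    finally show "(s \<otimes>\<^bsub>S\<^esub> x) z = f z" using endo_closed[OF fc(1) z] by (simp del: Bc)
  qed
  with s show ?thesis by blast
qed

end

context local_module
begin

text \<open>An endomorphism that is the identity modulo \<open>\<mm>\<close> is surjective by the Nakayama lemma over \<open>R\<close>, hence
invertible by Vasconcelos' theorem.\<close>
theorem left_inverse_mod_J:
  assumes f: "f \<in> idempotents S" and fg: "fg_image f" and x: "x \<in> corner S f"
    and fx: "f \<ominus>\<^bsub>S\<^esub> x \<in> J"
  shows "\<exists>y\<in>carrier S. y \<otimes>\<^bsub>S\<^esub> x = f"
proof (rule surjective_corner_endo_left_invertible[OF f fg x])
  have fc: "f \<in> carrier S" "f \<otimes>\<^bsub>S\<^esub> f = f" using f by (auto simp: idempotents_def)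
  have xc: "x \<in> carrier S" "f \<otimes>\<^bsub>S\<^esub> x = x" "x \<otimes>\<^bsub>S\<^esub> f = x" using x by (auto simp: corner_def)
  have ff: "f (f z) = f z" "f (x z) = x z" "x (f z) = x z" if "z \<in> carrier M" for z
    using that fc(2) xc(2,3) by (metis endo_mult)+
  obtain X where X: "finite X" "X \<subseteq> f ` carrier M" "\<And>z. z \<in> carrier M \<Longrightarrow> f z \<in> span X"
    using fg by (auto simp: fg_image_iff_span)
  have Xc: "X \<subseteq> carrier M" using X(2) fc endo_closed by auto
  have fX: "f y = y" if "y \<in> X" for y using that X(2) ff by auto
  obtain xs where xs: "set xs = X" using finite_list X(1) by blast
  let ?W = "x ` carrier M"
  have W: "submodule ?W R M" by (rule submodule_image[OF xc(1)])
  let ?N = "ideal_combinations ?W \<mm> xs"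
  have xsM: "set xs \<subseteq> carrier M" using xs Xc by simp
  have N: "submodule ?N R M" by (rule submodule_ideal_combinations[OF mm_ideal W xsM])
  have WN: "?W \<subseteq> ?N"
    using xsM
  proof (induction xs)
    case (Cons y ys)
    show ?case
    proof
      fix w assume w: "w \<in> ?W"
      then have "w = w \<oplus>\<^bsub>M\<^esub> \<zero> \<odot>\<^bsub>M\<^esub> y" using submoduleE(1)[OF W] Cons.prems by auto
      moreover have "\<zero> \<in> \<mm>" by (rule additive_subgroup.zero_closed[OF ideal.axioms(1)[OF mm_ideal]])
      moreover have "w \<in> ideal_combinations ?W \<mm> ys" using w Cons by auto
      ultimately show "w \<in> ideal_combinations ?W \<mm> (y # ys)" unfolding ideal_combinations.simps by blast
    qed
  qed simp
  have fm: "mM \<subseteq> {z \<in> carrier M. f z \<in> ?N}"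
  proof (rule ideal_multiples_least[OF submodule_preimage[OF fc(1) N]])
    fix i z assume i: "i \<in> \<mm>" and z: "z \<in> carrier M"
    have ic: "i \<in> carrier R" using i mm_subset by auto
    obtain c where c: "c \<in> X \<rightarrow> carrier R" "f z = (\<Oplus>\<^bsub>M\<^esub>w\<in>X. c w \<odot>\<^bsub>M\<^esub> w)"
      using X(3)[OF z] by (auto simp: span_def)
    have cc: "c w \<in> carrier R" "w \<in> carrier M" if "w \<in> X" for w using that c Xc by auto
    have "f (i \<odot>\<^bsub>M\<^esub> z) = i \<odot>\<^bsub>M\<^esub> (\<Oplus>\<^bsub>M\<^esub>w\<in>X. c w \<odot>\<^bsub>M\<^esub> w)"
      using c(2) by (simp add: endo_smult[OF fc(1) ic z])
    also have "\<dots> = (\<Oplus>\<^bsub>M\<^esub>w\<in>X. i \<odot>\<^bsub>M\<^esub> (c w \<odot>\<^bsub>M\<^esub> w))"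
      using X(1) ic cc by (intro finsum_smult_ldistr) auto
    also have "\<dots> \<in> ?N"
    proof (rule submodule_finsum[OF N], rule Pi_I)
      fix w assume w: "w \<in> X"
      have "i \<odot>\<^bsub>M\<^esub> (c w \<odot>\<^bsub>M\<^esub> w) = c w \<odot>\<^bsub>M\<^esub> (i \<odot>\<^bsub>M\<^esub> w)"
        using cc[OF w] ic by (metis R.m_comm smult_assoc1)
      moreover have "i \<odot>\<^bsub>M\<^esub> w \<in> ?N" using w xs by (intro ideal_combinations_mem[OF mm_ideal W xsM i]) simp
      ultimately show "i \<odot>\<^bsub>M\<^esub> (c w \<odot>\<^bsub>M\<^esub> w) \<in> ?N" using submoduleE(4)[OF N cc(1)[OF w]] by simp
    qed
    finally show "i \<odot>\<^bsub>M\<^esub> z \<in> {z \<in> carrier M. f z \<in> ?N}" using ic z by simp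
  qed
  have "y \<in> ?N" if y: "y \<in> set xs" for y
  proof -
    have yc: "y \<in> carrier M" "f y = y" using y xs Xc fX by auto
    have xy: "x y \<in> carrier M" using xc yc endo_closed by auto
    have "(f \<ominus>\<^bsub>S\<^esub> x) y \<in> mM" using fx yc by (simp add: endos_into_def)
    then have "f ((f \<ominus>\<^bsub>S\<^esub> x) y) \<in> ?N" using fm by auto
    moreover have "f ((f \<ominus>\<^bsub>S\<^esub> x) y) = y \<ominus>\<^bsub>M\<^esub> x y"
      using yc xy fc xc ff by (simp add: endo_minus endo_app_minus)
    moreover have "x y \<in> ?N" using WN yc by auto
    ultimately have "(y \<ominus>\<^bsub>M\<^esub> x y) \<oplus>\<^bsub>M\<^esub> x y \<in> ?N" using submoduleE(5)[OF N] by simp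
    then show ?thesis using yc xy by (simp add: M.minus_eq M.a_assoc M.l_neg)
  qed
  then obtain i where i: "i \<in> \<mm>" "\<And>y. y \<in> X \<Longrightarrow> (\<one> \<ominus> i) \<odot>\<^bsub>M\<^esub> y \<in> ?W"
    using nakayama_mod_submodule[OF mm_ideal W xsM] xs by auto
  have ic: "i \<in> carrier R" using i mm_subset by auto
  have "\<one> \<ominus> i \<notin> \<mm>"
  proof
    assume "\<one> \<ominus> i \<in> \<mm>"
    then have "(\<one> \<ominus> i) \<oplus> i \<in> \<mm>" using i(1) additive_subgroup.a_closed[OF ideal.axioms(1)[OF mm_ideal]] by blast
    then show False using mm_proper ic by (simp add: R.minus_eq R.a_assoc R.l_neg)
  qed
  then have "\<one> \<ominus> i \<in> Units R" using mm_units ic by auto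
  then obtain u where u: "u \<in> carrier R" "u \<otimes> (\<one> \<ominus> i) = \<one>" by (meson R.Units_inv_closed R.Units_l_inv)
  have "y \<in> ?W" if y: "y \<in> X" for y
  proof -
    have "u \<odot>\<^bsub>M\<^esub> ((\<one> \<ominus> i) \<odot>\<^bsub>M\<^esub> y) \<in> ?W" using submoduleE(4)[OF W u(1) i(2)[OF y]] .
    moreover have "u \<odot>\<^bsub>M\<^esub> ((\<one> \<ominus> i) \<odot>\<^bsub>M\<^esub> y) = y"
      using u ic y Xc by (subst smult_assoc1[symmetric]) auto
    ultimately show ?thesis by simp
  qed
  then have "span X \<subseteq> ?W" by (intro span_subset[OF W]) blast
  then show "f ` carrier M \<subseteq> ?W" using X(3) by blast
qed

text \<open>Nonzero orthogonal idempotents on a vector space of dimension \<open>d\<close> have linearly independent images,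
so there are at most \<open>d\<close> of them. The hypotheses are formulated modulo \<open>J\<close>, and thus the bound
serves for lifts of idempotents of \<open>S/J\<close> as well as for idempotents of \<open>S\<close>.\<close>
lemma corner_almost_orthogonal_bound:
  assumes e: "e \<in> carrier S" and fg: "fg_image e"
  shows "\<exists>d. \<forall>A. finite A \<longrightarrow> A \<subseteq> corner S e \<longrightarrow> (\<forall>a\<in>A. a \<notin> J \<and> a \<otimes>\<^bsub>S\<^esub> a \<ominus>\<^bsub>S\<^esub> a \<in> J) \<longrightarrow>
     (\<forall>a\<in>A. \<forall>b\<in>A. a \<noteq> b \<longrightarrow> a \<otimes>\<^bsub>S\<^esub> b \<in> J) \<longrightarrow> card A \<le> d"
proof -
  obtain X where X: "finite X" "X \<subseteq> e ` carrier M" "\<And>z. z \<in> carrier M \<Longrightarrow> e z \<in> span X"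
    using fg by (auto simp: fg_image_iff_span)
  have Xc: "X \<subseteq> carrier M" using X(2) e endo_closed by auto
  note mE = submoduleE[OF submodule_mM]
  have "card A \<le> card X" if fin: "finite A" and Ac: "A \<subseteq> corner S e"
    and nJ: "\<And>a. a \<in> A \<Longrightarrow> a \<notin> J" and idem: "\<And>a. a \<in> A \<Longrightarrow> a \<otimes>\<^bsub>S\<^esub> a \<ominus>\<^bsub>S\<^esub> a \<in> J"
    and orth: "\<And>a b. a \<in> A \<Longrightarrow> b \<in> A \<Longrightarrow> a \<noteq> b \<Longrightarrow> a \<otimes>\<^bsub>S\<^esub> b \<in> J" for A
  proof (rule ccontr)
    assume "\<not> card A \<le> card X"
    then have card: "card X < card A" by simp
    have ac: "a \<in> carrier S" "e \<otimes>\<^bsub>S\<^esub> a = a" if "a \<in> A" for a using Ac that by (auto simp: corner_def)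
    have "\<forall>a\<in>A. \<exists>z. z \<in> carrier M \<and> a z \<notin> mM" using nJ ac by (fastforce simp: endos_into_def)
    from bchoice[OF this] obtain z where z: "\<And>a. a \<in> A \<Longrightarrow> z a \<in> carrier M" "\<And>a. a \<in> A \<Longrightarrow> a (z a) \<notin> mM"
      by blast
    define y where "y a = a (z a)" for a
    have yc: "y a \<in> carrier M" if "a \<in> A" for a using that z(1) ac endo_closed by (auto simp: y_def)
    have "\<forall>a\<in>A. \<exists>V. V \<in> X \<rightarrow> carrier R \<and> y a = (\<Oplus>\<^bsub>M\<^esub>x\<in>X. V x \<odot>\<^bsub>M\<^esub> x)"
    proof
      fix a assume a: "a \<in> A"
      have "y a = e (y a)" unfolding y_def using ac(2)[OF a] z(1)[OF a] by (metis endo_mult)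
      then have "y a \<in> span X" using X(3)[OF yc[OF a]] by simp
      then show "\<exists>V. V \<in> X \<rightarrow> carrier R \<and> y a = (\<Oplus>\<^bsub>M\<^esub>x\<in>X. V x \<odot>\<^bsub>M\<^esub> x)" by (auto simp: span_def)
    qed
    from bchoice[OF this] obtain V where V: "\<And>a. a \<in> A \<Longrightarrow> V a \<in> X \<rightarrow> carrier R"
      "\<And>a. a \<in> A \<Longrightarrow> y a = (\<Oplus>\<^bsub>M\<^esub>x\<in>X. V a x \<odot>\<^bsub>M\<^esub> x)" by blast
    have Vc: "V a x \<in> carrier R" if "a \<in> A" "x \<in> X" for a x using V(1) that by auto
    from R.linear_dependence_mod_ideal[OF mm_ideal mm_proper mm_units X(1) fin card, of V, OF Vc]
    obtain c where c: "c \<in> A \<rightarrow> carrier R" "\<exists>a\<in>A. c a \<notin> \<mm>" "\<And>x. x \<in> X \<Longrightarrow> (\<Oplus>a\<in>A. c a \<otimes> V a x) \<in> \<mm>"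
      by blast
    have cc: "c a \<in> carrier R" if "a \<in> A" for a using c(1) that by auto
    have sum: "(\<Oplus>\<^bsub>M\<^esub>a\<in>A. c a \<odot>\<^bsub>M\<^esub> y a) \<in> mM"
      by (rule dependent_combination_in_ideal_multiples[OF mm_ideal fin X(1) Xc c(1) Vc V(2) c(3)])
    obtain b where b: "b \<in> A" "c b \<notin> \<mm>" using c(2) by blast
    \<comment> \<open>Applying \<open>b\<close> to the dependence isolates its \<open>b\<close>-th term, up to \<open>\<mm>M\<close>.\<close>
    have "b (\<Oplus>\<^bsub>M\<^esub>a\<in>A. c a \<odot>\<^bsub>M\<^esub> y a) = (\<Oplus>\<^bsub>M\<^esub>a\<in>A. b (c a \<odot>\<^bsub>M\<^esub> y a))"
      using cc yc by (intro endo_app_finsum[OF ac(1)[OF b(1)]]) auto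
    also have "\<dots> = (\<Oplus>\<^bsub>M\<^esub>a\<in>insert b (A - {b}). c a \<odot>\<^bsub>M\<^esub> b (y a))"
      using cc yc b(1) ac(1)[OF b(1)]
      by (intro M.finsum_cong') (auto simp: endo_smult endo_closed)
    also have "\<dots> = c b \<odot>\<^bsub>M\<^esub> b (y b) \<oplus>\<^bsub>M\<^esub> (\<Oplus>\<^bsub>M\<^esub>a\<in>A - {b}. c a \<odot>\<^bsub>M\<^esub> b (y a))"
      using fin cc yc b(1) ac(1)[OF b(1)] by (intro M.finsum_insert) (auto simp: endo_closed)
    finally have eq: "b (\<Oplus>\<^bsub>M\<^esub>a\<in>A. c a \<odot>\<^bsub>M\<^esub> y a) = \<dots>" .
    have L: "b (\<Oplus>\<^bsub>M\<^esub>a\<in>A. c a \<odot>\<^bsub>M\<^esub> y a) \<in> mM"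
      by (rule endo_ideal_multiples[OF ac(1)[OF b(1)] mm_subset sum])
    have rest: "(\<Oplus>\<^bsub>M\<^esub>a\<in>A - {b}. c a \<odot>\<^bsub>M\<^esub> b (y a)) \<in> mM"
    proof (rule submodule_finsum[OF submodule_mM], rule Pi_I)
      fix a assume a: "a \<in> A - {b}"
      then have "b \<otimes>\<^bsub>S\<^esub> a \<in> J" using orth b by auto
      then have "(b \<otimes>\<^bsub>S\<^esub> a) (z a) \<in> mM" using z(1) a by (auto simp: endos_into_def)
      then have "b (y a) \<in> mM" using z(1) a by (simp add: y_def)
      then show "c a \<odot>\<^bsub>M\<^esub> b (y a) \<in> mM" using mE(4)[OF cc] a by auto
    qed
    have byc: "b (y b) \<in> carrier M" using ac b yc endo_closed by auto
    have "c b \<odot>\<^bsub>M\<^esub> b (y b) = b (\<Oplus>\<^bsub>M\<^esub>a\<in>A. c a \<odot>\<^bsub>M\<^esub> y a) \<ominus>\<^bsub>M\<^esub> (\<Oplus>\<^bsub>M\<^esub>a\<in>A - {b}. c a \<odot>\<^bsub>M\<^esub> b (y a))"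
      unfolding eq using byc cc[OF b(1)] rest mE(1) by (simp add: M.minus_eq M.a_assoc M.r_neg subsetD)
    then have cby: "c b \<odot>\<^bsub>M\<^esub> b (y b) \<in> mM" using submodule_minus[OF submodule_mM L rest] by simp
    have "c b \<in> Units R" using b cc mm_units by auto
    then obtain u where u: "u \<in> carrier R" "u \<otimes> c b = \<one>" by (meson R.Units_inv_closed R.Units_l_inv)
    have "b (y b) = u \<odot>\<^bsub>M\<^esub> (c b \<odot>\<^bsub>M\<^esub> b (y b))"
      using u byc cc[OF b(1)] by (subst smult_assoc1[symmetric]) auto
    then have by_m: "b (y b) \<in> mM" using mE(4)[OF u(1) cby] by simp
    have "(b \<otimes>\<^bsub>S\<^esub> b \<ominus>\<^bsub>S\<^esub> b) (z b) \<in> mM" using idem[OF b(1)] z(1)[OF b(1)] by (auto simp: endos_into_def)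
    then have d: "b (y b) \<ominus>\<^bsub>M\<^esub> y b \<in> mM" using ac b z(1)[OF b(1)] by (simp add: endo_minus y_def)
    have "y b = b (y b) \<ominus>\<^bsub>M\<^esub> (b (y b) \<ominus>\<^bsub>M\<^esub> y b)"
      using byc yc[OF b(1)] by (simp add: M.minus_eq M.minus_add M.r_neg2)
    then have "y b \<in> mM" using submodule_minus[OF submodule_mM by_m d] by simp
    then show False using z(2)[OF b(1)] by (simp add: y_def)
  qed
  then have "\<forall>A. finite A \<longrightarrow> A \<subseteq> corner S e \<longrightarrow> (\<forall>a\<in>A. a \<notin> J \<and> a \<otimes>\<^bsub>S\<^esub> a \<ominus>\<^bsub>S\<^esub> a \<in> J) \<longrightarrow>
     (\<forall>a\<in>A. \<forall>b\<in>A. a \<noteq> b \<longrightarrow> a \<otimes>\<^bsub>S\<^esub> b \<in> J) \<longrightarrow> card A \<le> card X"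
    by simp
  then show ?thesis by (rule exI)
qed

end

section \<open>Finiteness of the set of indecomposable summands\<close>

lemma ring_hom_finsum:
  assumes "ring R" "ring R'" and h: "h \<in> ring_hom R R'" and f: "f \<in> A \<rightarrow> carrier R"
  shows "h (\<Oplus>\<^bsub>R\<^esub>a\<in>A. f a) = (\<Oplus>\<^bsub>R'\<^esub>a\<in>A. h (f a))"
proof -
  interpret R: ring R by fact
  interpret R': ring R' by fact
  have h0: "h \<zero>\<^bsub>R\<^esub> = \<zero>\<^bsub>R'\<^esub>" by (rule ring_hom_zero[OF h R.ring_axioms R'.ring_axioms])
  show ?thesis using f
  proof (induction A rule: infinite_finite_induct)
    case (insert a A)
    then have fa: "f a \<in> carrier R" "f \<in> A \<rightarrow> carrier R" by auto
    then have "h (\<Oplus>\<^bsub>R\<^esub>a\<in>insert a A. f a) = h (f a) \<oplus>\<^bsub>R'\<^esub> (\<Oplus>\<^bsub>R'\<^esub>a\<in>A. h (f a))"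
      using insert by (simp add: R.finsum_insert ring_hom_add[OF h])
    also have "\<dots> = (\<Oplus>\<^bsub>R'\<^esub>a\<in>insert a A. h (f a))"
      using insert fa ring_hom_closed[OF h] by (intro R'.finsum_insert[symmetric]) auto
    finally show ?case .
  qed (simp_all add: h0)
qed

context local_module
begin

abbreviation "T \<equiv> S Quot J"
abbreviation "\<pi> \<equiv> a_r_coset S J"

lemma ring_T: "ring T" by (rule ideal.quotient_is_ring[OF ideal_J])

lemma pi_hom: "\<pi> \<in> ring_hom S T" by (rule ideal.rcos_ring_hom[OF ideal_J])

lemma carrier_T: "carrier T = \<pi> ` carrier S"
  by (auto simp: FactRing_def A_RCOSETS_defs a_r_coset_def)

lemma pi_eq_iff: "f \<in> carrier S \<Longrightarrow> g \<in> carrier S \<Longrightarrow> \<pi> f = \<pi> g \<longleftrightarrow> f \<ominus>\<^bsub>S\<^esub> g \<in> J"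
  using S.quotient_eq_iff_same_a_r_cos[OF ideal_J] by blast

lemmas pi_mult = ring_hom_mult[OF pi_hom]
  and pi_closed = ring_hom_closed[OF pi_hom]
  and pi_zero = ring_hom_zero[OF pi_hom ring_endo ring_T]

lemma pi_eq_zero_iff: "f \<in> carrier S \<Longrightarrow> \<pi> f = \<zero>\<^bsub>T\<^esub> \<longleftrightarrow> f \<in> J"
  using pi_eq_iff[of f "\<zero>\<^bsub>S\<^esub>"] by (simp add: pi_zero S.minus_eq)

lemma pi_nat_pow: "f \<in> carrier S \<Longrightarrow> \<pi> (f [^]\<^bsub>S\<^esub> (n::nat)) = \<pi> f [^]\<^bsub>T\<^esub> n"
  by (induction n) (simp_all add: ring_hom_one[OF pi_hom] pi_mult)

lemma pi_idempotent: "e \<in> idempotents S \<Longrightarrow> \<pi> e \<in> idempotents T"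
  by (auto simp: idempotents_def pi_mult[symmetric] pi_closed)

lemma corner_lift:
  assumes e: "e \<in> idempotents S" and w: "w \<in> corner T (\<pi> e)"
  obtains s where "s \<in> corner S e" "\<pi> s = w"
proof -
  interpret T: ring T by (rule ring_T)
  have ec: "e \<in> carrier S" "e \<otimes>\<^bsub>S\<^esub> e = e" using e by (auto simp: idempotents_def)
  have wc: "w \<in> carrier T" "\<pi> e \<otimes>\<^bsub>T\<^esub> w = w" "w \<otimes>\<^bsub>T\<^esub> \<pi> e = w" using w by (simp_all add: corner_def)
  then obtain s where s: "s \<in> carrier S" "w = \<pi> s" using carrier_T by auto
  have "e \<otimes>\<^bsub>S\<^esub> (e \<otimes>\<^bsub>S\<^esub> s \<otimes>\<^bsub>S\<^esub> e) = e \<otimes>\<^bsub>S\<^esub> s \<otimes>\<^bsub>S\<^esub> e" using ec s by (simp add: S.m_assoc[symmetric])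
  moreover have "e \<otimes>\<^bsub>S\<^esub> s \<otimes>\<^bsub>S\<^esub> e \<otimes>\<^bsub>S\<^esub> e = e \<otimes>\<^bsub>S\<^esub> s \<otimes>\<^bsub>S\<^esub> e" using ec s by (simp add: S.m_assoc)
  ultimately have "e \<otimes>\<^bsub>S\<^esub> s \<otimes>\<^bsub>S\<^esub> e \<in> corner S e" using ec s by (simp add: corner_def)
  moreover have "\<pi> (e \<otimes>\<^bsub>S\<^esub> s \<otimes>\<^bsub>S\<^esub> e) = w" using ec s wc by (simp add: pi_mult)
  ultimately show ?thesis using that by blast
qed

lemma semiperfect_quotient:
  assumes e: "e \<in> idempotents S" and fg: "fg_image e"
  shows "semiperfect_idempotent T (\<pi> e)"
  unfolding semiperfect_idempotent_def
proof (intro conjI ballI)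
  interpret T: ring T by (rule ring_T)
  have ec: "e \<in> carrier S" "e \<otimes>\<^bsub>S\<^esub> e = e" using e by (auto simp: idempotents_def)
  show "\<pi> e \<in> idempotents T" by (rule pi_idempotent[OF e])
  show "strongly_pi_regular T w" if w: "w \<in> corner T (\<pi> e)" for w
  proof -
    obtain s where s: "s \<in> corner S e" "\<pi> s = w" by (rule corner_lift[OF e w])
    have sc: "s \<in> carrier S" using s by (simp add: corner_def)
    obtain n :: nat and q where n: "n > 0" and q: "q \<in> carrier S" "s \<otimes>\<^bsub>S\<^esub> q = q \<otimes>\<^bsub>S\<^esub> s"
      "s [^]\<^bsub>S\<^esub> n \<ominus>\<^bsub>S\<^esub> s [^]\<^bsub>S\<^esub> Suc n \<otimes>\<^bsub>S\<^esub> q \<in> J"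
      using corner_pi_regular_mod_J[OF e fg s(1)] by blast
    have "\<pi> (s [^]\<^bsub>S\<^esub> n) = \<pi> (s [^]\<^bsub>S\<^esub> Suc n \<otimes>\<^bsub>S\<^esub> q)"
      using pi_eq_iff[of "s [^]\<^bsub>S\<^esub> n" "s [^]\<^bsub>S\<^esub> Suc n \<otimes>\<^bsub>S\<^esub> q"] q sc by blast
    then have "w [^]\<^bsub>T\<^esub> n = w [^]\<^bsub>T\<^esub> Suc n \<otimes>\<^bsub>T\<^esub> \<pi> q"
      using s(2) sc q(1) by (simp add: pi_mult pi_nat_pow)
    moreover have "w \<otimes>\<^bsub>T\<^esub> \<pi> q = \<pi> q \<otimes>\<^bsub>T\<^esub> w"
      using arg_cong[OF q(2), of \<pi>] s(2) sc q(1) by (simp add: pi_mult)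
    ultimately show ?thesis using n pi_closed[OF q(1)] unfolding strongly_pi_regular_def by blast
  qed
  obtain d where d: "\<And>A. finite A \<Longrightarrow> A \<subseteq> corner S e \<Longrightarrow> \<forall>a\<in>A. a \<notin> J \<and> a \<otimes>\<^bsub>S\<^esub> a \<ominus>\<^bsub>S\<^esub> a \<in> J \<Longrightarrow>
     \<forall>a\<in>A. \<forall>b\<in>A. a \<noteq> b \<longrightarrow> a \<otimes>\<^bsub>S\<^esub> b \<in> J \<Longrightarrow> card A \<le> d"
    using corner_almost_orthogonal_bound[OF ec(1) fg] by blast
  have "card A \<le> d" if A: "orthogonal_idempotents T A" "A \<subseteq> corner T (\<pi> e)" for A
  proof -
    have "\<forall>a\<in>A. \<exists>s. s \<in> corner S e \<and> \<pi> s = a"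
    proof
      fix a assume "a \<in> A"
      then have "a \<in> corner T (\<pi> e)" using A(2) by blast
      then obtain s where "s \<in> corner S e" "\<pi> s = a" by (rule corner_lift[OF e])
      then show "\<exists>s. s \<in> corner S e \<and> \<pi> s = a" by blast
    qed
    from bchoice[OF this] obtain s where s: "\<And>a. a \<in> A \<Longrightarrow> s a \<in> corner S e" "\<And>a. a \<in> A \<Longrightarrow> \<pi> (s a) = a"
      by blast
    have inj: "inj_on s A" by (rule inj_on_inverseI[of _ \<pi>]) (rule s(2))
    have sc: "s a \<in> carrier S" if "a \<in> A" for a using s(1)[OF that] by (simp add: corner_def)
    have "card (s ` A) \<le> d"
    proof (rule d)
      show "finite (s ` A)" "s ` A \<subseteq> corner S e" using A s by (auto simp: orthogonal_idempotents_def)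
      show "\<forall>b\<in>s ` A. b \<notin> J \<and> b \<otimes>\<^bsub>S\<^esub> b \<ominus>\<^bsub>S\<^esub> b \<in> J"
      proof (rule ballI, elim imageE)
        fix b a assume b: "b = s a" and a: "a \<in> A"
        have "a \<noteq> \<zero>\<^bsub>T\<^esub>" "a \<otimes>\<^bsub>T\<^esub> a = a" using A(1) a by (auto simp: orthogonal_idempotents_def idempotents_def)
        then show "b \<notin> J \<and> b \<otimes>\<^bsub>S\<^esub> b \<ominus>\<^bsub>S\<^esub> b \<in> J"
          using pi_eq_zero_iff[OF sc[OF a]] pi_eq_iff[of "b \<otimes>\<^bsub>S\<^esub> b" b] s(2)[OF a] sc[OF a] b
          by (simp add: pi_mult)
      qed
      show "\<forall>b\<in>s ` A. \<forall>c\<in>s ` A. b \<noteq> c \<longrightarrow> b \<otimes>\<^bsub>S\<^esub> c \<in> J"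
      proof (intro ballI impI, elim imageE)
        fix b c a a' assume b: "b \<noteq> c" "b = s a" "c = s a'" "a \<in> A" "a' \<in> A"
        then have "a \<noteq> a'" by blast
        then have "a \<otimes>\<^bsub>T\<^esub> a' = \<zero>\<^bsub>T\<^esub>" using A(1) b(4,5) by (simp add: orthogonal_idempotents_def)
        then show "b \<otimes>\<^bsub>S\<^esub> c \<in> J"
          using pi_eq_zero_iff[of "b \<otimes>\<^bsub>S\<^esub> c"] b sc s(2) by (simp add: pi_mult)
      qed
    qed
    then show ?thesis using card_image[OF inj] by simp
  qed
  then show "\<exists>d. \<forall>A. orthogonal_idempotents T A \<longrightarrow> A \<subseteq> corner T (\<pi> e) \<longrightarrow> card A \<le> d" by blast
qed

text \<open>A factorization modulo \<open>J\<close> composes to an endomorphism congruent to \<open>f\<close>, which is invertible in the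
corner of \<open>f\<close> and can be corrected to \<open>f\<close>.\<close>
lemma factors_through_lift:
  assumes f: "f \<in> idempotents S" "fg_image f" and g: "g \<in> carrier S"
    and le: "factors_through T (\<pi> f) (\<pi> g)"
  shows "factors_through S f g"
proof -
  interpret T: ring T by (rule ring_T)
  have fc: "f \<in> carrier S" "f \<otimes>\<^bsub>S\<^esub> f = f" using f by (auto simp: idempotents_def)
  obtain a b where ab: "a \<in> carrier S" "b \<in> carrier S" "\<pi> b \<otimes>\<^bsub>T\<^esub> \<pi> g \<otimes>\<^bsub>T\<^esub> \<pi> a = \<pi> f"
    using le carrier_T unfolding factors_through_def by auto
  define x where "x = f \<otimes>\<^bsub>S\<^esub> (b \<otimes>\<^bsub>S\<^esub> g \<otimes>\<^bsub>S\<^esub> a) \<otimes>\<^bsub>S\<^esub> f"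
  have xc: "x \<in> carrier S" using fc ab g by (simp add: x_def)
  have "f \<otimes>\<^bsub>S\<^esub> x = x" using fc ab g by (simp add: x_def S.m_assoc[symmetric])
  moreover have "x \<otimes>\<^bsub>S\<^esub> f = x" using fc ab g by (simp add: x_def S.m_assoc)
  ultimately have "x \<in> corner S f" using xc by (simp add: corner_def)
  moreover have "\<pi> f = \<pi> x"
  proof -
    have "\<pi> x = \<pi> f \<otimes>\<^bsub>T\<^esub> (\<pi> b \<otimes>\<^bsub>T\<^esub> \<pi> g \<otimes>\<^bsub>T\<^esub> \<pi> a) \<otimes>\<^bsub>T\<^esub> \<pi> f"
      using fc ab g by (simp add: x_def pi_mult)
    also have "\<dots> = \<pi> (f \<otimes>\<^bsub>S\<^esub> f \<otimes>\<^bsub>S\<^esub> f)" using ab(3) fc(1) by (simp add: pi_mult)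
    finally show ?thesis using fc by simp
  qed
  ultimately obtain y where y: "y \<in> carrier S" "y \<otimes>\<^bsub>S\<^esub> x = f"
    using left_inverse_mod_J[OF f] pi_eq_iff[OF fc(1) xc] by blast
  have "(y \<otimes>\<^bsub>S\<^esub> f \<otimes>\<^bsub>S\<^esub> b) \<otimes>\<^bsub>S\<^esub> g \<otimes>\<^bsub>S\<^esub> (a \<otimes>\<^bsub>S\<^esub> f) = f"
    using y fc(1) ab(1,2) g by (simp add: x_def S.m_assoc)
  then show ?thesis unfolding factors_through_def using y fc ab by blast
qed

lemma fg_idempotent_in_J:
  assumes f: "f \<in> idempotents S" "fg_image f" and J: "f \<in> J"
  shows "f = \<zero>\<^bsub>S\<^esub>"
proof -
  have fc: "f \<in> carrier S" using f by (auto simp: idempotents_def)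
  have "\<zero>\<^bsub>S\<^esub> \<in> corner S f" using fc by (simp add: corner_def)
  moreover have "f \<ominus>\<^bsub>S\<^esub> \<zero>\<^bsub>S\<^esub> \<in> J" using J fc by (simp add: S.minus_eq)
  ultimately obtain y where "y \<in> carrier S" "y \<otimes>\<^bsub>S\<^esub> \<zero>\<^bsub>S\<^esub> = f" using left_inverse_mod_J[OF f] by blast
  then show ?thesis by simp
qed

text \<open>Every nonzero idempotent below \<open>e\<close> stays nonzero modulo \<open>J\<close>, so the bound on orthogonal families
modulo \<open>J\<close> applies.\<close>
theorem fg_idempotent_decomposition:
  assumes e: "e \<in> idempotents S" and fg: "fg_image e"
  shows "\<exists>A. orthogonal_idempotents S A \<and> (\<Oplus>\<^bsub>S\<^esub>a\<in>A. a) = e \<and> (\<forall>a\<in>A. primitive_idempotent S a)"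
proof -
  have ec: "e \<in> carrier S" using e by (auto simp: idempotents_def)
  obtain d where d: "\<And>A. finite A \<Longrightarrow> A \<subseteq> corner S e \<Longrightarrow> \<forall>a\<in>A. a \<notin> J \<and> a \<otimes>\<^bsub>S\<^esub> a \<ominus>\<^bsub>S\<^esub> a \<in> J \<Longrightarrow>
     \<forall>a\<in>A. \<forall>b\<in>A. a \<noteq> b \<longrightarrow> a \<otimes>\<^bsub>S\<^esub> b \<in> J \<Longrightarrow> card A \<le> d"
    using corner_almost_orthogonal_bound[OF ec fg] by blast
  have "card A \<le> d" if A: "orthogonal_idempotents S A" "A \<subseteq> corner S e" for A
  proof (rule d)
    show "finite A" "A \<subseteq> corner S e" using A by (auto simp: orthogonal_idempotents_def)
    show "\<forall>a\<in>A. a \<notin> J \<and> a \<otimes>\<^bsub>S\<^esub> a \<ominus>\<^bsub>S\<^esub> a \<in> J"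
    proof
      fix a assume a: "a \<in> A"
      have ai: "a \<in> idempotents S" "a \<noteq> \<zero>\<^bsub>S\<^esub>" using A a by (auto simp: orthogonal_idempotents_def)
      have "fg_image a" using fg_image_corner[OF fg ec] A(2) a by (auto simp: corner_def)
      then have "a \<notin> J" using fg_idempotent_in_J ai by blast
      then show "a \<notin> J \<and> a \<otimes>\<^bsub>S\<^esub> a \<ominus>\<^bsub>S\<^esub> a \<in> J"
        using ai J_zero_closed by (auto simp: idempotents_def S.minus_eq S.r_neg)
    qed
    show "\<forall>a\<in>A. \<forall>b\<in>A. a \<noteq> b \<longrightarrow> a \<otimes>\<^bsub>S\<^esub> b \<in> J"
      using A(1) J_zero_closed by (auto simp: orthogonal_idempotents_def)
  qed
  then show ?thesis by (rule S.primitive_decomposition[OF e])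
qed

text \<open>The multiplicity vectors are computed in \<open>S/J\<close>, where the idempotents with finitely generated
image satisfy the Krull-Schmidt theorem. A comparison of vectors gives a factorization modulo \<open>J\<close>, which lifts to \<open>S\<close>, and for primitive idempotents a
factorization is an equivalence.\<close>
theorem finitely_many_primitive_classes:
  assumes U: "finite U" "\<And>u. u \<in> U \<Longrightarrow> u \<in> idempotents S \<and> fg_image u"
    and Q: "\<And>q. q \<in> Q \<Longrightarrow> primitive_idempotent S q \<and> fg_image q"
    and sum: "\<And>q. q \<in> Q \<Longrightarrow> \<exists>(I :: 'i set) a u b. finite I \<and> a \<in> I \<rightarrow> carrier S \<and> b \<in> I \<rightarrow> carrier S \<and>
        u \<in> I \<rightarrow> U \<and> (\<Oplus>\<^bsub>S\<^esub>i\<in>I. a i \<otimes>\<^bsub>S\<^esub> u i \<otimes>\<^bsub>S\<^esub> b i) = q"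
  shows "\<exists>F. finite F \<and> F \<subseteq> Q \<and> (\<forall>q\<in>Q. \<exists>f\<in>F. equivalent_idempotents S q f)"
proof -
  interpret T: ring T by (rule ring_T)
  have Qi: "q \<in> idempotents S" "q \<in> carrier S" if "q \<in> Q" for q
    using Q[OF that] by (auto simp: primitive_idempotent_def idempotents_def)
  have Ui: "u \<in> carrier S" if "u \<in> U" for u using U(2)[OF that] by (auto simp: idempotents_def)
  have Tsum: "\<exists>(I :: 'i set) a u b. finite I \<and> a \<in> I \<rightarrow> carrier T \<and> b \<in> I \<rightarrow> carrier T \<and>
        u \<in> I \<rightarrow> \<pi> ` U \<and> (\<Oplus>\<^bsub>T\<^esub>i\<in>I. a i \<otimes>\<^bsub>T\<^esub> u i \<otimes>\<^bsub>T\<^esub> b i) = r" if r: "r \<in> \<pi> ` Q" for r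
  proof -
    obtain q where q: "q \<in> Q" "r = \<pi> q" using r by blast
    obtain I :: "'i set" and a u b where I: "finite I" "a \<in> I \<rightarrow> carrier S" "b \<in> I \<rightarrow> carrier S"
      "u \<in> I \<rightarrow> U" "(\<Oplus>\<^bsub>S\<^esub>i\<in>I. a i \<otimes>\<^bsub>S\<^esub> u i \<otimes>\<^bsub>S\<^esub> b i) = q" using sum[OF q(1)] by blast
    have Ic: "a i \<in> carrier S" "b i \<in> carrier S" "u i \<in> carrier S" if "i \<in> I" for i
      using I that Ui by auto
    have "r = (\<Oplus>\<^bsub>T\<^esub>i\<in>I. \<pi> (a i \<otimes>\<^bsub>S\<^esub> u i \<otimes>\<^bsub>S\<^esub> b i))"
      unfolding q(2) I(5)[symmetric] using Ic by (intro ring_hom_finsum[OF ring_endo ring_T pi_hom]) auto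
    also have "\<dots> = (\<Oplus>\<^bsub>T\<^esub>i\<in>I. \<pi> (a i) \<otimes>\<^bsub>T\<^esub> \<pi> (u i) \<otimes>\<^bsub>T\<^esub> \<pi> (b i))"
      using Ic by (intro T.add.finprod_cong') (auto simp: pi_mult pi_closed)
    finally have "(\<Oplus>\<^bsub>T\<^esub>i\<in>I. \<pi> (a i) \<otimes>\<^bsub>T\<^esub> \<pi> (u i) \<otimes>\<^bsub>T\<^esub> \<pi> (b i)) = r" by simp
    then show ?thesis using I Ic
      by (intro exI[of _ I] exI[of _ "\<lambda>i. \<pi> (a i)"] exI[of _ "\<lambda>i. \<pi> (u i)"] exI[of _ "\<lambda>i. \<pi> (b i)"])
        (auto simp: pi_closed)
  qed
  have sU: "semiperfect_idempotent T u" if "u \<in> \<pi> ` U" for u using that U(2) semiperfect_quotient by auto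
  have sQ: "semiperfect_idempotent T q" if "q \<in> \<pi> ` Q" for q using that Q Qi(1) semiperfect_quotient by auto
  obtain \<Lambda> :: "('c \<Rightarrow> 'c) set set" and \<tau> :: "('c \<Rightarrow> 'c) set \<Rightarrow> ('c \<Rightarrow> 'c) set \<Rightarrow> nat" where Lam: "finite \<Lambda>" and tau: "\<And>r r'. r \<in> \<pi> ` Q \<Longrightarrow> r' \<in> \<pi> ` Q \<Longrightarrow>
     (\<And>v. v \<in> \<Lambda> \<Longrightarrow> \<tau> r v \<le> (\<tau> r' v :: nat)) \<Longrightarrow> factors_through T r r'"
  proof (rule T.multiplicity_vector[OF finite_imageI[OF U(1)] sU sQ Tsum])
    fix \<Lambda> and \<tau> :: "('c \<Rightarrow> 'c) set \<Rightarrow> ('c \<Rightarrow> 'c) set \<Rightarrow> nat"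
    assume a: "finite \<Lambda>" and b: "\<And>r r'. r \<in> \<pi> ` Q \<Longrightarrow> r' \<in> \<pi> ` Q \<Longrightarrow>
      (\<And>v. v \<in> \<Lambda> \<Longrightarrow> \<tau> r v \<le> \<tau> r' v) \<Longrightarrow> factors_through T r r'"
    show thesis by (rule that[OF a]) (rule b)
  qed
  show ?thesis
  proof (rule dickson_finite_representatives[OF Lam, where \<tau> = "\<lambda>q. \<tau> (\<pi> q)"])
    fix q q' assume q: "q \<in> Q" "q' \<in> Q" and le: "\<And>v. v \<in> \<Lambda> \<Longrightarrow> \<tau> (\<pi> q) v \<le> \<tau> (\<pi> q') v"
    have "factors_through T (\<pi> q) (\<pi> q')" using q le by (intro tau) auto
    then have "factors_through S q q'" using factors_through_lift Qi q Q by blast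
    moreover have "q \<noteq> \<zero>\<^bsub>S\<^esub>" using Q[OF q(1)] by (simp add: primitive_idempotent_def)
    ultimately have "equivalent_idempotents S q q'"
      using S.equivalent_of_primitive Q[OF q(2)] Qi q by blast
    then show "equivalent_idempotents S q' q" by (rule S.equivalent_idempotents_sym)
  qed
qed

end

section \<open>Linear maps\<close>

definition linear_map ::
  "('a, 'r) ring_scheme \<Rightarrow> ('a, 'b, 'm) module_scheme \<Rightarrow> ('a, 'c, 'n) module_scheme \<Rightarrow> ('b \<Rightarrow> 'c) \<Rightarrow> bool" where
  "linear_map R M N f \<longleftrightarrow> f \<in> carrier M \<rightarrow> carrier N \<and>
     (\<forall>x\<in>carrier M. \<forall>y\<in>carrier M. f (x \<oplus>\<^bsub>M\<^esub> y) = f x \<oplus>\<^bsub>N\<^esub> f y) \<and>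
     (\<forall>r\<in>carrier R. \<forall>x\<in>carrier M. f (r \<odot>\<^bsub>M\<^esub> x) = r \<odot>\<^bsub>N\<^esub> f x)"

lemma linear_mapD:
  assumes "linear_map R M N f"
  shows "x \<in> carrier M \<Longrightarrow> f x \<in> carrier N"
    "x \<in> carrier M \<Longrightarrow> y \<in> carrier M \<Longrightarrow> f (x \<oplus>\<^bsub>M\<^esub> y) = f x \<oplus>\<^bsub>N\<^esub> f y"
    "r \<in> carrier R \<Longrightarrow> x \<in> carrier M \<Longrightarrow> f (r \<odot>\<^bsub>M\<^esub> x) = r \<odot>\<^bsub>N\<^esub> f x"
  using assms by (auto simp: linear_map_def)

lemma linear_map_comp:
  "linear_map R M N f \<Longrightarrow> linear_map R N P g \<Longrightarrow> linear_map R M P (\<lambda>x. g (f x))"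
  by (auto simp: linear_map_def Pi_iff)

lemma linear_map_zero:
  assumes "module R M" "module R N" "linear_map R M N f"
  shows "f \<zero>\<^bsub>M\<^esub> = \<zero>\<^bsub>N\<^esub>"
proof -
  interpret M: module R M by fact
  interpret N: module R N by fact
  have "f \<zero>\<^bsub>M\<^esub> = f (\<zero>\<^bsub>R\<^esub> \<odot>\<^bsub>M\<^esub> \<zero>\<^bsub>M\<^esub>)" by simp
  also have "\<dots> = \<zero>\<^bsub>R\<^esub> \<odot>\<^bsub>N\<^esub> f \<zero>\<^bsub>M\<^esub>" by (rule linear_mapD(3)[OF assms(3)]) auto
  also have "\<dots> = \<zero>\<^bsub>N\<^esub>" using linear_mapD(1)[OF assms(3)] by simp
  finally show ?thesis .
qed

lemma linear_map_finsum:
  assumes "module R M" "module R N" "linear_map R M N f" "h \<in> A \<rightarrow> carrier M"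
  shows "f (\<Oplus>\<^bsub>M\<^esub>a\<in>A. h a) = (\<Oplus>\<^bsub>N\<^esub>a\<in>A. f (h a))"
proof -
  interpret M: module R M by fact
  interpret N: module R N by fact
  note f0 = linear_map_zero[OF assms(1-3)]
  note f = linear_mapD[OF assms(3)]
  show ?thesis using assms(4)
  proof (induction A rule: infinite_finite_induct)
    case (insert a A)
    then have ha: "h a \<in> carrier M" "h \<in> A \<rightarrow> carrier M" by auto
    then have "f (\<Oplus>\<^bsub>M\<^esub>a\<in>insert a A. h a) = f (h a) \<oplus>\<^bsub>N\<^esub> (\<Oplus>\<^bsub>N\<^esub>a\<in>A. f (h a))"
      using insert by (simp add: M.M.finsum_insert f)
    also have "\<dots> = (\<Oplus>\<^bsub>N\<^esub>a\<in>insert a A. f (h a))"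
      using insert ha f(1) by (intro N.M.finsum_insert[symmetric]) auto
    finally show ?case .
  qed (simp_all add: f0)
qed

lemma module_iso_inverse:
  assumes "f \<in> module_iso R M N"
  shows "linear_map R M N f"
    "x \<in> carrier M \<Longrightarrow> inv_into (carrier M) f (f x) = x"
    "y \<in> carrier N \<Longrightarrow> f (inv_into (carrier M) f y) = y"
    "y \<in> carrier N \<Longrightarrow> inv_into (carrier M) f y \<in> carrier M"
proof -
  have b: "bij_betw f (carrier M) (carrier N)" using assms by (simp add: module_iso_def)
  show "linear_map R M N f" using assms by (auto simp: linear_map_def module_iso_def bij_betw_def)
  show "x \<in> carrier M \<Longrightarrow> inv_into (carrier M) f (f x) = x" using b by (rule bij_betw_inv_into_left)
  show "y \<in> carrier N \<Longrightarrow> f (inv_into (carrier M) f y) = y" using b by (rule bij_betw_inv_into_right)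
  show "y \<in> carrier N \<Longrightarrow> inv_into (carrier M) f y \<in> carrier M"
    using b by (metis bij_betw_def inv_into_into)
qed

lemma module_iso_inverse_linear:
  assumes M: "module R M" and f: "f \<in> module_iso R M N"
  shows "linear_map R N M (inv_into (carrier M) f)"
proof -
  interpret M: module R M by fact
  note i = module_iso_inverse[OF f]
  let ?g = "inv_into (carrier M) f"
  have "?g (x \<oplus>\<^bsub>N\<^esub> y) = ?g x \<oplus>\<^bsub>M\<^esub> ?g y" if "x \<in> carrier N" "y \<in> carrier N" for x y
  proof -
    have "x \<oplus>\<^bsub>N\<^esub> y = f (?g x \<oplus>\<^bsub>M\<^esub> ?g y)" using i that by (simp add: linear_mapD[OF i(1)])
    then show ?thesis using i that by simp
  qed
  moreover have "?g (r \<odot>\<^bsub>N\<^esub> y) = r \<odot>\<^bsub>M\<^esub> ?g y" if "r \<in> carrier R" "y \<in> carrier N" for r y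
  proof -
    have "r \<odot>\<^bsub>N\<^esub> y = f (r \<odot>\<^bsub>M\<^esub> ?g y)" using i that by (simp add: linear_mapD[OF i(1)])
    then show ?thesis using i that by simp
  qed
  ultimately show ?thesis using i(4) by (auto simp: linear_map_def)
qed

lemma module_isomorphicI:
  assumes "linear_map R M N f" "\<And>y. y \<in> carrier N \<Longrightarrow> g y \<in> carrier M"
    "\<And>x. x \<in> carrier M \<Longrightarrow> g (f x) = x" "\<And>y. y \<in> carrier N \<Longrightarrow> f (g y) = y"
  shows "module_isomorphic R M N"
proof -
  have "bij_betw f (carrier M) (carrier N)"
    by (rule bij_betw_byWitness[where f' = g]) (use assms linear_mapD(1)[OF assms(1)] in auto)
  then have "f \<in> module_iso R M N" using assms(1) by (simp add: module_iso_def linear_map_def)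
  then show ?thesis by (auto simp: module_isomorphic_def)
qed

lemma module_isomorphic_refl: "module_isomorphic R M M"
  by (rule module_isomorphicI[where f = "\<lambda>x. x" and g = "\<lambda>x. x"]) (auto simp: linear_map_def)

text \<open>The module axioms are pulled back along the injective map \<open>f\<close>. For a Frobenius pushforward this reads
off the distributive law \<open>(r + s)x = rx + sx\<close> from an isomorphism with a direct sum of modules.\<close>
lemma module_from_iso:
  assumes ab: "abelian_group P" and sm: "\<And>r x. r \<in> carrier R \<Longrightarrow> x \<in> carrier P \<Longrightarrow> r \<odot>\<^bsub>P\<^esub> x \<in> carrier P"
    and D: "module R D" and f: "f \<in> module_iso R P D"
  shows "module R P"
proof -
  interpret P: abelian_group P by fact
  interpret D: module R D by fact
  note i = module_iso_inverse[OF f]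
  note l = linear_mapD[OF i(1)]
  have inj: "x = y" if "f x = f y" "x \<in> carrier P" "y \<in> carrier P" for x y
    using i(2) that by metis
  show ?thesis
    by (rule moduleI[OF D.is_cring ab]; (rule inj)?)
      (auto simp: sm l D.smult_l_distr D.smult_r_distr D.smult_assoc1)
qed

section \<open>Direct sums\<close>

lemma module_direct_sum:
  assumes R: "cring R" and N: "\<And>i. i \<in> I \<Longrightarrow> module R (N i)"
  shows "module R (direct_sum_module I N)"
proof -
  interpret R: cring R by fact
  have ab: "abelian_group (N i)" if "i \<in> I" for i using N[OF that] by (simp add: module_def)
  note am = abelian_group.axioms(1)[OF ab]
  show ?thesis
  proof (rule moduleI[OF R])
    show "abelian_group (direct_sum_module I N)"
    proof (rule abelian_groupI)
      fix x assume x: "x \<in> carrier (direct_sum_module I N)"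
      then have "(\<lambda>i\<in>I. \<ominus>\<^bsub>N i\<^esub> x i) \<in> carrier (direct_sum_module I N)"
        by (auto simp: direct_sum_module_def intro!: abelian_group.a_inv_closed[OF ab])
      moreover have "(\<lambda>i\<in>I. \<ominus>\<^bsub>N i\<^esub> x i) \<oplus>\<^bsub>direct_sum_module I N\<^esub> x = \<zero>\<^bsub>direct_sum_module I N\<^esub>"
        using x by (auto simp: direct_sum_module_def intro!: restrict_ext abelian_group.l_neg[OF ab])
      ultimately show "\<exists>y\<in>carrier (direct_sum_module I N). y \<oplus>\<^bsub>direct_sum_module I N\<^esub> x = \<zero>\<^bsub>direct_sum_module I N\<^esub>"
        by blast
    next
      fix x assume x: "x \<in> carrier (direct_sum_module I N)"
      show "\<zero>\<^bsub>direct_sum_module I N\<^esub> \<oplus>\<^bsub>direct_sum_module I N\<^esub> x = x"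
      proof
        fix i show "(\<zero>\<^bsub>direct_sum_module I N\<^esub> \<oplus>\<^bsub>direct_sum_module I N\<^esub> x) i = x i"
          using x abelian_monoid.l_zero[OF am] by (auto simp: direct_sum_module_def PiE_def extensional_def Pi_iff)
      qed
    next
      fix x y assume "x \<in> carrier (direct_sum_module I N)" "y \<in> carrier (direct_sum_module I N)"
      then show "x \<oplus>\<^bsub>direct_sum_module I N\<^esub> y \<in> carrier (direct_sum_module I N)"
        "x \<oplus>\<^bsub>direct_sum_module I N\<^esub> y = y \<oplus>\<^bsub>direct_sum_module I N\<^esub> x"
        by (auto simp: direct_sum_module_def intro!: restrict_ext abelian_monoid.a_closed[OF am] abelian_monoid.a_comm[OF am])
    next
      fix x y z assume "x \<in> carrier (direct_sum_module I N)" "y \<in> carrier (direct_sum_module I N)"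
        "z \<in> carrier (direct_sum_module I N)"
      then show "x \<oplus>\<^bsub>direct_sum_module I N\<^esub> y \<oplus>\<^bsub>direct_sum_module I N\<^esub> z =
          x \<oplus>\<^bsub>direct_sum_module I N\<^esub> (y \<oplus>\<^bsub>direct_sum_module I N\<^esub> z)"
        by (auto simp: direct_sum_module_def intro!: restrict_ext abelian_monoid.a_assoc[OF am])
    qed (auto simp: direct_sum_module_def intro!: abelian_monoid.zero_closed[OF am])
  next
    fix x assume x: "x \<in> carrier (direct_sum_module I N)"
    show "\<one>\<^bsub>R\<^esub> \<odot>\<^bsub>direct_sum_module I N\<^esub> x = x"
    proof
      fix i show "(\<one>\<^bsub>R\<^esub> \<odot>\<^bsub>direct_sum_module I N\<^esub> x) i = x i"
        using x module.smult_one[OF N] by (auto simp: direct_sum_module_def PiE_def extensional_def Pi_iff)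
    qed
  qed (auto simp: direct_sum_module_def module.smult_l_distr[OF N] module.smult_r_distr[OF N]
      module.smult_assoc1[OF N] PiE_iff intro!: restrict_ext module.smult_closed[OF N])
qed

definition summand_inj :: "'i set \<Rightarrow> ('i \<Rightarrow> ('a, 'b, 'm) module_scheme) \<Rightarrow> 'i \<Rightarrow> 'b \<Rightarrow> 'i \<Rightarrow> 'b" where
  "summand_inj I N i x = (\<lambda>j\<in>I. if j = i then x else \<zero>\<^bsub>N j\<^esub>)"

lemma summand_inj_linear:
  assumes N: "\<And>i. i \<in> I \<Longrightarrow> module R (N i)" and i: "i \<in> I"
  shows "linear_map R (N i) (direct_sum_module I N) (summand_inj I N i)"
proof -
  have z: "\<zero>\<^bsub>N j\<^esub> \<in> carrier (N j)" "\<zero>\<^bsub>N j\<^esub> \<oplus>\<^bsub>N j\<^esub> \<zero>\<^bsub>N j\<^esub> = \<zero>\<^bsub>N j\<^esub>"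
    "r \<in> carrier R \<Longrightarrow> r \<odot>\<^bsub>N j\<^esub> \<zero>\<^bsub>N j\<^esub> = \<zero>\<^bsub>N j\<^esub>" if "j \<in> I" for j r
  proof -
    interpret module R "N j" by (rule N[OF that])
    show "\<zero>\<^bsub>N j\<^esub> \<in> carrier (N j)" "\<zero>\<^bsub>N j\<^esub> \<oplus>\<^bsub>N j\<^esub> \<zero>\<^bsub>N j\<^esub> = \<zero>\<^bsub>N j\<^esub>"
      "r \<in> carrier R \<Longrightarrow> r \<odot>\<^bsub>N j\<^esub> \<zero>\<^bsub>N j\<^esub> = \<zero>\<^bsub>N j\<^esub>" by auto
  qed
  then show ?thesis
    by (auto simp: linear_map_def direct_sum_module_def summand_inj_def intro!: restrict_ext)
qed

lemma summand_proj_linear: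
  "i \<in> I \<Longrightarrow> linear_map R (direct_sum_module I N) (N i) (\<lambda>y. y i)"
  by (auto simp: linear_map_def direct_sum_module_def)

text \<open>The right-hand side is built up over growing finite subsets of the index set, comparing with the
truncations of \<open>y\<close>.\<close>
lemma linear_map_direct_sum_expand:
  assumes R: "cring R" and N: "\<And>i. i \<in> I \<Longrightarrow> module R (N i)" and fin: "finite I" and M: "module R M"
    and g: "linear_map R (direct_sum_module I N) M g" and y: "y \<in> carrier (direct_sum_module I N)"
  shows "g y = (\<Oplus>\<^bsub>M\<^esub>i\<in>I. g (summand_inj I N i (y i)))"
proof -
  interpret M: module R M by fact
  let ?D = "direct_sum_module I N"
  have D: "module R ?D" by (rule module_direct_sum[OF R N])
  interpret D: module R ?D by fact
  note gl = linear_mapD[OF g]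
  have yi: "y i \<in> carrier (N i)" if "i \<in> I" for i using y that by (auto simp: direct_sum_module_def)
  define tr where "tr J = (\<lambda>i\<in>I. if i \<in> J then y i else \<zero>\<^bsub>N i\<^esub>)" for J
  have z: "\<zero>\<^bsub>N i\<^esub> \<in> carrier (N i)" if "i \<in> I" for i
  proof -
    interpret module R "N i" by (rule N[OF that])
    show ?thesis by simp
  qed
  have trc: "tr J \<in> carrier ?D" for J using yi z by (auto simp: tr_def direct_sum_module_def)
  have inj: "summand_inj I N i (y i) \<in> carrier ?D" if "i \<in> I" for i
  proof -
    have "linear_map R (N i) ?D (summand_inj I N i)" using N that by (rule summand_inj_linear)
    then show ?thesis using yi[OF that] by (rule linear_mapD(1))
  qed
  have "g (tr J) = (\<Oplus>\<^bsub>M\<^esub>i\<in>J. g (summand_inj I N i (y i)))" if "finite J" "J \<subseteq> I" for J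
    using that
  proof (induction J rule: finite_induct)
    case empty
    have "tr {} = \<zero>\<^bsub>?D\<^esub>" by (simp add: tr_def direct_sum_module_def)
    then show ?case using linear_map_zero[OF D M g] by simp
  next
    case (insert j J)
    have jI: "j \<in> I" "J \<subseteq> I" using insert.prems by auto
    interpret Nj: module R "N j" by (rule N[OF jI(1)])
    have "tr (insert j J) = summand_inj I N j (y j) \<oplus>\<^bsub>?D\<^esub> tr J"
    proof
      fix i
      show "tr (insert j J) i = (summand_inj I N j (y j) \<oplus>\<^bsub>?D\<^esub> tr J) i"
      proof (cases "i \<in> I")
        case True
        interpret Ni: module R "N i" by (rule N[OF True])
        show ?thesis using True insert.hyps yi[OF True]
          by (auto simp: tr_def summand_inj_def direct_sum_module_def)
      qed (auto simp: tr_def direct_sum_module_def)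
    qed
    then have "g (tr (insert j J)) = g (summand_inj I N j (y j)) \<oplus>\<^bsub>M\<^esub> (\<Oplus>\<^bsub>M\<^esub>i\<in>J. g (summand_inj I N i (y i)))"
      using insert.IH jI gl(2)[OF inj[OF jI(1)] trc] by simp
    also have "\<dots> = (\<Oplus>\<^bsub>M\<^esub>i\<in>insert j J. g (summand_inj I N i (y i)))"
      using insert.hyps jI inj gl(1) by (intro M.M.finsum_insert[symmetric]) auto
    finally show ?case .
  qed
  from this[OF fin order_refl] have "g (tr I) = (\<Oplus>\<^bsub>M\<^esub>i\<in>I. g (summand_inj I N i (y i)))" .
  moreover have "tr I = y"
  proof
    fix i show "tr I i = y i"
      using y by (cases "i \<in> I") (auto simp: tr_def direct_sum_module_def intro: PiE_arb[symmetric])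
  qed
  ultimately show ?thesis by simp
qed

lemma direct_sum_with_multiplicities:
  fixes L :: "nat \<Rightarrow> ('a, 'c) module"
  assumes fin: "finite \<Gamma>" and L: "L \<in> {..<k} \<rightarrow> \<Gamma>"
  shows "\<exists>t. module_isomorphic R (direct_sum_module {..<k} L)
     (direct_sum_module (SIGMA N:\<Gamma>. {..<t N}) (fst :: ('a, 'c) module \<times> nat \<Rightarrow> ('a, 'c) module))"
proof -
  define B where "B P = {i \<in> {..<k}. L i = P}" for P
  have "\<exists>g. bij_betw g {..<card (B P)} (B P)" for P
    using ex_bij_betw_nat_finite[of "B P"] by (auto simp: atLeast0LessThan B_def)
  then obtain g where g: "\<And>P. bij_betw (g P) {..<card (B P)} (B P)" by metis
  define J where "J = (SIGMA P:\<Gamma>. {..<card (B P)})"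
  have gB: "g P j \<in> B P" if "j < card (B P)" for P j
    using g[of P] that by (auto dest: bij_betwE)
  have bij: "bij_betw (\<lambda>(P, j). g P j) J {..<k}"
  proof (rule bij_betw_imageI)
    show "inj_on (\<lambda>(P, j). g P j) J"
    proof (rule inj_onI, clarify)
      fix P j Q l assume *: "(P, j) \<in> J" "(Q, l) \<in> J" "g P j = g Q l"
      then have jl: "j < card (B P)" "l < card (B Q)" by (auto simp: J_def)
      then have "P = Q" using gB[of j P] gB[of l Q] * by (auto simp: B_def)
      with * jl g[of P] show "P = Q \<and> j = l" by (auto simp: bij_betw_def inj_on_def)
    qed
    show "(\<lambda>(P, j). g P j) ` J = {..<k}"
    proof
      show "(\<lambda>(P, j). g P j) ` J \<subseteq> {..<k}"
        using gB by (fastforce simp: J_def B_def)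
      show "{..<k} \<subseteq> (\<lambda>(P, j). g P j) ` J"
      proof
        fix i assume i: "i \<in> {..<k}"
        then have "i \<in> B (L i)" by (simp add: B_def)
        then obtain j where "j < card (B (L i))" "i = g (L i) j"
          using g[of "L i"] by (auto simp: bij_betw_def)
        then show "i \<in> (\<lambda>(P, j). g P j) ` J"
          using i L by (auto simp: J_def intro!: image_eqI[of _ _ "(L i, j)"])
      qed
    qed
  qed
  have "module_isomorphic R (direct_sum_module {..<k} L) (direct_sum_module J fst)"
  proof (rule direct_sum_module_reindex[OF bij])
    fix j assume "j \<in> J"
    then have "(case j of (P, i) \<Rightarrow> g P i) \<in> B (fst j)" using gB by (auto simp: J_def)
    then show "module_isomorphic R (L (case j of (P, i) \<Rightarrow> g P i)) (fst j)"
      by (auto simp: B_def module_isomorphic_refl)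
  qed
  then show ?thesis unfolding J_def by (intro exI[of _ "\<lambda>P. card (B P)"])
qed

section \<open>Direct summands as images of idempotents\<close>

context module
begin

definition image_module :: "('c \<Rightarrow> 'c) \<Rightarrow> ('a, 'c, 'd) module_scheme" where
  "image_module f = M\<lparr>carrier := f ` carrier M\<rparr>"

lemma image_module_simps [simp]:
  "carrier (image_module f) = f ` carrier M" "add (image_module f) = add M"
  "zero (image_module f) = \<zero>\<^bsub>M\<^esub>" "smult (image_module f) = smult M"
  by (simp_all add: image_module_def)

lemma module_image: "f \<in> carrier S \<Longrightarrow> module R (image_module f)"
  using submodule.submodule_is_module[OF submodule_image module_axioms] by (simp add: image_module_def)

lemma finsum_image_module:
  assumes f: "f \<in> carrier S" and h: "h \<in> A \<rightarrow> f ` carrier M"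
  shows "(\<Oplus>\<^bsub>image_module f\<^esub>a\<in>A. h a) = (\<Oplus>\<^bsub>M\<^esub>a\<in>A. h a)"
proof -
  interpret I: module R "image_module f" by (rule module_image[OF f])
  have sub: "f ` carrier M \<subseteq> carrier M" using f endo_closed by auto
  show ?thesis using h
  proof (induction A rule: infinite_finite_induct)
    case (insert a A)
    then have ha: "h a \<in> f ` carrier M" "h \<in> A \<rightarrow> f ` carrier M" by auto
    have "(\<Oplus>\<^bsub>image_module f\<^esub>a\<in>insert a A. h a) = h a \<oplus>\<^bsub>M\<^esub> (\<Oplus>\<^bsub>image_module f\<^esub>a\<in>A. h a)"
      using insert.hyps ha by (subst I.M.finsum_insert) auto
    also have "\<dots> = h a \<oplus>\<^bsub>M\<^esub> (\<Oplus>\<^bsub>M\<^esub>a\<in>A. h a)" using insert.IH[OF ha(2)] by simp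
    also have "\<dots> = (\<Oplus>\<^bsub>M\<^esub>a\<in>insert a A. h a)"
      using insert.hyps ha sub by (intro M.finsum_insert[symmetric]) auto
    finally show ?case .
  qed (auto simp: I.M.finsum_infinite)
qed

lemma fg_module_image:
  assumes f: "f \<in> idempotents S" "fg_image f"
  shows "fg_module R (image_module f)"
  unfolding fg_module_def
proof (intro conjI)
  have fc: "f \<in> carrier S" using f by (auto simp: idempotents_def)
  have ff: "f (f z) = f z" if "z \<in> carrier M" for z
    using f that by (auto simp: idempotents_def) (metis endo_mult)
  show "module R (image_module f)" by (rule module_image[OF fc])
  obtain X where X: "finite X" "X \<subseteq> f ` carrier M"
    "\<And>z. z \<in> carrier M \<Longrightarrow> \<exists>c\<in>X \<rightarrow> carrier R. f z = (\<Oplus>\<^bsub>M\<^esub>x\<in>X. c x \<odot>\<^bsub>M\<^esub> x)"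
    using f(2) unfolding fg_image_def by blast
  have "\<exists>c\<in>X \<rightarrow> carrier R. y = (\<Oplus>\<^bsub>image_module f\<^esub>x\<in>X. c x \<odot>\<^bsub>image_module f\<^esub> x)"
    if y: "y \<in> carrier (image_module f)" for y
  proof -
    obtain z where z: "z \<in> carrier M" "y = f z" using y by auto
    obtain c where c: "c \<in> X \<rightarrow> carrier R" "f z = (\<Oplus>\<^bsub>M\<^esub>x\<in>X. c x \<odot>\<^bsub>M\<^esub> x)" using X(3)[OF z(1)] by blast
    have "(\<lambda>x. c x \<odot>\<^bsub>M\<^esub> x) \<in> X \<rightarrow> f ` carrier M"
      using c(1) X(2) by (auto intro!: submoduleE(4)[OF submodule_image[OF fc]])
    then have "y = (\<Oplus>\<^bsub>image_module f\<^esub>x\<in>X. c x \<odot>\<^bsub>image_module f\<^esub> x)"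
      using finsum_image_module[OF fc, of "\<lambda>x. c x \<odot>\<^bsub>M\<^esub> x" X] c(2) z(2) by simp
    then show ?thesis using c(1) by blast
  qed
  then show "\<exists>A. finite A \<and> A \<subseteq> carrier (image_module f) \<and> (\<forall>x\<in>carrier (image_module f).
      \<exists>c\<in>A \<rightarrow> carrier R. x = (\<Oplus>\<^bsub>image_module f\<^esub>a\<in>A. c a \<odot>\<^bsub>image_module f\<^esub> a))"
    using X(1,2) by (intro exI[of _ X]) auto
qed

lemma equivalent_idempotents_isomorphic:
  assumes "equivalent_idempotents S e f" and e: "e \<in> idempotents S" and f: "f \<in> idempotents S"
  shows "module_isomorphic R (image_module e) (image_module f)"
proof -
  obtain a b where ab: "a \<in> carrier S" "b \<in> carrier S"
    and eqs: "f \<otimes>\<^bsub>S\<^esub> a = a" "e \<otimes>\<^bsub>S\<^esub> b = b" "b \<otimes>\<^bsub>S\<^esub> a = e" "a \<otimes>\<^bsub>S\<^esub> b = f"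
    using assms(1) unfolding equivalent_idempotents_def by blast
  have ef: "e \<in> carrier S" "e \<otimes>\<^bsub>S\<^esub> e = e" "f \<in> carrier S" "f \<otimes>\<^bsub>S\<^esub> f = f"
    using e f by (auto simp: idempotents_def)
  have app: "f (a z) = a z" "e (b z) = b z" "b (a z) = e z" "a (b z) = f z" "e (e z) = e z" "f (f z) = f z"
    if "z \<in> carrier M" for z using that eqs ef by (metis endo_mult)+
  note cl = endo_closed[OF ab(1)] endo_closed[OF ab(2)] endo_closed[OF ef(1)] endo_closed[OF ef(3)]
  show ?thesis
  proof (rule module_isomorphicI)
    have "a z \<in> f ` carrier M" if "z \<in> carrier M" for z using app(1)[OF that] cl(1)[OF that] by (metis imageI)
    then show "linear_map R (image_module e) (image_module f) a"
      using cl by (auto simp: linear_map_def endo_add[OF ab(1)] endo_smult[OF ab(1)])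
    show "b y \<in> carrier (image_module e)" if "y \<in> carrier (image_module f)" for y
    proof -
      have "y \<in> carrier M" using that cl(4) by auto
      then show ?thesis using app(2)[of y] cl(2)[of y] by (metis image_eqI image_module_simps(1))
    qed
    show "b (a x) = x" if "x \<in> carrier (image_module e)" for x using that app cl by auto
    show "a (b y) = y" if "y \<in> carrier (image_module f)" for y using that app cl by auto
  qed
qed

text \<open>The isomorphism sends \<open>z\<close> to the family of its components \<open>a z\<close>; its inverse adds up the components.\<close>
lemma orthogonal_sum_isomorphic:
  assumes A: "orthogonal_idempotents S A" and e: "(\<Oplus>\<^bsub>S\<^esub>a\<in>A. a) = e"
  shows "module_isomorphic R (image_module e) (direct_sum_module A image_module)"
proof -
  have fin: "finite A" and Ac: "\<And>a. a \<in> A \<Longrightarrow> a \<in> carrier S"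
    and idem: "\<And>a z. a \<in> A \<Longrightarrow> z \<in> carrier M \<Longrightarrow> a (a z) = a z"
    and orth: "\<And>a b z. a \<in> A \<Longrightarrow> b \<in> A \<Longrightarrow> a \<noteq> b \<Longrightarrow> z \<in> carrier M \<Longrightarrow> a (b z) = \<zero>\<^bsub>M\<^esub>"
  proof -
    show "finite A" using A by (simp add: orthogonal_idempotents_def)
    show Ac: "a \<in> carrier S" if "a \<in> A" for a using that A by (auto simp: orthogonal_idempotents_def idempotents_def)
    show "a (a z) = a z" if "a \<in> A" "z \<in> carrier M" for a z
    proof -
      have "a \<otimes>\<^bsub>S\<^esub> a = a" using that A by (auto simp: orthogonal_idempotents_def idempotents_def)
      then show ?thesis using that(2) by (metis endo_mult)
    qed
    show "a (b z) = \<zero>\<^bsub>M\<^esub>" if "a \<in> A" "b \<in> A" "a \<noteq> b" "z \<in> carrier M" for a b z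
    proof -
      have "a \<otimes>\<^bsub>S\<^esub> b = \<zero>\<^bsub>S\<^esub>" using that A by (simp add: orthogonal_idempotents_def)
      then show ?thesis using that(4) by (metis endo_mult endo_zero)
    qed
  qed
  note Acl = endo_closed[OF Ac]
  have ec: "e \<in> carrier S" unfolding e[symmetric] using Ac by (intro S.finsum_closed) auto
  have eapp: "e z = (\<Oplus>\<^bsub>M\<^esub>a\<in>A. a z)" if "z \<in> carrier M" for z
    unfolding e[symmetric] using Ac that by (intro endo_finsum) auto
  have ae: "a (e z) = a z" "e (a z) = a z" if "a \<in> A" "z \<in> carrier M" for a z
    using S.orthogonal_sum_absorbs[OF A that(1)] that(2) unfolding e by (metis endo_mult)+
  have pi: "(\<Pi>\<^sub>E a\<in>A. a ` carrier M) = carrier (direct_sum_module A image_module)"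
    by (simp add: direct_sum_module_def)
  define F where "F z = (\<lambda>a\<in>A. a z)" for z
  define G where "G y = (\<Oplus>\<^bsub>M\<^esub>a\<in>A. y a)" for y :: "('c \<Rightarrow> 'c) \<Rightarrow> 'c"
  have ya: "y a \<in> carrier M" "a (y a) = y a" "b \<in> A \<Longrightarrow> b \<noteq> a \<Longrightarrow> b (y a) = \<zero>\<^bsub>M\<^esub>"
    if y: "y \<in> carrier (direct_sum_module A image_module)" and a: "a \<in> A" for y a b
  proof -
    have "y a \<in> a ` carrier M" using y a by (auto simp: pi[symmetric])
    then obtain z where z: "z \<in> carrier M" "y a = a z" by blast
    show "y a \<in> carrier M" "a (y a) = y a" using z a Acl idem by auto
    show "b \<in> A \<Longrightarrow> b \<noteq> a \<Longrightarrow> b (y a) = \<zero>\<^bsub>M\<^esub>" using z a orth by simp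
  qed
  show ?thesis
  proof (rule module_isomorphicI[where f = F and g = G])
    show "linear_map R (image_module e) (direct_sum_module A image_module) F"
    proof -
      have "z \<in> carrier M" if "z \<in> e ` carrier M" for z using that endo_closed[OF ec] by auto
      then show ?thesis using Ac Acl
        by (auto simp: linear_map_def direct_sum_module_def F_def endo_add endo_smult intro!: restrict_ext)
    qed
    show "G (F z) = z" if z: "z \<in> carrier (image_module e)" for z
    proof -
      obtain w where w: "w \<in> carrier M" "z = e w" using z by auto
      have "G (F z) = (\<Oplus>\<^bsub>M\<^esub>a\<in>A. a w)" unfolding G_def
        using w ae Acl by (intro M.finsum_cong') (auto simp: F_def)
      then show ?thesis using eapp w by simp
    qed
    fix y assume y: "y \<in> carrier (direct_sum_module A image_module)"
    have yc: "y \<in> A \<rightarrow> carrier M" using ya(1)[OF y] by blast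
    have Gc: "G y \<in> carrier M" unfolding G_def by (rule M.finsum_closed[OF yc])
    have aG: "a (G y) = y a" if a: "a \<in> A" for a
    proof -
      have "a (G y) = (\<Oplus>\<^bsub>M\<^esub>b\<in>A. a (y b))" unfolding G_def by (rule endo_app_finsum[OF Ac[OF a] yc])
      also have "\<dots> = (\<Oplus>\<^bsub>M\<^esub>b\<in>A. if a = b then y b else \<zero>\<^bsub>M\<^esub>)"
      proof (rule M.finsum_cong')
        show "a (y b) = (if a = b then y b else \<zero>\<^bsub>M\<^esub>)" if "b \<in> A" for b
          using ya(2)[OF y a] ya(3)[OF y that a] by auto
      qed (use yc in auto)
      also have "\<dots> = y a" by (rule M.add.finprod_singleton[OF a fin yc])
      finally show ?thesis .
    qed
    have "e (G y) = (\<Oplus>\<^bsub>M\<^esub>a\<in>A. y a)"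
      unfolding eapp[OF Gc] using aG yc by (intro M.finsum_cong') auto
    then have "e (G y) = G y" by (simp add: G_def)
    then show "G y \<in> carrier (image_module e)" using Gc by (metis image_eqI image_module_simps(1))
    show "F (G y) = y"
    proof
      fix a show "F (G y) a = y a"
        using aG y by (cases "a \<in> A") (auto simp: F_def pi[symmetric] intro: PiE_arb[symmetric])
    qed
  qed
qed

text \<open>A map out of the module is cut down to its carrier to become an element of the endomorphism ring.\<close>
definition to_endo :: "('c \<Rightarrow> 'c) \<Rightarrow> 'c \<Rightarrow> 'c" where
  "to_endo f = (\<lambda>z\<in>carrier M. f z)"

lemma to_endo_closed: "linear_map R M M f \<Longrightarrow> to_endo f \<in> carrier S"
  by (rule endoI) (auto simp: to_endo_def linear_map_def Pi_iff)

lemma to_endo_apply [simp]: "z \<in> carrier M \<Longrightarrow> to_endo f z = f z"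
  by (simp add: to_endo_def)

lemma retract_idempotent:
  assumes a: "linear_map R N M \<alpha>" and b: "linear_map R M N \<beta>" and ba: "\<And>x. x \<in> carrier N \<Longrightarrow> \<beta> (\<alpha> x) = x"
  shows "to_endo (\<lambda>z. \<alpha> (\<beta> z)) \<in> idempotents S"
proof -
  have u: "to_endo (\<lambda>z. \<alpha> (\<beta> z)) \<in> carrier S" by (rule to_endo_closed[OF linear_map_comp[OF b a]])
  moreover have "to_endo (\<lambda>z. \<alpha> (\<beta> z)) \<otimes>\<^bsub>S\<^esub> to_endo (\<lambda>z. \<alpha> (\<beta> z)) = to_endo (\<lambda>z. \<alpha> (\<beta> z))"
    using u ba linear_mapD(1)[OF a] linear_mapD(1)[OF b] by (intro endo_ext) auto
  ultimately show ?thesis by (simp add: idempotents_def)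
qed

lemma retract_fg_image:
  assumes N: "fg_module R N"
    and a: "linear_map R N M \<alpha>" and b: "linear_map R M N \<beta>" and ba: "\<And>x. x \<in> carrier N \<Longrightarrow> \<beta> (\<alpha> x) = x"
  shows "fg_image (to_endo (\<lambda>z. \<alpha> (\<beta> z)))"
proof -
  obtain A where A: "finite A" "A \<subseteq> carrier N"
    "\<And>x. x \<in> carrier N \<Longrightarrow> \<exists>c\<in>A \<rightarrow> carrier R. x = (\<Oplus>\<^bsub>N\<^esub>a\<in>A. c a \<odot>\<^bsub>N\<^esub> a)"
    using N unfolding fg_module_def by blast
  interpret N: module R N using N by (simp add: fg_module_def)
  note al = linear_mapD[OF a] and bl = linear_mapD[OF b]
  have aA: "\<alpha> ` A \<subseteq> carrier M" using A(2) al(1) by auto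
  have sub: "submodule (span (\<alpha> ` A)) R M" using A(1) aA by (intro submodule_span) auto
  have "\<alpha> x \<in> span (\<alpha> ` A)" if x: "x \<in> carrier N" for x
  proof -
    obtain c where c: "c \<in> A \<rightarrow> carrier R" "x = (\<Oplus>\<^bsub>N\<^esub>a\<in>A. c a \<odot>\<^bsub>N\<^esub> a)" using A(3)[OF x] by blast
    have "\<alpha> x = (\<Oplus>\<^bsub>M\<^esub>a\<in>A. \<alpha> (c a \<odot>\<^bsub>N\<^esub> a))"
      unfolding c(2) using c(1) A(2)
      by (intro linear_map_finsum[OF N.module_axioms module_axioms a]) auto
    also have "\<dots> \<in> span (\<alpha> ` A)"
    proof (rule submodule_finsum[OF sub], rule Pi_I)
      fix y assume y: "y \<in> A"
      then have "\<alpha> (c y \<odot>\<^bsub>N\<^esub> y) = c y \<odot>\<^bsub>M\<^esub> \<alpha> y" using c(1) A(2) by (intro al(3)) auto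
      moreover have "\<alpha> y \<in> span (\<alpha> ` A)" using y A(1) aA by (intro span_superset) auto
      moreover have "c y \<in> carrier R" using c(1) y by auto
      ultimately show "\<alpha> (c y \<odot>\<^bsub>N\<^esub> y) \<in> span (\<alpha> ` A)" using submoduleE(4)[OF sub] by simp
    qed
    finally show ?thesis .
  qed
  moreover have "\<alpha> ` A \<subseteq> to_endo (\<lambda>z. \<alpha> (\<beta> z)) ` carrier M"
  proof
    fix y assume "y \<in> \<alpha> ` A"
    then obtain x where x: "x \<in> carrier N" "y = \<alpha> x" using A(2) by auto
    then have "y = to_endo (\<lambda>z. \<alpha> (\<beta> z)) (\<alpha> x)" using ba al(1) by simp
    then show "y \<in> to_endo (\<lambda>z. \<alpha> (\<beta> z)) ` carrier M" using al(1)[OF x(1)] by (rule image_eqI)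
  qed
  ultimately show ?thesis using A(1) bl(1) unfolding fg_image_iff_span
    by (intro exI[of _ "\<alpha> ` A"]) auto
qed

text \<open>The condition \<open>e f\<^sub>i = f\<^sub>i\<close> puts the generators of the images of all \<open>f\<^sub>i\<close> into the image of \<open>e\<close>.\<close>
lemma fg_image_finsum:
  assumes fin: "finite I" and f: "\<And>i. i \<in> I \<Longrightarrow> f i \<in> carrier S" "\<And>i. i \<in> I \<Longrightarrow> fg_image (f i)"
    and e: "e = (\<Oplus>\<^bsub>S\<^esub>i\<in>I. f i)" and ef: "\<And>i. i \<in> I \<Longrightarrow> e \<otimes>\<^bsub>S\<^esub> f i = f i"
  shows "fg_image e"
proof -
  have "\<forall>i\<in>I. \<exists>X. finite X \<and> X \<subseteq> f i ` carrier M \<and> (\<forall>z\<in>carrier M. f i z \<in> span X)"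
    using f(2) by (simp add: fg_image_iff_span)
  from bchoice[OF this] obtain X where X: "\<And>i. i \<in> I \<Longrightarrow> finite (X i)"
    "\<And>i. i \<in> I \<Longrightarrow> X i \<subseteq> f i ` carrier M" "\<And>i z. i \<in> I \<Longrightarrow> z \<in> carrier M \<Longrightarrow> f i z \<in> span (X i)" by blast
  let ?Y = "\<Union>i\<in>I. X i"
  have Xc: "X i \<subseteq> carrier M" if "i \<in> I" for i using X(2)[OF that] f(1)[OF that] endo_closed by auto
  have Y: "finite ?Y" "?Y \<subseteq> carrier M" using fin X(1) Xc by auto
  have sub: "submodule (span ?Y) R M" by (rule submodule_span[OF Y])
  have "e z \<in> span ?Y" if z: "z \<in> carrier M" for z
  proof -
    have "e z = (\<Oplus>\<^bsub>M\<^esub>i\<in>I. f i z)" unfolding e using f(1) z by (intro endo_finsum) auto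
    also have "\<dots> \<in> span ?Y"
    proof (rule submodule_finsum[OF sub], rule Pi_I)
      fix i assume i: "i \<in> I"
      have "X i \<subseteq> span ?Y" using i span_superset[OF Y] by blast
      then show "f i z \<in> span ?Y" using span_subset[OF sub] X(3)[OF i z] by blast
    qed
    finally show ?thesis .
  qed
  moreover have "?Y \<subseteq> e ` carrier M"
  proof
    fix y assume "y \<in> ?Y"
    then obtain i z where i: "i \<in> I" "z \<in> carrier M" "y = f i z" using X(2) by blast
    have "y = e y" using ef[OF i(1)] i by (metis endo_mult)
    then show "y \<in> e ` carrier M" using i endo_closed[OF f(1)] by (metis image_eqI)
  qed
  ultimately show ?thesis using Y(1) by (auto simp: fg_image_iff_span)
qed

end

section \<open>All Frobenius pushforwards at once\<close>

text \<open>Positive exponents only: the component with index \<open>n\<close> is \<open>F\<^sub>*\<^sup>n\<^sup>+\<^sup>1(M)\<close>.\<close>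
definition frobenius_product ::
  "('a, 'r) ring_scheme \<Rightarrow> nat \<Rightarrow> ('a, 'b, 'm) module_scheme \<Rightarrow> ('a, nat \<Rightarrow> 'b) module" where
  "frobenius_product R p M = direct_sum_module UNIV (\<lambda>n. frobenius_pushforward R p (Suc n) M)"

locale frobenius_tower =
  fixes R :: "('a, 'r) ring_scheme" (structure) and M :: "('a, 'b, 'm) module_scheme" and p :: nat and \<mm>
  assumes mm: "ideal \<mm> R" "\<one> \<notin> \<mm>" "carrier R - \<mm> \<subseteq> Units R"
    and module_pushforward: "\<And>n. module R (frobenius_pushforward R p (Suc n) M)"
begin

abbreviation F where "F n \<equiv> frobenius_pushforward R p (Suc n) M"
abbreviation Z where "Z \<equiv> frobenius_product R p M"

lemma cring_R: "cring R" using module_pushforward[of 0] by (simp add: module_def)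

lemma module_Z: "module R Z"
  unfolding frobenius_product_def by (rule module_direct_sum[OF cring_R module_pushforward])

sublocale Z: local_module R Z \<mm>
  using module_Z mm by (simp add: local_module_def local_module_axioms_def)

abbreviation S where "S \<equiv> endo_ring R Z"

definition inj where "inj n = summand_inj UNIV F n"

definition proj :: "nat \<Rightarrow> (nat \<Rightarrow> 'b) \<Rightarrow> 'b" where "proj n z = z n"

lemma inj_linear: "linear_map R (F n) Z (inj n)"
  unfolding inj_def frobenius_product_def by (rule summand_inj_linear) (auto simp: module_pushforward)

lemma proj_linear: "linear_map R Z (F n) (proj n)"
  unfolding frobenius_product_def proj_def[abs_def] by (rule summand_proj_linear) simp

lemma proj_inj [simp]: "proj n (inj n x) = x"
  by (simp add: inj_def summand_inj_def proj_def)

lemma F_simps [simp]: "carrier (F n) = carrier M" "add (F n) = add M" "zero (F n) = zero M"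
  "smult (F n) r x = (r [^] (p ^ Suc n)) \<odot>\<^bsub>M\<^esub> x"
  by (simp_all add: frobenius_pushforward_def)

lemmas inj_closed = linear_mapD(1)[OF inj_linear, unfolded F_simps]
  and proj_closed = linear_mapD(1)[OF proj_linear, unfolded F_simps]

definition e where "e n = Z.to_endo (\<lambda>z. inj n (proj n z))"

lemma e_idempotent: "e n \<in> idempotents S"
  unfolding e_def by (rule Z.retract_idempotent[OF inj_linear proj_linear]) simp

lemma e_closed: "e n \<in> carrier S" using e_idempotent by (simp add: idempotents_def)

lemma e_apply: "z \<in> carrier Z \<Longrightarrow> e n z = inj n (proj n z)" by (simp add: e_def)

lemma corner_e_apply:
  assumes "f \<in> corner S (e n)" "z \<in> carrier Z"
  shows "inj n (proj n (f z)) = f z" "f (inj n (proj n z)) = f z"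
proof -
  have f: "f \<in> carrier S" "e n \<otimes>\<^bsub>S\<^esub> f = f" "f \<otimes>\<^bsub>S\<^esub> e n = f" using assms by (auto simp: corner_def)
  show "inj n (proj n (f z)) = f z"
    using arg_cong[OF f(2), of "\<lambda>g. g z"] assms(2) Z.endo_closed[OF f(1)] by (simp add: e_apply)
  show "f (inj n (proj n z)) = f z"
    using arg_cong[OF f(3), of "\<lambda>g. g z"] assms(2) by (simp add: e_apply)
qed

text \<open>This is functoriality of the pushforward: a map commuting with the \<open>p\<^sup>n\<^sup>+\<^sup>1\<close>-th powers of all
scalars commutes with their \<open>p\<^sup>n\<^sup>+\<^sup>2\<close>-th powers, which are \<open>p\<^sup>n\<^sup>+\<^sup>1\<close>-th powers as well.\<close>
lemma pushforward_linear:
  assumes "linear_map R (F n) (F n) g"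
  shows "linear_map R (F (Suc n)) (F (Suc n)) g"
proof -
  have "g ((r [^] (p ^ Suc (Suc n))) \<odot>\<^bsub>M\<^esub> x) = (r [^] (p ^ Suc (Suc n))) \<odot>\<^bsub>M\<^esub> g x"
    if r: "r \<in> carrier R" and x: "x \<in> carrier M" for r x
  proof -
    have "r [^] (p ^ Suc (Suc n)) = (r [^] p) [^] (p ^ Suc n)"
      using r by (simp add: Z.R.nat_pow_pow)
    then show ?thesis using linear_mapD(3)[OF assms, of "r [^] p" x] r x by simp
  qed
  then show ?thesis using assms by (simp add: linear_map_def)
qed

text \<open>The Frobenius pushforward of an endomorphism: the same additive map, one step further up.\<close>
definition shift where
  "shift n f = Z.to_endo (\<lambda>z. inj (Suc n) (proj n (f (inj n (proj (Suc n) z)))))"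

lemma shift_apply: "z \<in> carrier Z \<Longrightarrow> shift n f z = inj (Suc n) (proj n (f (inj n (proj (Suc n) z))))"
  by (simp add: shift_def)

lemma shift_closed:
  assumes f: "f \<in> carrier S"
  shows "shift n f \<in> carrier S"
proof -
  have "linear_map R Z Z f"
    using Z.endo_closed[OF f] Z.endo_add[OF f] Z.endo_smult[OF f] by (auto simp: linear_map_def)
  then have "linear_map R (F n) (F n) (\<lambda>x. proj n (f (inj n x)))"
    by (rule linear_map_comp[OF linear_map_comp[OF inj_linear] proj_linear])
  then have "linear_map R (F (Suc n)) (F (Suc n)) (\<lambda>x. proj n (f (inj n x)))" by (rule pushforward_linear)
  from linear_map_comp[OF proj_linear linear_map_comp[OF this inj_linear]]
  show ?thesis unfolding shift_def by (rule Z.to_endo_closed)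
qed

lemma shift_in_corner:
  assumes f: "f \<in> carrier S"
  shows "shift n f \<in> corner S (e (Suc n))"
proof -
  note sc = shift_closed[OF f, of n]
  have fc: "proj n (f (inj n (proj (Suc n) z))) \<in> carrier M" if "z \<in> carrier Z" for z
    by (rule proj_closed[OF Z.endo_closed[OF f inj_closed[OF proj_closed[OF that]]]])
  have "e (Suc n) \<otimes>\<^bsub>S\<^esub> shift n f = shift n f"
    using sc e_closed fc by (intro Z.endo_ext) (auto simp: e_apply shift_apply inj_closed)
  moreover have "shift n f \<otimes>\<^bsub>S\<^esub> e (Suc n) = shift n f"
    using sc e_closed by (intro Z.endo_ext) (auto simp: e_apply shift_apply inj_closed proj_closed)
  ultimately show ?thesis using sc by (simp add: corner_def)
qed

lemma shift_idempotent:
  assumes f: "f \<in> idempotents S" "f \<in> corner S (e n)"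
  shows "shift n f \<in> idempotents S"
proof -
  have fc: "f \<in> carrier S" "f \<otimes>\<^bsub>S\<^esub> f = f" using f by (auto simp: idempotents_def)
  note sc = shift_closed[OF fc(1), of n]
  have "shift n f \<otimes>\<^bsub>S\<^esub> shift n f = shift n f"
  proof (rule Z.endo_ext)
    fix z assume z: "z \<in> carrier Z"
    let ?w = "inj n (proj (Suc n) z)"
    have w: "?w \<in> carrier Z" by (rule inj_closed[OF proj_closed[OF z]])
    have fw: "f ?w \<in> carrier Z" by (rule Z.endo_closed[OF fc(1) w])
    have "shift n f (shift n f z) = inj (Suc n) (proj n (f (inj n (proj n (f ?w)))))"
      using z sc by (simp add: shift_apply inj_closed proj_closed fw)
    also have "inj n (proj n (f ?w)) = f ?w" by (rule corner_e_apply(1)[OF f(2) w])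
    also have "f (f ?w) = f ?w" using arg_cong[OF fc(2), of "\<lambda>g. g ?w"] w by simp
    finally show "(shift n f \<otimes>\<^bsub>S\<^esub> shift n f) z = shift n f z" using z by (simp add: shift_apply)
  qed (use sc in auto)
  then show ?thesis using sc by (simp add: idempotents_def)
qed

text \<open>On the underlying additive group nothing happens: the isomorphism moves the component with index \<open>n\<close>
to the index \<open>n + 1\<close>.\<close>
lemma pushforward_image_isomorphic_shift:
  assumes f: "f \<in> idempotents S" "f \<in> corner S (e n)"
  shows "module_isomorphic R (frobenius_pushforward R p 1 (Z.image_module f)) (Z.image_module (shift n f))"
proof -
  have fc: "f \<in> carrier S" "f \<otimes>\<^bsub>S\<^esub> f = f" using f by (auto simp: idempotents_def)
  have ff: "f (f z) = f z" if "z \<in> carrier Z" for z using arg_cong[OF fc(2), of "\<lambda>g. g z"] that by simp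
  have Fim [simp]: "carrier (frobenius_pushforward R p 1 (Z.image_module f)) = f ` carrier Z"
    "add (frobenius_pushforward R p 1 (Z.image_module f)) = add Z"
    "smult (frobenius_pushforward R p 1 (Z.image_module f)) r x = (r [^] p) \<odot>\<^bsub>Z\<^esub> x" for r x
    by (simp_all add: frobenius_pushforward_def)
  have fZ: "z \<in> carrier Z" "f z = z" "inj n (proj n z) = z" if z: "z \<in> f ` carrier Z" for z
  proof -
    obtain w where w: "w \<in> carrier Z" "z = f w" using z by blast
    show "z \<in> carrier Z" "f z = z" "inj n (proj n z) = z"
      using w ff Z.endo_closed[OF fc(1)] corner_e_apply(1)[OF f(2)] by auto
  qed
  have up: "inj (Suc n) (proj n z) = shift n f (inj (Suc n) (proj n z))" if z: "z \<in> f ` carrier Z" for z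
    using fZ[OF z] by (simp add: shift_apply inj_closed proj_closed)
  show ?thesis
  proof (rule module_isomorphicI[where f = "\<lambda>z. inj (Suc n) (proj n z)" and g = "\<lambda>z. inj n (proj (Suc n) z)"])
    have sm: "inj (Suc n) (proj n ((r [^] p) \<odot>\<^bsub>Z\<^esub> z)) = r \<odot>\<^bsub>Z\<^esub> inj (Suc n) (proj n z)"
      if r: "r \<in> carrier R" and z: "z \<in> carrier Z" for r z
    proof -
      have "proj n ((r [^] p) \<odot>\<^bsub>Z\<^esub> z) = ((r [^] p) [^] (p ^ Suc n)) \<odot>\<^bsub>M\<^esub> proj n z"
        using linear_mapD(3)[OF proj_linear, of "r [^] p" z n] r z by simp
      also have "(r [^] p) [^] (p ^ Suc n) = r [^] (p ^ Suc (Suc n))" using r by (simp add: Z.R.nat_pow_pow)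
      finally show ?thesis
        using linear_mapD(3)[OF inj_linear, of r "proj n z" "Suc n"] r proj_closed[OF z] by simp
    qed
    show "linear_map R (frobenius_pushforward R p 1 (Z.image_module f)) (Z.image_module (shift n f))
        (\<lambda>z. inj (Suc n) (proj n z))"
      unfolding linear_map_def Fim Z.image_module_simps
    proof (intro conjI ballI Pi_I)
      fix x assume x: "x \<in> f ` carrier Z"
      show "inj (Suc n) (proj n x) \<in> shift n f ` carrier Z"
        using up[OF x] inj_closed[OF proj_closed[OF fZ(1)[OF x]]] by (metis image_eqI)
    next
      fix x y assume "x \<in> f ` carrier Z" "y \<in> f ` carrier Z"
      then have "x \<in> carrier Z" "y \<in> carrier Z" by (simp_all only: fZ(1))
      then show "inj (Suc n) (proj n (x \<oplus>\<^bsub>Z\<^esub> y)) = inj (Suc n) (proj n x) \<oplus>\<^bsub>Z\<^esub> inj (Suc n) (proj n y)"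
        using linear_mapD(2)[OF proj_linear, of x y n] linear_mapD(2)[OF inj_linear, of "proj n x" "Suc n" "proj n y"]
        by (simp add: proj_closed)
    next
      fix r x assume "r \<in> carrier R" "x \<in> f ` carrier Z"
      then show "inj (Suc n) (proj n ((r [^] p) \<odot>\<^bsub>Z\<^esub> x)) = r \<odot>\<^bsub>Z\<^esub> inj (Suc n) (proj n x)"
        using sm fZ(1) by blast
    qed
    show "inj n (proj (Suc n) z) \<in> carrier (frobenius_pushforward R p 1 (Z.image_module f))"
      "inj (Suc n) (proj n (inj n (proj (Suc n) z))) = z"
      if z: "z \<in> carrier (Z.image_module (shift n f))" for z
    proof -
      obtain w where w: "w \<in> carrier Z" "z = shift n f w" using z by auto
      let ?v = "f (inj n (proj (Suc n) w))"
      have v: "inj n (proj (Suc n) w) \<in> carrier Z" by (rule inj_closed[OF proj_closed[OF w(1)]])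
      then have vf: "?v \<in> f ` carrier Z" by blast
      have zz: "z = inj (Suc n) (proj n ?v)" using w by (simp add: shift_apply)
      then show "inj (Suc n) (proj n (inj n (proj (Suc n) z))) = z" by (simp only: proj_inj)
      show "inj n (proj (Suc n) z) \<in> carrier (frobenius_pushforward R p 1 (Z.image_module f))"
        using fZ(3)[OF vf] vf by (simp only: zz proj_inj Fim)
    qed
    show "inj n (proj (Suc n) (inj (Suc n) (proj n z))) = z"
      if "z \<in> carrier (frobenius_pushforward R p 1 (Z.image_module f))" for z
      using fZ(3)[of z] that by (simp only: Fim proj_inj)
  qed
qed

lemma pushforward_isomorphic_image_e: "module_isomorphic R (F n) (Z.image_module (e n))"
proof (rule module_isomorphicI[where f = "inj n" and g = "proj n"])
  have "inj n x \<in> e n ` carrier Z" if "x \<in> carrier M" for x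
    using inj_closed[OF that] e_apply[OF inj_closed[OF that], of n] by (metis image_eqI proj_inj)
  then show "linear_map R (F n) (Z.image_module (e n)) (inj n)"
    using inj_linear[of n] by (auto simp: linear_map_def)
  fix z assume "z \<in> carrier (Z.image_module (e n))"
  then obtain w where "w \<in> carrier Z" "z = inj n (proj n w)" by (auto simp: e_apply)
  then show "proj n z \<in> carrier (F n)" "inj n (proj n z) = z" by (auto simp: proj_closed)
qed simp

definition primitive_summands where
  "primitive_summands = {q. primitive_idempotent S q \<and> (\<exists>n. q \<in> corner S (e n))}"

lemma summand_decomposition:
  assumes fg: "Z.fg_image (e n)" and f: "f \<in> idempotents S" "f \<in> corner S (e n)"
    and reps: "\<And>q. q \<in> primitive_summands \<Longrightarrow> \<exists>h\<in>H. equivalent_idempotents S q h"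
    and H: "H \<subseteq> primitive_summands"
  shows "\<exists>(k::nat) L. L \<in> {..<k} \<rightarrow> Z.image_module ` H \<and>
     module_isomorphic R (Z.image_module f) (direct_sum_module {..<k} L)"
proof -
  have "Z.fg_image f" using Z.fg_image_corner[OF fg e_closed] f(2) by (auto simp: corner_def)
  from Z.fg_idempotent_decomposition[OF f(1) this]
  obtain A where A: "orthogonal_idempotents S A" "(\<Oplus>\<^bsub>S\<^esub>a\<in>A. a) = f" "\<And>a. a \<in> A \<Longrightarrow> primitive_idempotent S a"
    by blast
  have Aprim: "a \<in> primitive_summands" if a: "a \<in> A" for a
  proof -
    have "a \<in> corner S f" using Z.S.orthogonal_sum_in_corner[OF A(1)] A(2) a by auto
    then have "a \<in> corner S (e n)" by (rule Z.S.corner_trans[OF f(2) _ e_closed])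
    then show ?thesis using A(3)[OF a] by (auto simp: primitive_summands_def)
  qed
  then have "\<forall>a\<in>A. \<exists>h. h \<in> H \<and> equivalent_idempotents S a h" using reps by blast
  from bchoice[OF this] obtain rep where rep: "\<And>a. a \<in> A \<Longrightarrow> rep a \<in> H"
    "\<And>a. a \<in> A \<Longrightarrow> equivalent_idempotents S a (rep a)" by blast
  have "finite A" using A(1) by (simp add: orthogonal_idempotents_def)
  then obtain g where g: "bij_betw g {..<card A} A"
    using ex_bij_betw_nat_finite[of A] by (auto simp: atLeast0LessThan)
  define L where "L i = Z.image_module (rep (g i))" for i
  have gA: "g i \<in> A" if "i < card A" for i using g that by (auto dest: bij_betwE)
  have "module_isomorphic R (direct_sum_module A Z.image_module) (direct_sum_module {..<card A} L)"
  proof (rule direct_sum_module_reindex[OF g])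
    fix i assume i: "i \<in> {..<card A}"
    then have a: "g i \<in> A" using gA by auto
    have "g i \<in> idempotents S" "rep (g i) \<in> idempotents S"
      using Aprim[OF a] rep(1)[OF a] H by (auto simp: primitive_summands_def primitive_idempotent_def)
    then show "module_isomorphic R (Z.image_module (g i)) (L i)"
      unfolding L_def using Z.equivalent_idempotents_isomorphic rep(2)[OF a] by blast
  qed
  with Z.orthogonal_sum_isomorphic[OF A(1,2)]
  have "module_isomorphic R (Z.image_module f) (direct_sum_module {..<card A} L)"
    by (rule module_isomorphic_trans)
  moreover have "L \<in> {..<card A} \<rightarrow> Z.image_module ` H" using rep(1) gA by (auto simp: L_def)
  ultimately show ?thesis by blast
qed

text \<open>The FFRT system consists of the images of representatives of the primitive idempotents below the
\<open>e n\<close>. It is closed under the pushforward because \<open>shift n\<close> sends an idempotent below \<open>e n\<close> to an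
idempotent below \<open>e (Suc n)\<close>, which decomposes again into primitive idempotents.\<close>
theorem system_of_primitive_summands:
  assumes U: "finite U" "\<And>u. u \<in> U \<Longrightarrow> u \<in> idempotents S \<and> Z.fg_image u"
    and fg: "\<And>n. Z.fg_image (e n)"
    and sum: "\<And>n. \<exists>(I :: 'i set) a u b. finite I \<and> a \<in> I \<rightarrow> carrier S \<and> b \<in> I \<rightarrow> carrier S \<and>
        u \<in> I \<rightarrow> U \<and> (\<Oplus>\<^bsub>S\<^esub>i\<in>I. a i \<otimes>\<^bsub>S\<^esub> u i \<otimes>\<^bsub>S\<^esub> b i) = e n"
  shows "has_FFRT_by_system R p M"
proof -
  have Uc: "u \<in> carrier S" if "u \<in> U" for u using U(2)[OF that] by (simp add: idempotents_def)
  have Qfg: "Z.fg_image q" if "q \<in> primitive_summands" for q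
    using that Z.fg_image_corner[OF fg e_closed] by (auto simp: primitive_summands_def corner_def)
  have "\<exists>H. finite H \<and> H \<subseteq> primitive_summands \<and> (\<forall>q\<in>primitive_summands. \<exists>h\<in>H. equivalent_idempotents S q h)"
  proof (rule Z.finitely_many_primitive_classes[OF U])
    fix q assume q: "q \<in> primitive_summands"
    show "primitive_idempotent S q \<and> Z.fg_image q" using q Qfg by (auto simp: primitive_summands_def)
    obtain n where n: "q \<in> corner S (e n)" using q by (auto simp: primitive_summands_def)
    have qc: "q \<in> carrier S" "q \<otimes>\<^bsub>S\<^esub> e n \<otimes>\<^bsub>S\<^esub> q = q"
      using n q by (auto simp: corner_def primitive_summands_def primitive_idempotent_def idempotents_def)
    obtain I :: "'i set" and a u b where I: "finite I" "a \<in> I \<rightarrow> carrier S" "b \<in> I \<rightarrow> carrier S"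
      "u \<in> I \<rightarrow> U" "(\<Oplus>\<^bsub>S\<^esub>i\<in>I. a i \<otimes>\<^bsub>S\<^esub> u i \<otimes>\<^bsub>S\<^esub> b i) = e n" using sum[of n] by blast
    have Ic: "a i \<in> carrier S" "b i \<in> carrier S" "u i \<in> carrier S" if "i \<in> I" for i
      using I(2-4) that Uc by auto
    have "q \<otimes>\<^bsub>S\<^esub> e n \<otimes>\<^bsub>S\<^esub> q = (\<Oplus>\<^bsub>S\<^esub>i\<in>I. q \<otimes>\<^bsub>S\<^esub> (a i \<otimes>\<^bsub>S\<^esub> u i \<otimes>\<^bsub>S\<^esub> b i)) \<otimes>\<^bsub>S\<^esub> q"
      unfolding I(5)[symmetric] using I(1) Ic qc(1) by (subst Z.S.finsum_rdistr) auto
    also have "\<dots> = (\<Oplus>\<^bsub>S\<^esub>i\<in>I. q \<otimes>\<^bsub>S\<^esub> (a i \<otimes>\<^bsub>S\<^esub> u i \<otimes>\<^bsub>S\<^esub> b i) \<otimes>\<^bsub>S\<^esub> q)"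
      using I(1) Ic qc(1) by (subst Z.S.finsum_ldistr) auto
    also have "\<dots> = (\<Oplus>\<^bsub>S\<^esub>i\<in>I. (q \<otimes>\<^bsub>S\<^esub> a i) \<otimes>\<^bsub>S\<^esub> u i \<otimes>\<^bsub>S\<^esub> (b i \<otimes>\<^bsub>S\<^esub> q))"
      using Ic qc(1) by (intro Z.S.add.finprod_cong') (auto simp: Z.S.m_assoc)
    finally have "(\<Oplus>\<^bsub>S\<^esub>i\<in>I. (q \<otimes>\<^bsub>S\<^esub> a i) \<otimes>\<^bsub>S\<^esub> u i \<otimes>\<^bsub>S\<^esub> (b i \<otimes>\<^bsub>S\<^esub> q)) = q" using qc(2) by simp
    then show "\<exists>(I :: 'i set) a u b. finite I \<and> a \<in> I \<rightarrow> carrier S \<and> b \<in> I \<rightarrow> carrier S \<and>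
        u \<in> I \<rightarrow> U \<and> (\<Oplus>\<^bsub>S\<^esub>i\<in>I. a i \<otimes>\<^bsub>S\<^esub> u i \<otimes>\<^bsub>S\<^esub> b i) = q"
      using I(1,4) Ic qc(1)
      by (intro exI[of _ I] exI[of _ "\<lambda>i. q \<otimes>\<^bsub>S\<^esub> a i"] exI[of _ u] exI[of _ "\<lambda>i. b i \<otimes>\<^bsub>S\<^esub> q"]) auto
  qed
  then obtain H where H: "finite H" "H \<subseteq> primitive_summands"
    "\<And>q. q \<in> primitive_summands \<Longrightarrow> \<exists>h\<in>H. equivalent_idempotents S q h" by blast
  let ?\<Gamma> = "Z.image_module ` H"
  have Hi: "h \<in> idempotents S" if "h \<in> H" for h
    using that H(2) by (auto simp: primitive_summands_def primitive_idempotent_def)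
  have fin: "finite ?\<Gamma>" using H(1) by simp
  have fgG: "\<forall>N\<in>?\<Gamma>. fg_module R N"
    using Z.fg_module_image[OF Hi Qfg] H(2) by auto
  have dec: "\<exists>(k::nat) L. L \<in> {..<k} \<rightarrow> ?\<Gamma> \<and> module_isomorphic R (Z.image_module f) (direct_sum_module {..<k} L)"
    if "f \<in> idempotents S" "f \<in> corner S (e n)" for f n
    by (rule summand_decomposition[OF fg that H(3,2)])
  have sys: "FFRT_system R p ?\<Gamma>"
    unfolding FFRT_system_def
  proof (intro conjI fin fgG ballI)
    fix N assume "N \<in> ?\<Gamma>"
    then obtain h where h: "h \<in> H" "N = Z.image_module h" by blast
    obtain n where n: "h \<in> corner S (e n)" using h(1) H(2) by (auto simp: primitive_summands_def)
    have hc: "h \<in> carrier S" using n by (simp add: corner_def)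
    obtain k :: nat and L where L: "L \<in> {..<k} \<rightarrow> ?\<Gamma>"
      "module_isomorphic R (Z.image_module (shift n h)) (direct_sum_module {..<k} L)"
      using dec[OF shift_idempotent[OF Hi[OF h(1)] n] shift_in_corner[OF hc]] by blast
    have "module_isomorphic R (frobenius_pushforward R p 1 N) (direct_sum_module {..<k} L)"
      using module_isomorphic_trans[OF pushforward_image_isomorphic_shift[OF Hi[OF h(1)] n] L(2)] h(2) by simp
    then show "\<exists>(k::nat) L. L \<in> {..<k} \<rightarrow> ?\<Gamma> \<and>
        module_isomorphic R (frobenius_pushforward R p 1 N) (direct_sum_module {..<k} L)"
      using L(1) by blast
  qed
  have "FFRT_by R p M ?\<Gamma>"
    unfolding FFRT_by_def
  proof (intro conjI fin fgG allI impI)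
    fix m :: nat assume "m > 0"
    then obtain n where m: "m = Suc n" by (cases m) auto
    have "e n \<in> corner S (e n)" using e_idempotent[of n] by (simp add: corner_def idempotents_def)
    then obtain k :: nat and L where L: "L \<in> {..<k} \<rightarrow> ?\<Gamma>"
      "module_isomorphic R (Z.image_module (e n)) (direct_sum_module {..<k} L)"
      using dec[OF e_idempotent] by blast
    obtain t :: "('a, nat \<Rightarrow> 'b) module \<Rightarrow> nat" where t: "module_isomorphic R (direct_sum_module {..<k} L)
        (direct_sum_module (SIGMA N:?\<Gamma>. {..<t N}) fst)"
      using direct_sum_with_multiplicities[OF fin L(1)] by blast
    show "\<exists>t :: ('a, nat \<Rightarrow> 'b) module \<Rightarrow> nat. module_isomorphic R (frobenius_pushforward R p m M) (direct_sum_module (SIGMA N:?\<Gamma>. {..<t N}) fst)"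
      unfolding m
      using module_isomorphic_trans[OF module_isomorphic_trans[OF pushforward_isomorphic_image_e L(2)] t] by blast
  qed
  with sys show ?thesis by (rule has_FFRT_by_system_I)
qed

end

context frobenius_tower
begin

text \<open>The decompositions of the pushforwards are turned into idempotents of \<open>S\<close>. Each \<open>N\<close> in \<open>\<Gamma>\<close> that
occurs at all is embedded once and for all as a direct summand \<open>u N\<close> of \<open>Z\<close>, through the inclusion
\<open>\<alpha>0 N\<close> and the projection \<open>\<beta>0 N\<close>; every other occurrence of \<open>N\<close> factors through this copy.\<close>
theorem FFRT_imp_system:
  fixes \<Gamma> :: "('a, 'c) module set" and t :: "nat \<Rightarrow> ('a, 'c) module \<Rightarrow> nat"
  assumes fin: "finite \<Gamma>" and fg: "\<And>N. N \<in> \<Gamma> \<Longrightarrow> fg_module R N"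
    and \<theta>: "\<And>n. \<theta> n \<in> module_iso R (F n) (direct_sum_module (SIGMA N:\<Gamma>. {..<t n N}) fst)"
  shows "has_FFRT_by_system R p M"
proof -
  define I where "I n = (SIGMA N:\<Gamma>. {..<t n N})" for n
  define D where "D n = direct_sum_module (I n) (fst :: ('a, 'c) module \<times> nat \<Rightarrow> _)" for n
  have finI: "finite (I n)" for n using fin by (simp add: I_def)
  have modI: "module R (fst i)" "fg_module R (fst i)" if "i \<in> I n" for n i
    using that fg by (auto simp: I_def fg_module_def)
  define \<gamma> where "\<gamma> n y = inj n (inv_into (carrier (F n)) (\<theta> n) y)" for n y
  define \<delta> where "\<delta> n z = \<theta> n (proj n z)" for n z
  have iso: "\<theta> n \<in> module_iso R (F n) (D n)" for n using \<theta> by (simp add: D_def I_def)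
  have \<gamma>: "linear_map R (D n) Z (\<gamma> n)" for n
    unfolding \<gamma>_def[abs_def]
    by (rule linear_map_comp[OF module_iso_inverse_linear[OF module_pushforward iso] inj_linear])
  have \<delta>: "linear_map R Z (D n) (\<delta> n)" for n
    unfolding \<delta>_def[abs_def] by (rule linear_map_comp[OF proj_linear module_iso_inverse(1)[OF iso]])
  have \<gamma>\<delta>: "\<gamma> n (\<delta> n z) = e n z" if z: "z \<in> carrier Z" for n z
    using module_iso_inverse(2)[OF iso, of "proj n z" n] proj_closed[OF z] by (simp add: \<gamma>_def \<delta>_def e_apply[OF z])
  have \<delta>\<gamma>: "\<delta> n (\<gamma> n y) = y" if "y \<in> carrier (D n)" for n y
    using module_iso_inverse(3)[OF iso that] by (simp add: \<gamma>_def \<delta>_def)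
  have e\<gamma>: "e n (\<gamma> n y) = \<gamma> n y" if y: "y \<in> carrier (D n)" for n y
    using \<gamma>\<delta>[OF linear_mapD(1)[OF \<gamma> y], of n] \<delta>\<gamma>[OF y] by simp
  define \<iota> where "\<iota> n = summand_inj (I n) (fst :: ('a, 'c) module \<times> nat \<Rightarrow> _)" for n
  have \<iota>: "linear_map R (fst i) (D n) (\<iota> n i)" if "i \<in> I n" for n i
    unfolding \<iota>_def D_def by (rule summand_inj_linear[OF modI(1) that])
  define \<alpha> where "\<alpha> n i x = \<gamma> n (\<iota> n i x)" for n i x
  define \<beta> where "\<beta> n i z = \<delta> n z i" for n i z
  have \<alpha>: "linear_map R (fst i) Z (\<alpha> n i)" if "i \<in> I n" for n i
    unfolding \<alpha>_def[abs_def] by (rule linear_map_comp[OF \<iota>[OF that] \<gamma>])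
  have \<beta>: "linear_map R Z (fst i) (\<beta> n i)" if "i \<in> I n" for n i
    unfolding \<beta>_def[abs_def]
    by (rule linear_map_comp[OF \<delta>[unfolded D_def] summand_proj_linear[OF that]])
  have \<beta>\<alpha>: "\<beta> n i (\<alpha> n i x) = x" if "i \<in> I n" "x \<in> carrier (fst i)" for n i x
    using \<delta>\<gamma>[OF linear_mapD(1)[OF \<iota>[OF that(1)] that(2)]] that(1)
    by (simp add: \<alpha>_def \<beta>_def \<iota>_def summand_inj_def)
  have e\<alpha>: "e n (\<alpha> n i x) = \<alpha> n i x" if "i \<in> I n" "x \<in> carrier (fst i)" for n i x
    unfolding \<alpha>_def by (rule e\<gamma>[OF linear_mapD(1)[OF \<iota>[OF that(1)] that(2)]])
  define f where "f n i = Z.to_endo (\<lambda>z. \<alpha> n i (\<beta> n i z))" for n i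
  have fc: "f n i \<in> carrier S" if "i \<in> I n" for n i
    unfolding f_def by (rule Z.to_endo_closed[OF linear_map_comp[OF \<beta>[OF that] \<alpha>[OF that]]])
  have e_sum: "e n = (\<Oplus>\<^bsub>S\<^esub>i\<in>I n. f n i)" for n
  proof (rule Z.endo_ext[OF e_closed])
    show "(\<Oplus>\<^bsub>S\<^esub>i\<in>I n. f n i) \<in> carrier S" using fc by (intro Z.S.finsum_closed) auto
    fix z assume z: "z \<in> carrier Z"
    have "e n z = \<gamma> n (\<delta> n z)" using \<gamma>\<delta>[OF z] by simp
    also have "\<dots> = (\<Oplus>\<^bsub>Z\<^esub>i\<in>I n. \<gamma> n (summand_inj (I n) fst i (\<delta> n z i)))"
      by (rule linear_map_direct_sum_expand[OF cring_R modI(1) finI module_Z \<gamma>[unfolded D_def]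
          linear_mapD(1)[OF \<delta>[unfolded D_def] z]])
    also have "\<dots> = (\<Oplus>\<^bsub>Z\<^esub>i\<in>I n. f n i z)"
      using z Z.endo_closed[OF fc z]
      by (intro Z.M.finsum_cong') (auto simp: f_def \<alpha>_def \<beta>_def \<iota>_def)
    also have "\<dots> = (\<Oplus>\<^bsub>S\<^esub>i\<in>I n. f n i) z"
      using fc z by (intro Z.endo_finsum[symmetric]) auto
    finally show "e n z = (\<Oplus>\<^bsub>S\<^esub>i\<in>I n. f n i) z" .
  qed
  have fg_e: "Z.fg_image (e n)" for n
  proof (rule Z.fg_image_finsum[OF finI _ _ e_sum])
    fix i assume i: "i \<in> I n"
    show "f n i \<in> carrier S" by (rule fc[OF i])
    show "Z.fg_image (f n i)"
      unfolding f_def by (rule Z.retract_fg_image[OF modI(2)[OF i] \<alpha>[OF i] \<beta>[OF i] \<beta>\<alpha>[OF i]])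
    show "e n \<otimes>\<^bsub>S\<^esub> f n i = f n i"
      using e_closed fc[OF i] e\<alpha>[OF i linear_mapD(1)[OF \<beta>[OF i]]]
      by (intro Z.endo_ext) (auto simp: f_def)
  qed
  define \<Gamma>' where "\<Gamma>' = {N \<in> \<Gamma>. \<exists>n. (N, 0) \<in> I n}"
  define \<nu> where "\<nu> N = (SOME n. (N, 0) \<in> I n)" for N
  have \<nu>: "(N, 0) \<in> I (\<nu> N)" if "N \<in> \<Gamma>'" for N
    using that unfolding \<Gamma>'_def \<nu>_def by (auto intro: someI_ex)
  have I\<Gamma>: "fst i \<in> \<Gamma>'" if "i \<in> I n" for n i
    using that by (auto simp: \<Gamma>'_def I_def intro!: exI[of _ n])
  define \<alpha>0 where "\<alpha>0 N = \<alpha> (\<nu> N) (N, 0)" for N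
  define \<beta>0 where "\<beta>0 N = \<beta> (\<nu> N) (N, 0)" for N
  have \<alpha>0: "linear_map R N Z (\<alpha>0 N)" and \<beta>0: "linear_map R Z N (\<beta>0 N)"
    and \<beta>\<alpha>0: "\<And>x. x \<in> carrier N \<Longrightarrow> \<beta>0 N (\<alpha>0 N x) = x" if "N \<in> \<Gamma>'" for N
    using \<alpha>[OF \<nu>[OF that]] \<beta>[OF \<nu>[OF that]] \<beta>\<alpha>[OF \<nu>[OF that]] by (simp_all add: \<alpha>0_def \<beta>0_def)
  define u where "u N = Z.to_endo (\<lambda>z. \<alpha>0 N (\<beta>0 N z))" for N
  show ?thesis
  proof (rule system_of_primitive_summands[where U = "u ` \<Gamma>'"])
    show "finite (u ` \<Gamma>')" using fin by (simp add: \<Gamma>'_def)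
    show "w \<in> idempotents S \<and> Z.fg_image w" if w: "w \<in> u ` \<Gamma>'" for w
    proof -
      obtain N where N: "N \<in> \<Gamma>'" "w = u N" using w by blast
      then have "fg_module R N" using fg by (simp add: \<Gamma>'_def)
      then show ?thesis
        unfolding N(2) u_def
        using Z.retract_idempotent[OF \<alpha>0 \<beta>0 \<beta>\<alpha>0] Z.retract_fg_image[OF _ \<alpha>0 \<beta>0 \<beta>\<alpha>0] N(1) by blast
    qed
    show "Z.fg_image (e n)" for n by (rule fg_e)
    show "\<exists>(J :: (('a, 'c) module \<times> nat) set) a v b. finite J \<and> a \<in> J \<rightarrow> carrier S \<and> b \<in> J \<rightarrow> carrier S \<and>
        v \<in> J \<rightarrow> u ` \<Gamma>' \<and> (\<Oplus>\<^bsub>S\<^esub>i\<in>J. a i \<otimes>\<^bsub>S\<^esub> v i \<otimes>\<^bsub>S\<^esub> b i) = e n" for n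
    proof -
      define a where "a i = Z.to_endo (\<lambda>z. \<alpha> n i (\<beta>0 (fst i) z))" for i
      define b where "b i = Z.to_endo (\<lambda>z. \<alpha>0 (fst i) (\<beta> n i z))" for i
      have ac: "a i \<in> carrier S" if "i \<in> I n" for i
        unfolding a_def by (rule Z.to_endo_closed[OF linear_map_comp[OF \<beta>0[OF I\<Gamma>[OF that]] \<alpha>[OF that]]])
      have bc: "b i \<in> carrier S" if "i \<in> I n" for i
        unfolding b_def by (rule Z.to_endo_closed[OF linear_map_comp[OF \<beta>[OF that] \<alpha>0[OF I\<Gamma>[OF that]]]])
      have uc: "u (fst i) \<in> carrier S" if "i \<in> I n" for i
        unfolding u_def
        by (rule Z.to_endo_closed[OF linear_map_comp[OF \<beta>0[OF I\<Gamma>[OF that]] \<alpha>0[OF I\<Gamma>[OF that]]]])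
      have "a i \<otimes>\<^bsub>S\<^esub> u (fst i) \<otimes>\<^bsub>S\<^esub> b i = f n i" if i: "i \<in> I n" for i
      proof (rule Z.endo_ext)
        show "a i \<otimes>\<^bsub>S\<^esub> u (fst i) \<otimes>\<^bsub>S\<^esub> b i \<in> carrier S" "f n i \<in> carrier S"
          using ac[OF i] bc[OF i] uc[OF i] fc[OF i] by simp_all
        fix z assume z: "z \<in> carrier Z"
        note N = I\<Gamma>[OF i]
        let ?x = "\<beta> n i z"
        have x: "?x \<in> carrier (fst i)" by (rule linear_mapD(1)[OF \<beta>[OF i] z])
        have y: "\<alpha>0 (fst i) ?x \<in> carrier Z" by (rule linear_mapD(1)[OF \<alpha>0[OF N] x])
        have "u (fst i) (b i z) = \<alpha>0 (fst i) ?x"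
          using z y \<beta>\<alpha>0[OF N x] by (simp add: u_def b_def)
        then have "a i (u (fst i) (b i z)) = \<alpha> n i ?x" using y \<beta>\<alpha>0[OF N x] by (simp add: a_def)
        then show "(a i \<otimes>\<^bsub>S\<^esub> u (fst i) \<otimes>\<^bsub>S\<^esub> b i) z = f n i z"
          using z Z.endo_closed[OF bc[OF i] z] by (simp add: f_def)
      qed
      then have "(\<Oplus>\<^bsub>S\<^esub>i\<in>I n. a i \<otimes>\<^bsub>S\<^esub> u (fst i) \<otimes>\<^bsub>S\<^esub> b i) = e n"
        unfolding e_sum using fc by (intro Z.S.add.finprod_cong') auto
      then show ?thesis using finI ac bc I\<Gamma>
        by (intro exI[of _ "I n"] exI[of _ a] exI[of _ "\<lambda>i. u (fst i)"] exI[of _ b]) auto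
    qed
  qed
qed

end

section \<open>The FFRT system\<close>

lemma abelian_group_pushforward:
  assumes "module R M"
  shows "abelian_group (frobenius_pushforward R p n M)"
proof -
  interpret module R M by fact
  show ?thesis
  proof (rule abelian_groupI)
    fix x assume "x \<in> carrier (frobenius_pushforward R p n M)"
    then show "\<exists>y\<in>carrier (frobenius_pushforward R p n M).
        y \<oplus>\<^bsub>frobenius_pushforward R p n M\<^esub> x = \<zero>\<^bsub>frobenius_pushforward R p n M\<^esub>"
      by (auto simp: frobenius_pushforward_def M.l_neg intro!: bexI[of _ "\<ominus>\<^bsub>M\<^esub> x"])
  qed (auto simp: frobenius_pushforward_def M.a_ac)
qed

theorem theorem4p9:
  fixes R :: "('a, 'r) ring_scheme" and M :: "('a, 'b, 'm) module_scheme" and p :: nat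
  assumes "noetherian_ring R"
    and "local_ring R"
    and "has_prime_char R p"
    and "fg_module R M"
    and "has_FFRT R p M"
  shows "has_FFRT_by_system R p M"
proof -
  interpret M: module R M using assms(4) by (simp add: fg_module_def)
  obtain \<mm> where mm: "ideal \<mm> R" "\<one>\<^bsub>R\<^esub> \<notin> \<mm>" "carrier R - \<mm> \<subseteq> Units R"
    by (rule local_ring_nonunits_ideal[OF assms(2)])
  obtain \<Gamma> :: "'a fg_mod set" where \<Gamma>: "FFRT_by R p M \<Gamma>" using assms(5) by (auto simp: has_FFRT_def)
  then have fin: "finite \<Gamma>" and fg: "\<And>N. N \<in> \<Gamma> \<Longrightarrow> fg_module R N" by (auto simp: FFRT_by_def)
  have "\<forall>n. \<exists>t :: 'a fg_mod \<Rightarrow> nat. module_isomorphic R (frobenius_pushforward R p (Suc n) M)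
      (direct_sum_module (SIGMA N:\<Gamma>. {..<t N}) fst)"
    using \<Gamma> by (auto simp: FFRT_by_def)
  from choice[OF this] obtain t :: "nat \<Rightarrow> 'a fg_mod \<Rightarrow> nat" where
    t: "\<forall>n. module_isomorphic R (frobenius_pushforward R p (Suc n) M)
      (direct_sum_module (SIGMA N:\<Gamma>. {..<t n N}) fst)" by blast
  then have "\<forall>n. \<exists>\<theta>. \<theta> \<in> module_iso R (frobenius_pushforward R p (Suc n) M)
      (direct_sum_module (SIGMA N:\<Gamma>. {..<t n N}) fst)"
    by (auto simp: module_isomorphic_def)
  from choice[OF this] obtain \<theta> where
    \<theta>: "\<And>n. \<theta> n \<in> module_iso R (frobenius_pushforward R p (Suc n) M)
      (direct_sum_module (SIGMA N:\<Gamma>. {..<t n N}) fst)" by blast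
  have mod: "module R (frobenius_pushforward R p (Suc n) M)" for n
  proof (rule module_from_iso[OF abelian_group_pushforward[OF M.module_axioms] _ _ \<theta>])
    show "module R (direct_sum_module (SIGMA N:\<Gamma>. {..<t n N}) fst)"
      using fg by (intro module_direct_sum[OF M.is_cring]) (auto simp: fg_module_def)
  qed (auto simp: frobenius_pushforward_def)
  interpret frobenius_tower R M p \<mm>
    using mm mod by (simp add: frobenius_tower_def)
  show ?thesis by (rule FFRT_imp_system[OF fin fg \<theta>])
qed

end
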